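(* Let $\gamma\in\mathbb{R}$ with $\gamma\neq-1/2$. Then for every axisymmetric divergence-free vector field $\mathbf{u}\in C_0^\infty(\mathbb{R}^3)$, which is assumed in addition to satisfy $\mathbf{u}(\mathbf{0})=\mathbf{0}$ in the case $\gamma<-1/2$, the inequality $$\int_{\mathbb{R}^3}|x|^{2\gamma-2}|\mathbf{u}|^2\,dx\le C_{3,\gamma}\int_{\mathbb{R}^3}|x|^{2\gamma}|\nabla\mathbf{u}|^2\,dx$$ holds with the best (smallest possible) constant $$C_{3,\gamma}=\begin{cases}\dfrac{4}{(2\gamma+1)^2}\cdot\dfrac{2+(\gamma-3/2)^2}{4+(\gamma-3/2)^2}, & \gamma\le 1,\\[3mm] \dfrac{4}{8+(1+2\gamma)^2}, & \gamma>1.\end{cases}$$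
   Context: Vector fields $\mathbf{u}:\mathbb{R}^3\to\mathbb{R}^3$ are real; $C_0^\infty(\mathbb{R}^3)$ denotes smooth compactly supported fields; $|\nabla\mathbf{u}|^2=\sum_{i,j}(\partial_{x_i}u_j)^2$ in Cartesian coordinates. Axial symmetry: let $(\rho,\theta,\varphi)$ be the usual spherical coordinates, $\rho=|x|>0$, $\theta\in[0,\pi]$ the angle between $x$ and a fixed axis, $\varphi\in[0,2\pi)$ the azimuthal angle around that axis, and write $\mathbf{u}=(u_\rho,u_\theta,u_\varphi)$ for the components of $\mathbf{u}$ in the local orthonormal frame of unit vectors in the coordinate directions. The field $\mathbf{u}$ is called axisymmetric if $u_\rho,u_\theta,u_\varphi$ depend only on $\rho$ and $\theta$ (the component $u_\varphi$ need not vanish). *)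

theory Defs
  imports "HOL-Analysis.Analysis"
begin

text \<open>C-k regularity on the whole space: all iterated partial derivatives up to order k exist
  as total derivatives and are continuous.\<close>

primrec Ck :: "nat \<Rightarrow> ('a::euclidean_space \<Rightarrow> 'b::real_normed_vector) \<Rightarrow> bool" where
  "Ck 0 f \<longleftrightarrow> continuous_on UNIV f"
| "Ck (Suc k) f \<longleftrightarrow> (\<forall>x. f differentiable (at x)) \<and>
     (\<forall>v\<in>Basis. Ck k (\<lambda>x. frechet_derivative f (at x) v))"

definition test_field :: "(real^3 \<Rightarrow> real^3) \<Rightarrow> bool" where
  "test_field u \<longleftrightarrow> (\<forall>k. Ck k u) \<and> compact (closure {x. u x \<noteq> 0})"

text \<open>The entry \<open>jacobian u (at x) $ j $ i\<close> is the partial derivative of the j-th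
  component of u in the i-th coordinate direction.\<close>

definition divergence :: "(real^3 \<Rightarrow> real^3) \<Rightarrow> real^3 \<Rightarrow> real" where
  "divergence u x = (\<Sum>i\<in>UNIV. jacobian u (at x) $ i $ i)"

definition grad_sq :: "(real^3 \<Rightarrow> real^3) \<Rightarrow> real^3 \<Rightarrow> real" where
  "grad_sq u x = (\<Sum>i\<in>UNIV. \<Sum>j\<in>UNIV. (jacobian u (at x) $ j $ i)\<^sup>2)"

text \<open>Spherical coordinates about the axis spanned by c, with the azimuth measured from a towards b.
  Reversing the orientation of (a, b, c) only changes the sign of the azimuthal component, so
  right-handedness is not required.\<close>

definition orthonormal_frame :: "real^3 \<Rightarrow> real^3 \<Rightarrow> real^3 \<Rightarrow> bool" where
  "orthonormal_frame a b c \<longleftrightarrow>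
     norm a = 1 \<and> norm b = 1 \<and> norm c = 1 \<and> orthogonal a b \<and> orthogonal a c \<and> orthogonal b c"

definition e_rho :: "real^3 \<Rightarrow> real^3 \<Rightarrow> real^3 \<Rightarrow> real \<Rightarrow> real \<Rightarrow> real^3" where
  "e_rho a b c \<theta> \<phi> = (sin \<theta> * cos \<phi>) *\<^sub>R a + (sin \<theta> * sin \<phi>) *\<^sub>R b + cos \<theta> *\<^sub>R c"

definition e_theta :: "real^3 \<Rightarrow> real^3 \<Rightarrow> real^3 \<Rightarrow> real \<Rightarrow> real \<Rightarrow> real^3" where
  "e_theta a b c \<theta> \<phi> = (cos \<theta> * cos \<phi>) *\<^sub>R a + (cos \<theta> * sin \<phi>) *\<^sub>R b - sin \<theta> *\<^sub>R c"

definition e_phi :: "real^3 \<Rightarrow> real^3 \<Rightarrow> real \<Rightarrow> real^3" where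
  "e_phi a b \<phi> = - sin \<phi> *\<^sub>R a + cos \<phi> *\<^sub>R b"

definition axisymmetric :: "real^3 \<Rightarrow> real^3 \<Rightarrow> real^3 \<Rightarrow> (real^3 \<Rightarrow> real^3) \<Rightarrow> bool" where
  "axisymmetric a b c u \<longleftrightarrow>
     (\<exists>u\<^sub>\<rho> u\<^sub>\<theta> u\<^sub>\<phi> :: real \<Rightarrow> real \<Rightarrow> real.
        \<forall>\<rho>>0. \<forall>\<theta>\<in>{0..pi}. \<forall>\<phi>\<in>{0..<2*pi}.
          u (\<rho> *\<^sub>R e_rho a b c \<theta> \<phi>) =
            u\<^sub>\<rho> \<rho> \<theta> *\<^sub>R e_rho a b c \<theta> \<phi> + u\<^sub>\<theta> \<rho> \<theta> *\<^sub>R e_theta a b c \<theta> \<phi> + u\<^sub>\<phi> \<rho> \<theta> *\<^sub>R e_phi a b \<phi>)"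

definition admissible :: "real^3 \<Rightarrow> real^3 \<Rightarrow> real^3 \<Rightarrow> real \<Rightarrow> (real^3 \<Rightarrow> real^3) \<Rightarrow> bool" where
  "admissible a b c \<gamma> u \<longleftrightarrow>
     test_field u \<and> axisymmetric a b c u \<and> (\<forall>x. divergence u x = 0) \<and>
     (\<gamma> < -1/2 \<longrightarrow> u 0 = 0)"

text \<open>For very negative \<open>\<gamma>\<close> both integrals can diverge, so they take values in the
  extended nonnegative reals. For negative C the value of \<open>ennreal C\<close> is 0.\<close>

definition hardy_leray :: "real^3 \<Rightarrow> real^3 \<Rightarrow> real^3 \<Rightarrow> real \<Rightarrow> real \<Rightarrow> bool" where
  "hardy_leray a b c \<gamma> C \<longleftrightarrow>
     (\<forall>u. admissible a b c \<gamma> u \<longrightarrow>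
        (\<integral>\<^sup>+x. ennreal (norm x powr (2*\<gamma> - 2) * (norm (u x))\<^sup>2) \<partial>lborel)
          \<le> ennreal C * (\<integral>\<^sup>+x. ennreal (norm x powr (2*\<gamma>) * grad_sq u x) \<partial>lborel))"

definition C3 :: "real \<Rightarrow> real" where
  "C3 \<gamma> =
     (if \<gamma> \<le> 1 then 4 / (2*\<gamma> + 1)\<^sup>2 * ((2 + (\<gamma> - 3/2)\<^sup>2) / (4 + (\<gamma> - 3/2)\<^sup>2))
      else 4 / (8 + (1 + 2*\<gamma>)\<^sup>2))"

end

theory Submission
  imports Defs
begin

text \<open>Let \<open>p\<close>, \<open>q\<close>, \<open>w\<close> be the radial, polar and azimuthal components of \<open>u\<close>, put \<open>s = \<gamma> + 1/2\<close> and
  write the optimal constant as \<open>1 / (s\<^sup>2 + k)\<close>, where \<open>0 \<le> k \<le> 2\<close>. The divergence equation reads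
  \<open>r p\<^sub>r + 2 p + (q\<^sub>\<theta> + q cot \<theta>) = 0\<close>. On each sphere, completing squares (the ground states are \<open>cos \<theta>\<close> for \<open>p\<close>,
  which has mean zero, and \<open>sin \<theta>\<close> for \<open>q\<close> and \<open>w\<close>) shows that the angular gradient energy of \<open>(p, q)\<close>
  dominates \<open>(r p\<^sub>r)\<^sup>2\<close>, that \<open>2 q\<^sup>2\<close> is dominated by \<open>(r p\<^sub>r + 2 p)\<^sup>2\<close>, and that \<open>2 w\<^sup>2\<close> is dominated by the
  angular gradient energy of \<open>w\<close>. Along each ray the Hardy inequality applies to \<open>q\<close> and \<open>w\<close>, and what
  remains is \<open>(s\<^sup>2 + k) p\<^sup>2 + (k/2) (r p\<^sub>r + 2 p)\<^sup>2 \<le> 2 (r p\<^sub>r)\<^sup>2\<close> after integration, which is again a completed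
  square as soon as \<open>k (s\<^sup>2/2 - 2 s + 3) \<le> s\<^sup>2\<close>. All integrals live in \<open>[0, \<infinity>]\<close>, so that finiteness is not an issue.

  For sharpness one takes fields of degree one in the polar angle and with radial profile \<open>r\<close> to the power \<open>- s\<close>,
  cut off on a logarithmic scale: poloidal for \<open>\<gamma> \<le> 1\<close>, a pure swirl for \<open>\<gamma> > 1\<close>. The excess terms carry derivatives
  of the cutoff and disappear as it is stretched.\<close>

section \<open>Orthonormal frames\<close>

text \<open>The condition on \<open>k\<close> is the remaining radial inequality tested on its
  critical power: if \<open>p\<close> is \<open>r\<close> to the power \<open>- s\<close>, then
  \<open>r p_r = - s p\<close>, and it reads \<open>s^2 + k + (k/2) (2 - s)^2 \<le> 2 s^2\<close>.
  The bound \<open>k \<le> 2\<close> comes from the swirl, where the angular energy controls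
  \<open>2 w^2\<close> and no more. The best \<open>k\<close> is thus the smaller of
  \<open>2\<close> and \<open>2 s^2 / (2 + (2 - s)^2)\<close>. The two agree at
  \<open>s = 3/2\<close>, that is at \<open>\<gamma> = 1\<close>, which explains the case
  distinction in \<open>C3\<close>.

  The factor 2 on the right arises because \<open>(r p_r)^2\<close> is used twice: once as radial
  energy of \<open>p\<close>, once as lower bound for the angular energy of \<open>(p, q)\<close>.

  The delicate point is the boundary term \<open>r^(2s) f^2\<close> at the origin. For
  \<open>s > 0\<close> it vanishes because the components stay bounded. For \<open>s < 0\<close> the
  weight blows up; then \<open>u 0 = 0\<close> makes the components tend to zero, and a finite
  weighted radial energy makes them do so fast enough. If that energy is infinite, there is nothing
  to prove.\<close>

lemma orthonormal_frame_complete: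
  assumes "orthonormal_frame e1 e2 e3"
  shows "e1 $ i * e1 $ j + e2 $ i * e2 $ j + e3 $ i * e3 $ j = (if i = j then 1 else 0)"
proof -
  define A :: "real^3^3" where "A = vector [e1, e2, e3]"
  have "A ** transpose A = mat 1"
    using assms
    unfolding A_def orthonormal_frame_def orthogonal_def norm_eq_1
    by (simp add: vec_eq_iff forall_3 matrix_matrix_mult_def transpose_def mat_def inner_vec_def sum_3
        vector_3 mult.commute)
  \<comment> \<open>For a square matrix a right inverse is a left inverse: orthonormal rows force
    orthonormal columns, which is the completeness relation.\<close>
  then have "transpose A ** A = mat 1"
    using matrix_left_right_inverse by blast
  then have "(transpose A ** A) $ i $ j = (mat 1 :: real^3^3) $ i $ j"
    by simp
  then show ?thesis
    by (simp add: matrix_matrix_mult_def transpose_def mat_def sum_3 A_def vector_3)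
qed

lemma parseval_frame:
  assumes "orthonormal_frame e1 e2 e3"
  shows "v \<bullet> w = (v \<bullet> e1) * (w \<bullet> e1) + (v \<bullet> e2) * (w \<bullet> e2) + (v \<bullet> e3) * (w \<bullet> e3)"
proof -
  note c = orthonormal_frame_complete[OF assms]
  have "(v \<bullet> e1) * (w \<bullet> e1) + (v \<bullet> e2) * (w \<bullet> e2) + (v \<bullet> e3) * (w \<bullet> e3)
    = (\<Sum>i\<in>UNIV. \<Sum>j\<in>UNIV. v $ i * w $ j * (e1 $ i * e1 $ j + e2 $ i * e2 $ j + e3 $ i * e3 $ j))"
    by (simp add: inner_vec_def sum_3 algebra_simps)
  also have "\<dots> = v \<bullet> w"
    unfolding c by (simp add: inner_vec_def sum_3)
  finally show ?thesis by simp
qed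

lemma norm_sq_frame:
  assumes "orthonormal_frame e1 e2 e3"
  shows "(norm v)\<^sup>2 = (v \<bullet> e1)\<^sup>2 + (v \<bullet> e2)\<^sup>2 + (v \<bullet> e3)\<^sup>2"
  using parseval_frame[OF assms, of v v] unfolding power2_norm_eq_inner by (simp add: power2_eq_square)

lemma frame_expansion:
  assumes "orthonormal_frame e1 e2 e3"
  shows "v = (v \<bullet> e1) *\<^sub>R e1 + (v \<bullet> e2) *\<^sub>R e2 + (v \<bullet> e3) *\<^sub>R e3"
proof -
  have "w \<bullet> v = w \<bullet> ((v \<bullet> e1) *\<^sub>R e1 + (v \<bullet> e2) *\<^sub>R e2 + (v \<bullet> e3) *\<^sub>R e3)" for w
    using parseval_frame[OF assms, of w v] by (simp add: inner_add_right mult.commute)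
  then show ?thesis
    by (metis vector_eq_ldot)
qed

text \<open>The Frobenius norm of the Jacobian is the same in every orthonormal frame, so the moving
  spherical frame may replace the Cartesian one at each point. Swapping the double sum groups it by
  rows of the Jacobian, and Parseval applies to each row.\<close>

lemma grad_sq_frame:
  assumes "orthonormal_frame e1 e2 e3" and u: "(u has_derivative D) (at x)"
  shows "grad_sq u x = (norm (D e1))\<^sup>2 + (norm (D e2))\<^sup>2 + (norm (D e3))\<^sup>2"
proof -
  let ?J = "jacobian u (at x)"
  have D: "D = frechet_derivative u (at x)"
    using u by (rule frechet_derivative_at)
  have DJ: "D v = ?J *v v" for v
    unfolding jacobian_def D[symmetric]
    using u by (simp add: has_derivative_bounded_linear bounded_linear.linear)
  have DJk: "D v $ k = ?J $ k \<bullet> v" for v k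
    by (simp add: DJ matrix_vector_mult_def inner_vec_def)
  have r: "(\<Sum>i\<in>UNIV. (?J $ k $ i)\<^sup>2) = (?J $ k \<bullet> e1)\<^sup>2 + (?J $ k \<bullet> e2)\<^sup>2 + (?J $ k \<bullet> e3)\<^sup>2" for k
    using parseval_frame[OF assms(1), of "?J $ k" "?J $ k"] by (simp add: inner_vec_def power2_eq_square)
  have "grad_sq u x = (\<Sum>k\<in>UNIV. \<Sum>i\<in>UNIV. (?J $ k $ i)\<^sup>2)"
    unfolding grad_sq_def by (rule sum.swap)
  also have "\<dots> = (\<Sum>k\<in>UNIV. (D e1 $ k)\<^sup>2) + (\<Sum>k\<in>UNIV. (D e2 $ k)\<^sup>2) + (\<Sum>k\<in>UNIV. (D e3 $ k)\<^sup>2)"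
    unfolding r DJk by (simp add: sum.distrib)
  also have "\<dots> = (norm (D e1))\<^sup>2 + (norm (D e2))\<^sup>2 + (norm (D e3))\<^sup>2"
    unfolding power2_norm_eq_inner by (simp add: inner_vec_def power2_eq_square)
  finally show ?thesis .
qed

text \<open>Invariance of the trace: the completeness relation collapses the double sum over matrix
  entries to the diagonal.\<close>

lemma divergence_frame:
  assumes "orthonormal_frame e1 e2 e3" and u: "(u has_derivative D) (at x)"
  shows "divergence u x = D e1 \<bullet> e1 + D e2 \<bullet> e2 + D e3 \<bullet> e3"
proof -
  let ?J = "jacobian u (at x)"
  have D: "D = frechet_derivative u (at x)"
    using u by (rule frechet_derivative_at)
  have DJ: "D v = ?J *v v" for v
    unfolding jacobian_def D[symmetric]
    using u by (simp add: has_derivative_bounded_linear bounded_linear.linear)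
  have "D e1 \<bullet> e1 + D e2 \<bullet> e2 + D e3 \<bullet> e3
      = (\<Sum>i\<in>UNIV. \<Sum>j\<in>UNIV. ?J $ i $ j * (e1 $ i * e1 $ j + e2 $ i * e2 $ j + e3 $ i * e3 $ j))"
    by (simp add: DJ matrix_vector_mult_def inner_vec_def sum_3 algebra_simps)
  also have "\<dots> = divergence u x"
    unfolding orthonormal_frame_complete[OF assms(1)] divergence_def by (simp add: sum_3)
  finally show ?thesis by simp
qed

context
  fixes a b c :: "real^3"
  assumes frame: "orthonormal_frame a b c"
begin

lemma frame_inner:
  "a \<bullet> a = 1" "b \<bullet> b = 1" "c \<bullet> c = 1" "a \<bullet> b = 0" "b \<bullet> a = 0" "a \<bullet> c = 0" "c \<bullet> a = 0" "b \<bullet> c = 0" "c \<bullet> b = 0"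
  using frame by (auto simp: orthonormal_frame_def orthogonal_def norm_eq_1 inner_commute)

lemma spherical_frame:
  "orthonormal_frame (e_rho a b c \<theta> \<phi>) (e_theta a b c \<theta> \<phi>) (e_phi a b \<phi>)"
proof -
  have s: "(sin \<theta>)\<^sup>2 + (cos \<theta>)\<^sup>2 = 1" "(sin \<phi>)\<^sup>2 + (cos \<phi>)\<^sup>2 = 1" by simp_all
  show ?thesis
    unfolding orthonormal_frame_def orthogonal_def norm_eq_1 e_rho_def e_theta_def e_phi_def
    using s by (simp add: inner_simps frame_inner del: sin_cos_squared_add) (intro conjI; algebra)
qed

end

section \<open>Integration in spherical coordinates\<close>

lemma prod_Basis_vec:
  fixes x :: "real^'n"
  shows "(\<Prod>b\<in>Basis. x \<bullet> b) = (\<Prod>i\<in>UNIV. x $ i)"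
proof -
  have B: "(Basis :: (real^'n) set) = range (\<lambda>i. axis i 1)"
    by (auto simp: Basis_vec_def)
  have "inj (\<lambda>i. axis i 1 :: real^'n)"
    by (simp add: inj_on_def axis_eq_axis)
  then show ?thesis
    unfolding B by (simp add: prod.reindex inner_axis)
qed

lemma measurable_vector3:
  "(\<lambda>(x, y, z). vector [x, y, z] :: real^3) \<in> borel_measurable (lborel \<Otimes>\<^sub>M (lborel \<Otimes>\<^sub>M lborel))"
proof -
  have "(\<lambda>p. (vector [fst p, fst (snd p), snd (snd p)] :: real^3) \<bullet> axis i 1)
      \<in> borel_measurable (lborel \<Otimes>\<^sub>M (lborel \<Otimes>\<^sub>M lborel))" for i
    using exhaust_3[of i] by (auto simp: inner_axis vector_3)
  then show ?thesis
    by (subst borel_measurable_euclidean_space) (auto simp: Basis_vec_def case_prod_beta)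
qed

text \<open>A measure that gives every box its volume is Lebesgue measure, and the preimage of a box
  under the coordinate map is a product of three intervals. This opens \<open>real^3\<close> to
  iterated one-dimensional integrals.\<close>

lemma lborel_vec3:
  "(lborel :: (real^3) measure) =
     distr (lborel \<Otimes>\<^sub>M (lborel \<Otimes>\<^sub>M lborel)) borel (\<lambda>(x, y, z). vector [x, y, z])"
proof (rule lborel_eqI)
  let ?V = "\<lambda>(x::real, y::real, z::real). vector [x, y, z] :: real^3"
  have [measurable]: "?V \<in> borel_measurable (lborel \<Otimes>\<^sub>M (lborel \<Otimes>\<^sub>M lborel))"
    by (rule measurable_vector3)
  have P2: "sigma_finite_measure (lborel \<Otimes>\<^sub>M lborel :: (real \<times> real) measure)"
    unfolding lborel_prod by (rule sigma_finite_lborel)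
  fix l u :: "real^3"
  assume le: "\<And>b. b \<in> Basis \<Longrightarrow> l \<bullet> b \<le> u \<bullet> b"
  have le': "l $ i \<le> u $ i" for i
    using le[of "axis i 1"] by (simp add: inner_axis)
  have pre: "?V -` box l u \<inter> space (lborel \<Otimes>\<^sub>M (lborel \<Otimes>\<^sub>M lborel))
      = {l $ 1<..<u $ 1} \<times> ({l $ 2<..<u $ 2} \<times> {l $ 3<..<u $ 3})"
    by (auto simp: mem_box_cart forall_3 vector_3 space_pair_measure)
  have "emeasure (distr (lborel \<Otimes>\<^sub>M (lborel \<Otimes>\<^sub>M lborel)) borel ?V) (box l u)
      = emeasure (lborel \<Otimes>\<^sub>M (lborel \<Otimes>\<^sub>M lborel)) ({l $ 1<..<u $ 1} \<times> ({l $ 2<..<u $ 2} \<times> {l $ 3<..<u $ 3}))"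
    by (subst emeasure_distr) (simp_all add: pre)
  also have "\<dots> = ennreal (u $ 1 - l $ 1) * (ennreal (u $ 2 - l $ 2) * ennreal (u $ 3 - l $ 3))"
    using sigma_finite_measure.emeasure_pair_measure_Times[OF P2, of "{l $ 1<..<u $ 1}" lborel "{l $ 2<..<u $ 2} \<times> {l $ 3<..<u $ 3}"]
    by (simp add: lborel.emeasure_pair_measure_Times le')
  also have "\<dots> = ennreal (\<Prod>i\<in>UNIV. (u - l) $ i)"
    unfolding UNIV_3 using le'[of 1] le'[of 2] by (simp add: ennreal_mult' mult.assoc)
  finally show "emeasure (distr (lborel \<Otimes>\<^sub>M (lborel \<Otimes>\<^sub>M lborel)) borel ?V) (box l u) = (\<Prod>b\<in>Basis. (u - l) \<bullet> b)"
    by (simp only: prod_Basis_vec)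
qed simp

lemma nn_integral_vec3:
  fixes F :: "real^3 \<Rightarrow> ennreal"
  assumes [measurable]: "F \<in> borel_measurable borel"
  shows "(\<integral>\<^sup>+v. F v \<partial>lborel) = (\<integral>\<^sup>+x. \<integral>\<^sup>+y. \<integral>\<^sup>+z. F (vector [x, y, z]) \<partial>lborel \<partial>lborel \<partial>lborel)"
proof -
  let ?P = "lborel \<Otimes>\<^sub>M (lborel \<Otimes>\<^sub>M lborel) :: (real \<times> real \<times> real) measure"
  have V[measurable]: "(\<lambda>(x, y, z). vector [x, y, z] :: real^3) \<in> borel_measurable ?P"
    by (rule measurable_vector3)
  have [measurable]: "(\<lambda>p. F (vector [fst p, fst (snd p), snd (snd p)])) \<in> borel_measurable ?P"
    using measurable_compose[OF V assms] by (simp add: case_prod_beta)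
  have P2: "sigma_finite_measure (lborel \<Otimes>\<^sub>M lborel :: (real \<times> real) measure)"
    unfolding lborel_prod by (rule sigma_finite_lborel)
  have "(\<integral>\<^sup>+v. F v \<partial>lborel) = (\<integral>\<^sup>+p. F (vector [fst p, fst (snd p), snd (snd p)]) \<partial>?P)"
    by (subst lborel_vec3) (simp add: nn_integral_distr case_prod_beta V[unfolded case_prod_beta])
  also have "\<dots> = (\<integral>\<^sup>+x. \<integral>\<^sup>+q. F (vector [x, fst q, snd q]) \<partial>(lborel \<Otimes>\<^sub>M lborel) \<partial>lborel)"
    by (subst sigma_finite_measure.nn_integral_fst[OF P2, symmetric]) simp_all
  also have "\<dots> = (\<integral>\<^sup>+x. \<integral>\<^sup>+y. \<integral>\<^sup>+z. F (vector [x, y, z]) \<partial>lborel \<partial>lborel \<partial>lborel)"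
  proof (rule nn_integral_cong)
    fix x :: real
    have [measurable]: "(\<lambda>q. F (vector [x, fst q, snd q])) \<in> borel_measurable (lborel \<Otimes>\<^sub>M lborel)"
      using measurable_Pair2[of "\<lambda>p. F (vector [fst p, fst (snd p), snd (snd p)])" lborel "lborel \<Otimes>\<^sub>M lborel" borel x]
      by simp
    show "(\<integral>\<^sup>+q. F (vector [x, fst q, snd q]) \<partial>(lborel \<Otimes>\<^sub>M lborel)) = (\<integral>\<^sup>+y. \<integral>\<^sup>+z. F (vector [x, y, z]) \<partial>lborel \<partial>lborel)"
      by (subst lborel.nn_integral_fst[symmetric]) simp_all
  qed
  finally show ?thesis .
qed

section \<open>Change of variables to spherical coordinates\<close>

definition sph_dom :: "(real^3) set" where
  "sph_dom = {v. 0 < v $ 1 \<and> 0 < v $ 2 \<and> v $ 2 < pi \<and> 0 < v $ 3 \<and> v $ 3 < 2 * pi}"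

lemma open_sph_dom: "open sph_dom"
  unfolding sph_dom_def by (intro open_Collect_conj open_Collect_less continuous_intros)

context
  fixes a b c :: "real^3"
  assumes frame: "orthonormal_frame a b c"
begin

lemma e_rho_inner:
  "e_rho a b c \<theta> \<phi> \<bullet> a = sin \<theta> * cos \<phi>" "e_rho a b c \<theta> \<phi> \<bullet> b = sin \<theta> * sin \<phi>" "e_rho a b c \<theta> \<phi> \<bullet> c = cos \<theta>"
  by (simp_all add: e_rho_def inner_simps frame_inner[OF frame])

lemma norm_e_rho: "norm (e_rho a b c \<theta> \<phi>) = 1"
  using spherical_frame[OF frame] by (simp add: orthonormal_frame_def)

lemma spherical_map_inj: "inj_on (\<lambda>v. v $ 1 *\<^sub>R e_rho a b c (v $ 2) (v $ 3)) sph_dom"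
proof (rule inj_onI)
  fix v w assume v: "v \<in> sph_dom" and w: "w \<in> sph_dom"
    and eq: "v $ 1 *\<^sub>R e_rho a b c (v $ 2) (v $ 3) = w $ 1 *\<^sub>R e_rho a b c (w $ 2) (w $ 3)"
  have 1: "v $ 1 = w $ 1"
    using arg_cong[OF eq, of norm] v w by (simp add: norm_e_rho sph_dom_def)
  then have eq': "e_rho a b c (v $ 2) (v $ 3) = e_rho a b c (w $ 2) (w $ 3)"
    using eq v by (simp add: sph_dom_def)
  have "cos (v $ 2) = cos (w $ 2)"
    using arg_cong[OF eq', of "\<lambda>x. x \<bullet> c"] by (simp add: e_rho_inner)
  then have 2: "v $ 2 = w $ 2"
    using cos_inj_pi v w by (simp add: sph_dom_def)
  have "sin (w $ 2) > 0"
    using w by (auto simp: sph_dom_def intro: sin_gt_zero)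
  then have "cos (v $ 3) = cos (w $ 3)" "sin (v $ 3) = sin (w $ 3)"
    using arg_cong[OF eq', of "\<lambda>x. x \<bullet> a"] arg_cong[OF eq', of "\<lambda>x. x \<bullet> b"] 2 by (auto simp: e_rho_inner)
  then obtain n :: int where n: "v $ 3 = w $ 3 + 2 * pi * n"
    using sin_cos_eq_iff by blast
  have "\<bar>2 * pi * n\<bar> < 2 * pi * 1"
  proof -
    have "0 < v $ 3" "v $ 3 < 2 * pi" "0 < w $ 3" "w $ 3 < 2 * pi"
      using v w by (simp_all add: sph_dom_def)
    then show ?thesis
      using n by linarith
  qed
  then have "\<bar>n\<bar> < 1"
    unfolding abs_mult by simp
  then have 3: "v $ 3 = w $ 3"
    using n by simp
  show "v = w"
    using 1 2 3 by (simp add: vec_eq_iff forall_3)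
qed

text \<open>The open domain \<open>sph_dom\<close> misses the half-plane of azimuth 0 together with
  the axis. Both lie in the plane orthogonal to \<open>b\<close>, and a plane is negligible, so
  points off that plane are enough.\<close>

lemma spherical_map_image:
  assumes "x \<bullet> b \<noteq> 0"
  shows "x \<in> (\<lambda>v. v $ 1 *\<^sub>R e_rho a b c (v $ 2) (v $ 3)) ` sph_dom"
proof -
  define r where "r = norm x"
  have r: "r > 0" using assms by (auto simp: r_def)
  have r2: "r\<^sup>2 = (x \<bullet> a)\<^sup>2 + (x \<bullet> b)\<^sup>2 + (x \<bullet> c)\<^sup>2"
    unfolding r_def by (rule norm_sq_frame[OF frame])
  define p where "p = sqrt ((x \<bullet> a)\<^sup>2 + (x \<bullet> b)\<^sup>2)"
  have p2: "p\<^sup>2 = (x \<bullet> a)\<^sup>2 + (x \<bullet> b)\<^sup>2" by (simp add: p_def)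
  have p: "p > 0" unfolding p_def using assms by (simp add: sum_power2_gt_zero_iff)
  have lt: "(x \<bullet> c)\<^sup>2 < r\<^sup>2" using r2 p2 p by (smt (verit) zero_less_power)
  then have abs: "\<bar>x \<bullet> c\<bar> < r" using power2_less_imp_less[of "\<bar>x \<bullet> c\<bar>" r] r by simp
  define \<theta> where "\<theta> = arccos (x \<bullet> c / r)"
  have b1: "-1 < x \<bullet> c / r" "x \<bullet> c / r < 1" using abs r by (auto simp: field_simps abs_less_iff)
  have th: "0 < \<theta>" "\<theta> < pi" using arccos_lt_bounded[OF b1] by (auto simp: \<theta>_def)
  have c1: "r * cos \<theta> = x \<bullet> c" using b1 r by (simp add: \<theta>_def)
  have "(r * sin \<theta>)\<^sup>2 = p\<^sup>2"
    using r2 p2 by (simp add: power_mult_distrib sin_squared_eq right_diff_distrib c1[symmetric])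
  then have s1: "r * sin \<theta> = p"
    using p r th by (simp add: power2_eq_iff_nonneg sin_ge_zero)
  have "((x \<bullet> a) / p)\<^sup>2 + ((x \<bullet> b) / p)\<^sup>2 = 1"
    using p by (simp add: power_divide add_divide_distrib[symmetric] p2[symmetric])
  then obtain \<phi> where ph: "0 \<le> \<phi>" "\<phi> < 2 * pi" and xa: "x \<bullet> a / p = cos \<phi>" and xb: "x \<bullet> b / p = sin \<phi>"
    using sincos_total_2pi by metis
  have xa': "x \<bullet> a = r * sin \<theta> * cos \<phi>" and xb': "x \<bullet> b = r * sin \<theta> * sin \<phi>"
    using xa xb p unfolding s1 by (simp_all add: field_simps)
  have "\<phi> \<noteq> 0" using xb assms p by auto
  then have ph': "0 < \<phi>" using ph by simp
  have "x = (x \<bullet> a) *\<^sub>R a + (x \<bullet> b) *\<^sub>R b + (x \<bullet> c) *\<^sub>R c"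
    by (rule frame_expansion[OF frame])
  also have "\<dots> = r *\<^sub>R e_rho a b c \<theta> \<phi>"
    unfolding e_rho_def xa' xb' c1[symmetric] by (simp add: algebra_simps)
  finally have x: "x = r *\<^sub>R e_rho a b c \<theta> \<phi>" .
  show ?thesis
    by (rule image_eqI[of _ _ "vector [r, \<theta>, \<phi>]"]) (use x r th ph ph' in \<open>auto simp: sph_dom_def vector_3\<close>)
qed

lemma e_rho_has_derivative:
  "((\<lambda>v::real^3. v $ 1 *\<^sub>R e_rho a b c (v $ 2) (v $ 3)) has_derivative
     (\<lambda>w. w $ 1 *\<^sub>R e_rho a b c (v $ 2) (v $ 3) + w $ 2 *\<^sub>R (v $ 1 *\<^sub>R e_theta a b c (v $ 2) (v $ 3))
        + w $ 3 *\<^sub>R ((v $ 1 * sin (v $ 2)) *\<^sub>R e_phi a b (v $ 3)))) (at v)"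
proof -
  have n: "((\<lambda>v::real^3. v $ i) has_derivative (\<lambda>w. w $ i)) (at v)" for i
    by (rule bounded_linear.has_derivative) (auto intro: bounded_linear_vec_nth has_derivative_ident)
  have "((\<lambda>v::real^3. e_rho a b c (v $ 2) (v $ 3)) has_derivative
     (\<lambda>w. w $ 2 *\<^sub>R e_theta a b c (v $ 2) (v $ 3) + w $ 3 *\<^sub>R (sin (v $ 2) *\<^sub>R e_phi a b (v $ 3)))) (at v)"
    unfolding e_rho_def e_theta_def e_phi_def
    by (rule derivative_eq_intros n refl)+ (simp add: fun_eq_iff algebra_simps)
  from has_derivative_scaleR[OF n[of 1] this] show ?thesis
    by (simp add: algebra_simps)
qed

text \<open>The columns of the matrix are orthogonal with lengths 1, |r| and |p|, so its Gram matrix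
  is diagonal, and the determinant of the Gram matrix is the square of the one sought. The sign is
  lost, whence the absolute values.\<close>

lemma spherical_jacobian:
  assumes "\<And>w. L w = w $ 1 *\<^sub>R e1 + w $ 2 *\<^sub>R (r *\<^sub>R e2) + w $ 3 *\<^sub>R (p *\<^sub>R e3)"
    and f: "orthonormal_frame e1 e2 e3"
  shows "\<bar>det (matrix L)\<bar> = \<bar>r * p\<bar>"
proof -
  let ?A = "matrix L"
  have L1: "L (axis 1 1) = e1" "L (axis 2 1) = r *\<^sub>R e2" "L (axis 3 1) = p *\<^sub>R e3"
    by (simp_all add: assms(1) axis_def)
  have "(transpose ?A ** ?A) $ i $ j = L (axis i 1) \<bullet> L (axis j 1)" for i j
    by (simp add: matrix_matrix_mult_def transpose_def matrix_def inner_vec_def)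
  then have "transpose ?A ** ?A = (\<chi> i j. if i = j then (if i = 1 then 1 else if i = 2 then r\<^sup>2 else p\<^sup>2) else 0)" (is "_ = ?D")
    by (simp add: vec_eq_iff forall_3 L1 frame_inner[OF f] power2_eq_square)
  from arg_cong[OF this, of det] have "(det ?A)\<^sup>2 = det ?D"
    by (simp add: det_mul power2_eq_square)
  also have "\<dots> = (r * p)\<^sup>2"
    by (subst det_3) (simp add: power_mult_distrib)
  finally show ?thesis
    by (simp only: power2_eq_iff abs_eq_iff)
qed

end

context
  fixes a b c :: "real^3"
  assumes frame: "orthonormal_frame a b c"
begin

definition sph :: "real^3 \<Rightarrow> real^3" where
  "sph v = v $ 1 *\<^sub>R e_rho a b c (v $ 2) (v $ 3)"

lemma continuous_on_sph: "continuous_on A sph"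
  unfolding sph_def using e_rho_has_derivative[OF frame]
  by (meson continuous_at_imp_continuous_on has_derivative_continuous)

lemma measurable_sph [measurable]: "sph \<in> borel_measurable borel"
  by (rule borel_measurable_continuous_onI) (rule continuous_on_sph)

text \<open>Change of variables for an injective differentiable map, applied to the part of the
  coordinate domain that lands in the box; its image fills the box up to a null set.\<close>

lemma spherical_volume_box:
  "((\<lambda>v. (v $ 1)\<^sup>2 * sin (v $ 2)) has_integral measure lborel (box l u)) (sph_dom \<inter> sph -` box l u)"
proof -
  let ?S = "sph_dom \<inter> sph -` box l u"
  have S: "?S \<in> sets lebesgue"
    using open_vimage[OF open_box continuous_on_sph, of l u] open_sph_dom by (auto intro!: sets_completionI_sets)
  have inj: "inj_on sph ?S"
    using spherical_map_inj[OF frame] unfolding sph_def[abs_def, symmetric] by (rule inj_on_subset) auto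
  define L where "L v = (\<lambda>w :: real^3. w $ 1 *\<^sub>R e_rho a b c (v $ 2) (v $ 3) + w $ 2 *\<^sub>R (v $ 1 *\<^sub>R e_theta a b c (v $ 2) (v $ 3))
        + w $ 3 *\<^sub>R ((v $ 1 * sin (v $ 2)) *\<^sub>R e_phi a b (v $ 3)))" for v :: "real^3"
  have der: "(sph has_derivative L v) (at v within ?S)" for v
    unfolding sph_def[abs_def] L_def by (rule has_derivative_at_withinI[OF e_rho_has_derivative[OF frame]])
  have det: "\<bar>det (matrix (L v))\<bar> = (v $ 1)\<^sup>2 * sin (v $ 2)" if "v \<in> ?S" for v
  proof -
    have "\<bar>det (matrix (L v))\<bar> = \<bar>v $ 1 * (v $ 1 * sin (v $ 2))\<bar>"
      by (rule spherical_jacobian[OF frame _ spherical_frame[OF frame]]) (simp add: L_def)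
    moreover have "0 < sin (v $ 2)" "0 < v $ 1"
      using that by (auto simp: sph_dom_def intro: sin_gt_zero)
    ultimately show ?thesis
      by (simp add: abs_mult power2_eq_square)
  qed
  have neg: "negligible {x. b \<bullet> x = 0}"
    by (rule negligible_hyperplane) (use frame in \<open>auto simp: orthonormal_frame_def\<close>)
  have sub: "sph ` ?S \<subseteq> box l u" by auto
  have diff: "box l u - sph ` ?S \<subseteq> {x. b \<bullet> x = 0}"
  proof (clarsimp)
    fix x assume "x \<in> box l u" and n: "x \<notin> sph ` ?S"
    show "b \<bullet> x = 0"
    proof (rule ccontr)
      assume "b \<bullet> x \<noteq> 0"
      then have "x \<in> sph ` sph_dom"
        using spherical_map_image[OF frame, of x] by (simp add: sph_def[abs_def] inner_commute)
      then show False using n \<open>x \<in> box l u\<close> by auto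
    qed
  qed
  have negd: "negligible (sym_diff (box l u) (sph ` ?S))"
    using negligible_subset[OF neg diff] sub by (metis Diff_eq_empty_iff sup_bot.right_neutral)
  have "sph ` ?S \<in> lmeasurable \<and> measure lebesgue (sph ` ?S) = measure lebesgue (box l u)"
    using lmeasurable_negligible_symdiff[OF _ negd] measure_negligible_symdiff[OF _ negd] by simp
  then have "((\<lambda>v. \<bar>det (matrix (L v))\<bar>) has_integral measure lebesgue (box l u)) ?S"
    using has_measure_differentiable_image[OF S der inj] by blast
  then show ?thesis
    using has_integral_cong[of ?S "\<lambda>v. \<bar>det (matrix (L v))\<bar>", OF det] by simp
qed

text \<open>Lebesgue measure is determined by its values on boxes, so the volume of a box is the
  only instance of the change of variables to be computed. Being an identity of measures, the result
  covers every nonnegative measurable integrand, also those of infinite integral.\<close>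

lemma lborel_spherical:
  "lborel = distr (density lborel (\<lambda>v. ennreal ((v $ 1)\<^sup>2 * sin (v $ 2)) * indicator sph_dom v)) borel sph"
    (is "_ = distr (density lborel ?D) _ _")
proof (rule lborel_eqI)
  have [measurable]: "sph_dom \<in> sets borel"
    by (simp add: open_sph_dom borel_open)
  have [measurable]: "(\<lambda>v::real^3. v $ i) \<in> borel_measurable borel" for i
    by (intro borel_measurable_continuous_onI continuous_intros)
  fix l u :: "real^3" assume le: "\<And>b. b \<in> Basis \<Longrightarrow> l \<bullet> b \<le> u \<bullet> b"
  have nn: "0 \<le> (v $ 1)\<^sup>2 * sin (v $ 2)" if "v \<in> sph_dom" for v :: "real^3"
    using that sin_gt_zero[of "v $ 2"] by (auto simp: sph_dom_def)
  have "emeasure (distr (density lborel ?D) borel sph) (box l u)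
      = emeasure (density lborel ?D) (sph -` box l u)"
    by (subst emeasure_distr) auto
  also have "\<dots> = (\<integral>\<^sup>+v. ?D v * indicator (sph -` box l u) v \<partial>lborel)"
    by (rule emeasure_density) (use measurable_sets[OF measurable_sph, of "box l u"] in auto)
  also have "\<dots> = (\<integral>\<^sup>+v. ennreal ((v $ 1)\<^sup>2 * sin (v $ 2)) * indicator (sph_dom \<inter> sph -` box l u) v \<partial>lborel)"
    by (rule nn_integral_cong) (simp add: indicator_inter_arith mult.assoc)
  also have "\<dots> = ennreal (measure lborel (box l u))"
    by (rule nn_integral_has_integral_lebesgue'[OF _ spherical_volume_box]) (use nn in auto)
  also have "\<dots> = (\<Prod>b\<in>Basis. (u - l) \<bullet> b)"
    using le by (subst measure_lborel_box_eq) auto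
  finally show "emeasure (distr (density lborel ?D) borel sph) (box l u) = (\<Prod>b\<in>Basis. (u - l) \<bullet> b)" .
qed simp

lemma nn_integral_spherical:
  assumes [measurable]: "F \<in> borel_measurable borel"
  shows "(\<integral>\<^sup>+x. F x \<partial>lborel)
    = (\<integral>\<^sup>+r. \<integral>\<^sup>+\<theta>. \<integral>\<^sup>+\<phi>. F (r *\<^sub>R e_rho a b c \<theta> \<phi>) * ennreal (r\<^sup>2 * sin \<theta>)
        * indicator {0<..} r * indicator {0<..<pi} \<theta> * indicator {0<..<2*pi} \<phi> \<partial>lborel \<partial>lborel \<partial>lborel)"
proof -
  have [measurable]: "sph_dom \<in> sets borel"
    by (simp add: open_sph_dom borel_open)
  have [measurable]: "(\<lambda>v::real^3. v $ i) \<in> borel_measurable borel" for i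
    by (intro borel_measurable_continuous_onI continuous_intros)
  have "(\<integral>\<^sup>+x. F x \<partial>lborel)
      = (\<integral>\<^sup>+v. ennreal ((v $ 1)\<^sup>2 * sin (v $ 2)) * indicator sph_dom v * F (sph v) \<partial>lborel)"
    by (subst lborel_spherical) (simp add: nn_integral_distr nn_integral_density)
  also have "\<dots> = (\<integral>\<^sup>+r. \<integral>\<^sup>+\<theta>. \<integral>\<^sup>+\<phi>. ennreal (r\<^sup>2 * sin \<theta>) * indicator sph_dom (vector [r, \<theta>, \<phi>] :: real^3)
        * F (sph (vector [r, \<theta>, \<phi>])) \<partial>lborel \<partial>lborel \<partial>lborel)"
    by (subst nn_integral_vec3) (simp_all add: vector_3)
  also have "\<dots> = (\<integral>\<^sup>+r. \<integral>\<^sup>+\<theta>. \<integral>\<^sup>+\<phi>. F (r *\<^sub>R e_rho a b c \<theta> \<phi>) * ennreal (r\<^sup>2 * sin \<theta>)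
        * indicator {0<..} r * indicator {0<..<pi} \<theta> * indicator {0<..<2*pi} \<phi> \<partial>lborel \<partial>lborel \<partial>lborel)"
    by (intro nn_integral_cong) (auto simp: sph_def vector_3 sph_dom_def indicator_def mult.commute)
  finally show ?thesis .
qed

end

section \<open>One-dimensional inequalities\<close>

abbreviation nnint :: "'a::euclidean_space set \<Rightarrow> ('a \<Rightarrow> real) \<Rightarrow> ennreal" where
  "nnint A f \<equiv> (\<integral>\<^sup>+x\<in>A. ennreal (f x) \<partial>lborel)"

lemma set_nn_integral_continuous_Icc:
  fixes f :: "real \<Rightarrow> real"
  assumes "continuous_on {c..d} f" "\<And>x. x \<in> {c..d} \<Longrightarrow> 0 \<le> f x"
  shows "nnint {c..d} f = ennreal (integral {c..d} f)"
  using assms by (intro nn_integral_has_integral_lebesgue' integrable_integral integrable_continuous_real)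

lemma borel_measurable_ennreal_indicator:
  fixes f :: "'a :: topological_space \<Rightarrow> real"
  assumes "continuous_on A f" "A \<in> sets borel"
  shows "(\<lambda>x. ennreal (f x) * indicator A x) \<in> borel_measurable borel"
proof -
  have "(\<lambda>x. ennreal (f x) * indicator A x) = (\<lambda>x. ennreal (indicator A x *\<^sub>R f x))"
    by (auto simp: indicator_def)
  also have "\<dots> \<in> borel_measurable borel"
    using borel_measurable_continuous_on_indicator[OF assms(2,1)] by simp
  finally show ?thesis .
qed

text \<open>The common mechanism of all one-dimensional inequalities below: \<open>f2 - f1\<close> dominates an exact
  derivative whose primitive vanishes at both ends. Neither integral has to be finite.\<close>

lemma nn_integral_le_antiderivative:
  fixes f1 f2 F F' :: "real \<Rightarrow> real"
  assumes ab: "l < u"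
    and F: "\<And>x. l < x \<Longrightarrow> x < u \<Longrightarrow> (F has_real_derivative F' x) (at x)"
    and le: "\<And>x. l < x \<Longrightarrow> x < u \<Longrightarrow> F' x \<le> f2 x - f1 x"
    and nn1: "\<And>x. l < x \<Longrightarrow> x < u \<Longrightarrow> 0 \<le> f1 x"
    and nn2: "\<And>x. l < x \<Longrightarrow> x < u \<Longrightarrow> 0 \<le> f2 x"
    and c1: "continuous_on {l<..<u} f1" and c2: "continuous_on {l<..<u} f2"
    and La: "(F \<longlongrightarrow> 0) (at_right l)" and Lb: "(F \<longlongrightarrow> 0) (at_left u)"
  shows "nnint {l<..<u} f1 \<le> nnint {l<..<u} f2"
    (is "?I1 \<le> ?I2")
proof -
  \<comment> \<open>The compact intervals \<open>{c n..d n}\<close> exhaust the open one; moving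
    each end inwards by at most a third of the length keeps \<open>c n < d n\<close> from the
    start.\<close>
  define h where "h = (u - l) / 3"
  have h: "h > 0" using ab by (simp add: h_def)
  define c where "c n = l + h / (real n + 1)" for n :: nat
  define d where "d n = u - h / (real n + 1)" for n :: nat
  have hn: "0 < h / (real n + 1)" "h / (real n + 1) \<le> h" for n
    using h by (auto simp: field_simps)
  have cd: "l < c n" "c n < d n" "d n < u" for n
  proof -
    have "3 * h = u - l" by (simp add: h_def)
    then show "l < c n" "c n < d n" "d n < u"
      using hn[of n] h unfolding c_def d_def by linarith+
  qed
  have h0: "(\<lambda>n. h / (real n + 1)) \<longlonglongrightarrow> 0"
    using LIMSEQ_inverse_real_of_nat[THEN tendsto_mult_right_zero, of h] by (simp add: divide_inverse add.commute)
  have c_lim: "c \<longlonglongrightarrow> l" and d_lim: "d \<longlonglongrightarrow> u"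
    unfolding c_def[abs_def] d_def[abs_def] using tendsto_add[OF tendsto_const h0, of l] tendsto_diff[OF tendsto_const h0, of u] by auto
  have Fc: "(\<lambda>n. F (c n)) \<longlonglongrightarrow> 0"
    by (rule filterlim_compose[OF La]) (auto intro!: tendsto_imp_filterlim_at_right c_lim eventuallyI cd)
  have Fd: "(\<lambda>n. F (d n)) \<longlonglongrightarrow> 0"
    by (rule filterlim_compose[OF Lb]) (auto intro!: tendsto_imp_filterlim_at_left d_lim eventuallyI cd)
  have sub: "{c n..d n} \<subseteq> {l<..<u}" for n
    using cd[of n] by auto
  have key: "nnint {c n..d n} f1 \<le> ?I2 + ennreal (\<bar>F (c n)\<bar> + \<bar>F (d n)\<bar>)" for n
  proof -
    have i1: "f1 integrable_on {c n..d n}" and i2: "f2 integrable_on {c n..d n}"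
      using c1 c2 sub by (auto intro!: integrable_continuous_real intro: continuous_on_subset)
    have "(F' has_integral (F (d n) - F (c n))) {c n..d n}"
      by (rule fundamental_theorem_of_calculus)
        (use cd[of n] in \<open>auto intro: has_field_derivative_at_within[OF F] simp: has_real_derivative_iff_has_vector_derivative[symmetric]\<close>)
    then have "F (d n) - F (c n) \<le> integral {c n..d n} (\<lambda>x. f2 x - f1 x)"
      by (rule has_integral_le[OF _ integrable_integral[OF integrable_diff[OF i2 i1]]])
        (use le cd[of n] in auto)
    then have "integral {c n..d n} f1 \<le> integral {c n..d n} f2 + (\<bar>F (c n)\<bar> + \<bar>F (d n)\<bar>)"
      using i1 i2 by (simp add: integral_diff)
    then have "ennreal (integral {c n..d n} f1) \<le> ennreal (integral {c n..d n} f2 + (\<bar>F (c n)\<bar> + \<bar>F (d n)\<bar>))"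
      by (rule ennreal_leI)
    also have "\<dots> = ennreal (integral {c n..d n} f2) + ennreal (\<bar>F (c n)\<bar> + \<bar>F (d n)\<bar>)"
      using nn2 sub[of n] by (intro ennreal_plus integral_nonneg i2) auto
    also have "ennreal (integral {c n..d n} f2) = nnint {c n..d n} f2"
      using nn2 sub[of n] by (intro set_nn_integral_continuous_Icc[symmetric] continuous_on_subset[OF c2]) auto
    also have "\<dots> \<le> ?I2"
      using sub[of n] by (intro nn_integral_mono mult_left_mono) (auto simp: indicator_def)
    also have "ennreal (integral {c n..d n} f1) = nnint {c n..d n} f1"
      using nn1 sub[of n] by (intro set_nn_integral_continuous_Icc[symmetric] continuous_on_subset[OF c1]) auto
    finally show ?thesis by simp
  qed
  have meas: "(\<lambda>x. ennreal (f1 x) * indicator {c n..d n} x) \<in> borel_measurable lborel" for n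
    using borel_measurable_ennreal_indicator[OF continuous_on_subset[OF c1 sub]] by simp
  \<comment> \<open>Fatou's lemma along the exhaustion: it needs no integrability, and the boundary
    terms of \<open>key\<close> disappear in the limit.\<close>
  have "?I1 \<le> (\<integral>\<^sup>+x. liminf (\<lambda>n. ennreal (f1 x) * indicator {c n..d n} x) \<partial>lborel)"
  proof (rule nn_integral_mono)
    fix x
    show "ennreal (f1 x) * indicator {l<..<u} x \<le> liminf (\<lambda>n. ennreal (f1 x) * indicator {c n..d n} x)"
    proof (cases "x \<in> {l<..<u}")
      case True
      then have "eventually (\<lambda>n. c n < x) sequentially" "eventually (\<lambda>n. x < d n) sequentially"
        using order_tendstoD(2)[OF c_lim, of x] order_tendstoD(1)[OF d_lim, of x] by auto
      then have "eventually (\<lambda>n. ennreal (f1 x) * indicator {l<..<u} x \<le> ennreal (f1 x) * indicator {c n..d n} x) sequentially"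
        by eventually_elim (use True in auto)
      then show ?thesis by (rule Liminf_bounded)
    qed simp
  qed
  also have "\<dots> \<le> liminf (\<lambda>n. \<integral>\<^sup>+x\<in>{c n..d n}. ennreal (f1 x) \<partial>lborel)"
    by (rule nn_integral_liminf) (rule meas)
  also have "\<dots> \<le> liminf (\<lambda>n. ?I2 + ennreal (\<bar>F (c n)\<bar> + \<bar>F (d n)\<bar>))"
    by (rule Liminf_mono) (intro always_eventually allI key)
  also have "\<dots> = ?I2"
  proof (rule lim_imp_Liminf)
    have "(\<lambda>n. \<bar>F (c n)\<bar> + \<bar>F (d n)\<bar>) \<longlonglongrightarrow> 0"
      using tendsto_add[OF tendsto_rabs[OF Fc] tendsto_rabs[OF Fd]] by simp
    then have "(\<lambda>n. ennreal (\<bar>F (c n)\<bar> + \<bar>F (d n)\<bar>)) \<longlonglongrightarrow> ennreal 0"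
      by (rule tendsto_ennrealI)
    then show "(\<lambda>n. ?I2 + ennreal (\<bar>F (c n)\<bar> + \<bar>F (d n)\<bar>)) \<longlonglongrightarrow> ?I2"
      using tendsto_add[OF tendsto_const, of _ "ennreal 0" sequentially ?I2] by simp
  qed simp
  finally show ?thesis .
qed

section \<open>Sharp inequalities in the polar angle\<close>

lemma tendsto_at_ends:
  fixes F :: "real \<Rightarrow> real"
  assumes "continuous_on UNIV F" "F l = 0"
  shows "(F \<longlongrightarrow> 0) (at_right l)" "(F \<longlongrightarrow> 0) (at_left l)"
  using assms by (metis continuous_on_def filterlim_at_split iso_tuple_UNIV_I continuous_within)+

text \<open>In both cases the excess over the exact derivative is \<open>sin x\<close> times the
  square of \<open>b' - b cot x\<close>, which vanishes for the ground state \<open>b = sin\<close>.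
  The first inequality uses that \<open>1 / sin^2\<close> equals \<open>1 + cot^2\<close>. The
  primitives \<open>b^2 cos\<close> and \<open>2 b^2 cos\<close> vanish at the poles because
  \<open>b\<close> does.\<close>

lemma azimuthal_poincare:
  fixes b b' :: "real \<Rightarrow> real"
  assumes b: "\<And>x. (b has_real_derivative b' x) (at x)" and b': "continuous_on UNIV b'"
    and "b 0 = 0" "b pi = 0"
  shows "nnint {0<..<pi} (\<lambda>x. 2 * (b x)\<^sup>2 * sin x)
     \<le> nnint {0<..<pi} (\<lambda>x. ((b' x)\<^sup>2 + (b x / sin x)\<^sup>2) * sin x)"
    and "nnint {0<..<pi} (\<lambda>x. 2 * (b x)\<^sup>2 * sin x)
     \<le> nnint {0<..<pi} (\<lambda>x. (b' x + b x * (cos x / sin x))\<^sup>2 * sin x)"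
proof -
  have cb: "continuous_on A b" for A
    using b by (meson DERIV_continuous continuous_at_imp_continuous_on)
  have cb': "continuous_on A b'" for A
    using b' continuous_on_subset by blast
  have s: "sin x \<noteq> 0" "0 < sin x" if "0 < x" "x < pi" for x :: real
    using sin_gt_zero[OF that] by auto
  note intr = cb cb' continuous_intros
  show "nnint {0<..<pi} (\<lambda>x. 2 * (b x)\<^sup>2 * sin x)
     \<le> nnint {0<..<pi} (\<lambda>x. ((b' x)\<^sup>2 + (b x / sin x)\<^sup>2) * sin x)"
  proof (rule nn_integral_le_antiderivative[where F = "\<lambda>x. (b x)\<^sup>2 * cos x"
        and F' = "\<lambda>x. 2 * b x * b' x * cos x - (b x)\<^sup>2 * sin x"])
    show "((\<lambda>x. (b x)\<^sup>2 * cos x) has_real_derivative 2 * b x * b' x * cos x - (b x)\<^sup>2 * sin x) (at x)" for x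
      by (auto intro!: derivative_eq_intros b simp: algebra_simps)
    fix x :: real assume x: "0 < x" "x < pi"
    define k where "k = cos x / sin x"
    have co: "cos x = k * sin x" and "(b x / sin x)\<^sup>2 = (b x)\<^sup>2 * (1 + k\<^sup>2)"
      using s[OF x] sin_cos_squared_add[of x] by (auto simp: k_def field_simps power_divide)
    then have "((b' x)\<^sup>2 + (b x / sin x)\<^sup>2) * sin x - 2 * (b x)\<^sup>2 * sin x
        - (2 * b x * b' x * cos x - (b x)\<^sup>2 * sin x) = sin x * (b' x - b x * k)\<^sup>2"
      by (simp add: power2_eq_square algebra_simps)
    then show "2 * b x * b' x * cos x - (b x)\<^sup>2 * sin x \<le> ((b' x)\<^sup>2 + (b x / sin x)\<^sup>2) * sin x - 2 * (b x)\<^sup>2 * sin x"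
      using s[OF x] by (smt (verit) mult_nonneg_nonneg zero_le_power2)
  qed (use s in \<open>auto intro!: tendsto_at_ends intr simp: assms less_imp_le\<close>)
  show "nnint {0<..<pi} (\<lambda>x. 2 * (b x)\<^sup>2 * sin x)
     \<le> nnint {0<..<pi} (\<lambda>x. (b' x + b x * (cos x / sin x))\<^sup>2 * sin x)"
  proof (rule nn_integral_le_antiderivative[where F = "\<lambda>x. 2 * (b x)\<^sup>2 * cos x"
        and F' = "\<lambda>x. 4 * b x * b' x * cos x - 2 * (b x)\<^sup>2 * sin x"])
    show "((\<lambda>x. 2 * (b x)\<^sup>2 * cos x) has_real_derivative 4 * b x * b' x * cos x - 2 * (b x)\<^sup>2 * sin x) (at x)" for x
      by (auto intro!: derivative_eq_intros b simp: algebra_simps)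
    fix x :: real assume x: "0 < x" "x < pi"
    define k where "k = cos x / sin x"
    have co: "cos x = k * sin x"
      using s[OF x] by (auto simp: k_def)
    then have "(b' x + b x * k)\<^sup>2 * sin x - 2 * (b x)\<^sup>2 * sin x
        - (4 * b x * b' x * cos x - 2 * (b x)\<^sup>2 * sin x) = sin x * (b' x - b x * k)\<^sup>2"
      by (simp add: power2_eq_square algebra_simps)
    then show "4 * b x * b' x * cos x - 2 * (b x)\<^sup>2 * sin x
        \<le> (b' x + b x * (cos x / sin x))\<^sup>2 * sin x - 2 * (b x)\<^sup>2 * sin x"
      using s[OF x] unfolding k_def by (smt (verit) mult_nonneg_nonneg zero_le_power2)
  qed (use s in \<open>auto intro!: tendsto_at_ends intr simp: assms less_imp_le\<close>)
qed

text \<open>The function \<open>b\<close> contributes only an exact derivative: the right integrand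
  minus the left one is \<open>(a'^2 - 2 a^2) sin\<close> minus the derivative of
  \<open>2 a b sin + b^2 cos\<close>. What remains is the Poincare inequality for functions
  \<open>a\<close> of mean zero on the sphere, with eigenvalue 2 of degree one.\<close>

lemma polar_flux_poincare:
  fixes a a' b b' :: "real \<Rightarrow> real"
  assumes a: "\<And>x. (a has_real_derivative a' x) (at x)" and a': "continuous_on UNIV a'"
    and b: "\<And>x. (b has_real_derivative b' x) (at x)" and b': "continuous_on UNIV b'"
    and b0: "b 0 = 0" "b pi = 0"
    and mean: "integral {0..pi} (\<lambda>x. a x * sin x) = 0"
  shows "nnint {0<..<pi} (\<lambda>x. (2 * a x + b' x + b x * (cos x / sin x))\<^sup>2 * sin x)
     \<le> nnint {0<..<pi} (\<lambda>x. ((a' x - b x)\<^sup>2 + (b' x + a x)\<^sup>2 + (a x + b x * (cos x / sin x))\<^sup>2) * sin x)"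
proof -
  have cA: "continuous_on A a" "continuous_on A b" for A
    using a b by (meson DERIV_continuous continuous_at_imp_continuous_on)+
  have cA': "continuous_on A a'" "continuous_on A b'" for A
    using a' b' continuous_on_subset by blast+
  note intr = cA cA' continuous_intros
  have s: "sin x \<noteq> 0" "0 < sin x" if "0 < x" "x < pi" for x :: real
    using sin_gt_zero[OF that] by auto
  define S where "S x = integral {0..x} (\<lambda>x. a x * sin x)" for x
  have S_within: "(S has_real_derivative a x * sin x) (at x within {0..pi})" if "x \<in> {0..pi}" for x
    unfolding S_def[abs_def] has_real_derivative_iff_has_vector_derivative
    by (rule integral_has_vector_derivative) (use that in \<open>auto intro!: intr\<close>)
  have S: "(S has_real_derivative a x * sin x) (at x)" if "0 < x" "x < pi" for x
    using S_within[of x] that at_within_Icc_at[of 0 x pi] by simp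
  have S0: "S 0 = 0" "S pi = 0"
    using mean by (simp_all add: S_def)
  \<comment> \<open>L'Hospital by difference quotients: \<open>S\<close> and its derivative
    \<open>a sin\<close> vanish at both ends, while the derivative of \<open>sin\<close> there is 1
    or -1. The zero of \<open>S\<close> at \<open>pi\<close> is the hypothesis of mean zero.\<close>
  have q0: "((\<lambda>x. S x / sin x) \<longlongrightarrow> 0) (at_right 0)" and qpi: "((\<lambda>x. S x / sin x) \<longlongrightarrow> 0) (at_left pi)"
  proof -
    have 1: "((\<lambda>x. S x / x) \<longlongrightarrow> 0) (at_right 0)"
      using S_within[of 0] by (simp add: has_field_derivative_iff S0 at_within_Icc_at_right)
    have 2: "((\<lambda>x::real. sin x / x) \<longlongrightarrow> 1) (at_right 0)"
      using DERIV_sin[of "0::real"] by (simp add: has_field_derivative_iff filterlim_at_split)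
    have "((\<lambda>x. (S x / x) / (sin x / x)) \<longlongrightarrow> 0) (at_right 0)"
      using tendsto_divide[OF 1 2] by simp
    then show "((\<lambda>x. S x / sin x) \<longlongrightarrow> 0) (at_right 0)"
      by (rule Lim_transform_eventually) (auto simp: eventually_at_filter)
    have 1: "((\<lambda>x. S x / (x - pi)) \<longlongrightarrow> 0) (at_left pi)"
      using S_within[of pi] by (simp add: has_field_derivative_iff S0 at_within_Icc_at_left)
    have 2: "((\<lambda>x::real. sin x / (x - pi)) \<longlongrightarrow> -1) (at_left pi)"
      using DERIV_sin[of pi] by (simp add: has_field_derivative_iff filterlim_at_split)
    have "((\<lambda>x. (S x / (x - pi)) / (sin x / (x - pi))) \<longlongrightarrow> 0) (at_left pi)"
      using tendsto_divide[OF 1 2] by simp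
    then show "((\<lambda>x. S x / sin x) \<longlongrightarrow> 0) (at_left pi)"
      by (rule Lim_transform_eventually) (auto simp: eventually_at_filter)
  qed
  define q where "q x = S x / sin x" for x
  \<comment> \<open>Since \<open>q' + q cot = a\<close>, the first two terms of \<open>F\<close>
    turn \<open>a'^2 - 2 a^2\<close> into the squares of \<open>a' + 2 q\<close> and, twice, of
    \<open>a - 2 q cot\<close>. For \<open>a = cos\<close> one has \<open>q = sin / 2\<close>, and
    both squares vanish. The last two terms remove \<open>b\<close>.\<close>
  define F where "F x = 4 * ((q x)\<^sup>2 * cos x) - 4 * (a x * q x * sin x) - 2 * (a x * b x * sin x) - (b x)\<^sup>2 * cos x" for x
  have lim: "(g \<longlongrightarrow> g l) (at l within A)" if "continuous_on UNIV g" for g :: "real \<Rightarrow> real" and l A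
    using that continuous_within continuous_on_eq_continuous_within continuous_within_subset[of l UNIV g A] by blast
  let ?k = "\<lambda>x. cos x / sin x"
  let ?F' = "\<lambda>x. 4 * (2 * q x * (a x - q x * ?k x) * cos x - (q x)\<^sup>2 * sin x)
      - 4 * (a' x * q x * sin x + a x * (a x - q x * ?k x) * sin x + a x * q x * cos x)
      - 2 * (a' x * b x * sin x + a x * b' x * sin x + a x * b x * cos x) - 2 * b x * b' x * cos x + (b x)\<^sup>2 * sin x"
  show ?thesis
  proof (rule nn_integral_le_antiderivative[where F = F and F' = ?F'])
    fix x :: real assume x: "0 < x" "x < pi"
    have q': "(q has_real_derivative (a x - q x * ?k x)) (at x)"
      unfolding q_def[abs_def]
      by (rule DERIV_cong[OF DERIV_divide[OF S[OF x] DERIV_sin]]) (use s[OF x] in \<open>auto simp: field_simps\<close>)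
    show "(F has_real_derivative ?F' x) (at x)"
      unfolding F_def[abs_def]
      by (rule derivative_eq_intros a b q' refl)+ (simp add: algebra_simps power2_eq_square)
    define k where "k = cos x / sin x"
    have co: "cos x = k * sin x"
      using s[OF x] by (auto simp: k_def)
    have "((a' x - b x)\<^sup>2 + (b' x + a x)\<^sup>2 + (a x + b x * k)\<^sup>2) * sin x - (2 * a x + b' x + b x * k)\<^sup>2 * sin x
        - (4 * (2 * q x * (a x - q x * k) * cos x - (q x)\<^sup>2 * sin x)
      - 4 * (a' x * q x * sin x + a x * (a x - q x * k) * sin x + a x * q x * cos x)
      - 2 * (a' x * b x * sin x + a x * b' x * sin x + a x * b x * cos x) - 2 * b x * b' x * cos x + (b x)\<^sup>2 * sin x)
      = sin x * ((a' x + 2 * q x)\<^sup>2 + 2 * (a x - 2 * q x * k)\<^sup>2)"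
      unfolding co by algebra
    moreover have "0 \<le> sin x * ((a' x + 2 * q x)\<^sup>2 + 2 * (a x - 2 * q x * k)\<^sup>2)"
      using s[OF x] by simp
    ultimately show "?F' x \<le> ((a' x - b x)\<^sup>2 + (b' x + a x)\<^sup>2 + (a x + b x * (cos x / sin x))\<^sup>2) * sin x
          - (2 * a x + b' x + b x * (cos x / sin x))\<^sup>2 * sin x"
      unfolding k_def by linarith
  next
    show "(F \<longlongrightarrow> 0) (at_right 0)"
      unfolding F_def[abs_def]
      by (rule tendsto_eq_intros q0[folded q_def] lim[of a] lim[of b] lim[of sin] lim[of cos] intr refl)+ (simp add: b0)
    show "(F \<longlongrightarrow> 0) (at_left pi)"
      unfolding F_def[abs_def]
      by (rule tendsto_eq_intros qpi[folded q_def] lim[of a] lim[of b] lim[of sin] lim[of cos] intr refl)+ (simp add: b0)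
  qed (use s in \<open>auto intro!: intr simp: less_imp_le\<close>)
qed

section \<open>The weighted Hardy inequality on a ray\<close>

lemma borel_measurable_weighted_energy:
  fixes f' :: "real \<Rightarrow> real"
  assumes "continuous_on {0<..} f'"
  shows "(\<lambda>x. ennreal (x powr p * (x * f' x)\<^sup>2) * indicator {0<..} x) \<in> borel_measurable borel"
  by (rule borel_measurable_ennreal_indicator) (auto intro!: continuous_intros assms)

text \<open>Integrate \<open>f'\<close> from 0 to \<open>r\<close> and split by Young's inequality
  between the energy density and \<open>x\<close> to the power \<open>- 2 s - 1\<close>, whose
  integral from 0 is finite because \<open>s < 0\<close>. The parameter \<open>\<eta>\<close> stays
  free so that a small energy \<open>J\<close> yields a small trace.\<close>

lemma powr_weighted_trace_le:
  fixes f f' :: "real \<Rightarrow> real"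
  assumes f: "\<And>r. 0 < r \<Longrightarrow> (f has_real_derivative f' r) (at r)"
    and f': "continuous_on {0<..} f'"
    and f0: "(f \<longlongrightarrow> 0) (at_right 0)" and s: "s < 0" and r: "0 < r" and eta: "0 < \<eta>"
    and I: "nnint {0<..<r} (\<lambda>x. x powr (2 * s-1) * (x * f' x)\<^sup>2) \<le> ennreal J" and J: "0 \<le> J"
  shows "2 * (r powr s * \<bar>f r\<bar>) \<le> J / \<eta> + \<eta> / (- 2 * s)"
proof -
  \<comment> \<open>With this Young parameter, multiplication by \<open>r powr s\<close> makes all
    powers of \<open>r\<close> cancel, leaving a bound that is uniform in \<open>r\<close>.\<close>
  define m where "m = r powr (-s) / \<eta>"
  have mu: "m > 0" using r eta by (simp add: m_def)
  let ?h = "\<lambda>x. x powr (2 * s-1) * (x * f' x)\<^sup>2"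
  define K where "K = r powr (-2 * s) / (-2 * s)"
  have key: "2 * \<bar>f r - f y\<bar> \<le> m * J + K / m" if d: "0 < y" "y < r" for y
  proof -
    have sub: "{y..r} \<subseteq> {0<..}" using d by auto
    have ch: "continuous_on {y..r} ?h" and cp: "continuous_on {y..r} (\<lambda>x. x powr (-2 * s-1))"
      using d by (auto intro!: continuous_intros continuous_on_subset[OF f' sub])
    have ih: "?h integrable_on {y..r}"
      using ch by (rule integrable_continuous_real)
    have "ennreal (integral {y..r} ?h) = nnint {y..r} (\<lambda>x. ?h x)"
      by (rule set_nn_integral_continuous_Icc[symmetric]) (use ch in auto)
    also have "\<dots> = nnint {y..<r} (\<lambda>x. ?h x)"
      by (rule nn_integral_cong_AE) (use AE_lborel_singleton[of r] in \<open>auto simp: indicator_def elim!: eventually_mono\<close>)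
    also have "\<dots> \<le> nnint {0<..<r} (\<lambda>x. ?h x)"
      using d by (intro nn_integral_mono mult_left_mono) (auto simp: indicator_def)
    also note I
    finally have Jh: "integral {y..r} ?h \<le> J"
      using J by (simp add: ennreal_le_iff)
    have p: "((\<lambda>x. x powr (-2 * s-1)) has_integral (r powr (-2 * s) / (-2 * s) - y powr (-2 * s) / (-2 * s))) {y..r}"
    proof (rule fundamental_theorem_of_calculus)
      fix x assume x: "x \<in> {y..r}"
      have "((\<lambda>x. x powr (-2 * s) / (-2 * s)) has_real_derivative x powr (-2 * s-1)) (at x)"
        using x d s by (intro DERIV_cong[OF DERIV_cdivide[OF has_real_derivative_powr]]) auto
      then show "((\<lambda>x. x powr (-2 * s) / (-2 * s)) has_vector_derivative x powr (-2 * s-1)) (at x within {y..r})"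
        by (simp add: has_real_derivative_iff_has_vector_derivative[symmetric] has_field_derivative_at_within)
    qed (use d in simp)
    have tot: "((\<lambda>x. m * ?h x + x powr (-2 * s-1) / m) has_integral
        (m * integral {y..r} ?h + (r powr (-2 * s) / (-2 * s) - y powr (-2 * s) / (-2 * s)) / m)) {y..r}"
      by (intro has_integral_add has_integral_mult_right integrable_integral ih has_integral_divide p)
    have "(f' has_integral (f r - f y)) {y..r}"
      by (rule fundamental_theorem_of_calculus)
        (use d in \<open>auto intro: has_field_derivative_at_within[OF f] simp: has_real_derivative_iff_has_vector_derivative[symmetric]\<close>)
    then have dbl: "((\<lambda>x. 2 * f' x) has_integral 2 * (f r - f y)) {y..r}"
      by (rule has_integral_mult_right)
    have pw: "2 * \<bar>f' x\<bar> \<le> m * ?h x + x powr (-2 * s-1) / m" if "x \<in> {y..r}" for x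
    proof -
      have x: "x > 0" using that d by auto
      define w where "w = m * x powr (2 * s+1)"
      have w: "w > 0" using mu x by (simp add: w_def)
      have 1: "m * ?h x = w * (f' x)\<^sup>2"
        using x by (simp add: w_def power_mult_distrib powr_add powr_diff power2_eq_square field_simps)
      have 2: "x powr (-2 * s-1) / m = 1 / w"
      proof -
        have "x powr (-2 * s-1) = inverse (x powr (2 * s+1))"
          by (simp add: powr_minus[symmetric])
        then show ?thesis by (simp add: w_def field_simps)
      qed
      have "0 \<le> (w * \<bar>f' x\<bar> - 1)\<^sup>2 / w" using w by simp
      also have "\<dots> = w * (f' x)\<^sup>2 + 1 / w - 2 * \<bar>f' x\<bar>"
        using w by (simp add: power2_diff field_simps power2_eq_square)
      finally show ?thesis unfolding 1 2 by simp
    qed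
    have up: "2 * (f r - f y) \<le> m * integral {y..r} ?h + (r powr (-2 * s) / (-2 * s) - y powr (-2 * s) / (-2 * s)) / m"
      by (rule has_integral_le[OF dbl tot]) (use pw in fastforce)
    have "((\<lambda>x. - (2 * f' x)) has_integral - (2 * (f r - f y))) {y..r}"
      using dbl by (rule has_integral_neg)
    then have lo: "- (2 * (f r - f y)) \<le> m * integral {y..r} ?h + (r powr (-2 * s) / (-2 * s) - y powr (-2 * s) / (-2 * s)) / m"
      by (rule has_integral_le[OF _ tot]) (use pw in fastforce)
    have "m * integral {y..r} ?h \<le> m * J"
      using Jh mu by simp
    moreover have "(r powr (-2 * s) / (-2 * s) - y powr (-2 * s) / (-2 * s)) / m \<le> K / m"
      unfolding K_def using mu s by (intro divide_right_mono) (auto simp: divide_nonneg_neg)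
    ultimately show ?thesis using up lo by linarith
  qed
  have lim: "((\<lambda>y. 2 * \<bar>f r - f y\<bar>) \<longlongrightarrow> 2 * \<bar>f r - 0\<bar>) (at_right 0)"
    by (intro tendsto_intros f0)
  have "2 * \<bar>f r - 0\<bar> \<le> m * J + K / m"
    by (rule tendsto_upperbound[OF lim]) (use key r in \<open>auto simp: eventually_at_right_field\<close>)
  then have "r powr s * (2 * \<bar>f r\<bar>) \<le> r powr s * (m * J + K / m)"
    by (intro mult_left_mono) auto
  also have "\<dots> = J / \<eta> + \<eta> / (- 2 * s)"
  proof -
    have "r powr s * m = 1 / \<eta>"
      using r eta by (simp add: m_def powr_minus field_simps)
    moreover have "r powr s * K / m = \<eta> / (-2 * s)"
    proof -
      have "r powr (-2 * s) = r powr (-s) * r powr (-s)" by (simp add: powr_add[symmetric])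
      moreover have "r powr s * r powr (-s) = 1" using r by (simp add: powr_add[symmetric])
      ultimately show ?thesis
        unfolding K_def m_def using r eta s by (simp add: field_simps)
    qed
    ultimately show ?thesis
      by (simp add: distrib_left mult.assoc[symmetric])
  qed
  finally show ?thesis by (simp add: mult.left_commute)
qed

text \<open>A finite energy is small on short intervals at the origin, by continuity from above of
  the measure with this density, and the preceding trace bound turns this into decay.\<close>

lemma powr_weighted_trace_tendsto_0:
  fixes f f' :: "real \<Rightarrow> real"
  assumes f: "\<And>r. 0 < r \<Longrightarrow> (f has_real_derivative f' r) (at r)"
    and f': "continuous_on {0<..} f'"
    and f0: "(f \<longlongrightarrow> 0) (at_right 0)" and s: "s < 0"
    and I: "(nnint {0<..} (\<lambda>x. x powr (2 * s-1) * (x * f' x)\<^sup>2)) < \<infinity>"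
  shows "((\<lambda>r. r powr s * f r) \<longlongrightarrow> 0) (at_right 0)"
proof (rule tendstoI)
  let ?h = "\<lambda>x. ennreal (x powr (2 * s-1) * (x * f' x)\<^sup>2)"
  fix e :: real assume e: "e > 0"
  \<comment> \<open>This makes the second term of the trace bound equal to \<open>e / 2\<close>; an
    energy below \<open>\<eta> * e / 2\<close> makes the first at most \<open>e / 2\<close>. Their
    sum bounds twice the trace, hence the strict inequality in the end.\<close>
  define \<eta> where "\<eta> = e * (- 2 * s) / 2"
  have eta: "\<eta> > 0" using e s by (simp add: \<eta>_def mult_neg_pos zero_less_mult_iff mult_less_0_iff)
  define N where "N = density lborel (\<lambda>x. ?h x * indicator {0<..} x)"
  have hm: "(\<lambda>x. ?h x * indicator {0<..} x) \<in> borel_measurable lborel"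
    using borel_measurable_weighted_energy[OF f'] by simp
  define A where "A n = {0<..<1 / (real n + 1)}" for n
  have N: "emeasure N (A n) = (\<integral>\<^sup>+x\<in>A n. ?h x \<partial>lborel)" for n
    unfolding N_def by (subst emeasure_density[OF hm]) (auto simp: A_def indicator_def intro!: nn_integral_cong)
  have "decseq A"
    by (rule decseq_SucI) (auto simp: A_def field_simps)
  moreover have "emeasure N (A n) \<noteq> \<infinity>" for n
  proof -
    have "emeasure N (A n) \<le> (\<integral>\<^sup>+x\<in>{0<..}. ?h x \<partial>lborel)"
      unfolding N by (intro nn_integral_mono mult_left_mono) (auto simp: A_def indicator_def)
    then show ?thesis using I by (auto simp: top_unique)
  qed
  ultimately have "(\<lambda>n. emeasure N (A n)) \<longlonglongrightarrow> emeasure N (\<Inter>n. A n)"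
  proof (intro Lim_emeasure_decseq)
    show "range A \<subseteq> sets N" by (auto simp: N_def A_def)
  qed auto
  also have "(\<Inter>n. A n) = {}"
  proof -
    have "\<exists>n. x \<notin> A n" for x
    proof (cases "x > 0")
      case True
      then obtain n where "inverse (real (Suc n)) < x"
        using reals_Archimedean by blast
      then show ?thesis by (intro exI[of _ n]) (auto simp: A_def field_simps)
    qed (auto simp: A_def)
    then show ?thesis by blast
  qed
  finally have "(\<lambda>n. emeasure N (A n)) \<longlonglongrightarrow> 0" by simp
  then have "eventually (\<lambda>n. emeasure N (A n) < ennreal (\<eta> * e / 2)) sequentially"
    using eta e by (intro order_tendstoD) auto
  then obtain n where n: "emeasure N (A n) < ennreal (\<eta> * e / 2)"
    using eventually_sequentially by auto
  have "dist (r powr s * f r) 0 < e" if r: "0 < r" "r < 1 / (real n + 1)" for r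
  proof -
    have "(\<integral>\<^sup>+x\<in>{0<..<r}. ?h x \<partial>lborel) \<le> emeasure N (A n)"
      unfolding N using r by (intro nn_integral_mono mult_left_mono) (auto simp: A_def indicator_def)
    then have "2 * (r powr s * \<bar>f r\<bar>) \<le> (\<eta> * e / 2) / \<eta> + \<eta> / (- 2 * s)"
      using n r eta e by (intro powr_weighted_trace_le[OF f f' f0 s]) auto
    also have "\<dots> = e / 2 + e / 2"
      using eta e s unfolding \<eta>_def by (simp add: field_simps)
    finally show ?thesis using e by (simp add: abs_mult)
  qed
  then show "eventually (\<lambda>r. dist (r powr s * f r) 0 < e) (at_right 0)"
    unfolding eventually_at_right_field by (intro exI[of _ "1 / (real n + 1)"]) auto
qed

text \<open>A form general enough for all components: \<open>Q\<close> is any nonnegative density,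
  and \<open>M\<close> weighs the null term, which is up to the factor
  \<open>r powr (2 * s - 1)\<close> the derivative of \<open>(r powr s * f r)^2\<close>. A pointwise
  inequality between quadratic forms in \<open>f r\<close> and \<open>r * f' r\<close> thereby
  becomes an integral inequality.\<close>

lemma radial_hardy:
  fixes f f' Q :: "real \<Rightarrow> real"
  assumes f: "\<And>r. 0 < r \<Longrightarrow> (f has_real_derivative f' r) (at r)"
    and f': "continuous_on {0<..} f'"
    and fl: "(f \<longlongrightarrow> l) (at_right 0)" and l: "s < 0 \<Longrightarrow> l = 0" and s: "s \<noteq> 0"
    and R: "0 < R" and fR: "\<And>r. R \<le> r \<Longrightarrow> f r = 0" and QR: "\<And>r. R \<le> r \<Longrightarrow> Q r = 0"
    and Qc: "continuous_on {0<..} Q" and Q0: "\<And>r. 0 < r \<Longrightarrow> 0 \<le> Q r"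
    and m: "0 < m"
    and le: "\<And>r. 0 < r \<Longrightarrow> Q r + M * (2 * f r * (r * f' r) + 2 * s * (f r)\<^sup>2) \<le> m * (r * f' r)\<^sup>2"
  shows "nnint {0<..} (\<lambda>r. r powr (2 * s-1) * Q r)
    \<le> nnint {0<..} (\<lambda>r. r powr (2 * s-1) * (m * (r * f' r)\<^sup>2))" (is "?L \<le> ?R")
\<comment> \<open>For negative \<open>s\<close> the boundary term at the origin is controlled only
  through a finite right-hand side; an infinite one makes the claim trivial.\<close>
proof (cases "s < 0 \<and> ?R = \<infinity>")
  case True
  then show ?thesis by simp
next
  case False
  have c: "continuous_on {0<..} f"
    using f by (meson DERIV_continuous continuous_at_imp_continuous_on greaterThan_iff)
  have sub: "{0<..<R} \<subseteq> {0<..}" by auto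
  have trace: "((\<lambda>r. r powr s * f r) \<longlongrightarrow> 0) (at_right 0)"
  proof (cases "s < 0")
    case True
    have "?R = ennreal m * (nnint {0<..} (\<lambda>r. r powr (2 * s-1) * (r * f' r)\<^sup>2))"
    proof (subst nn_integral_cmult[symmetric])
      show "(\<lambda>x. ennreal (x powr (2 * s - 1) * (x * f' x)\<^sup>2) * indicator {0<..} x) \<in> borel_measurable lborel"
        using borel_measurable_weighted_energy[OF f'] by simp
      show "?R = (\<integral>\<^sup>+x. ennreal m * (ennreal (x powr (2 * s - 1) * (x * f' x)\<^sup>2) * indicator {0<..} x) \<partial>lborel)"
        using m by (intro nn_integral_cong) (auto simp: ennreal_mult[symmetric] indicator_def mult_ac)
    qed
    then have "nnint {0<..} (\<lambda>r. r powr (2 * s-1) * (r * f' r)\<^sup>2) < \<infinity>"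
      using False True m by (auto simp: ennreal_mult_eq_top_iff less_top)
    then show ?thesis
      using fl l[OF True] by (intro powr_weighted_trace_tendsto_0[OF f f' _ True]) auto
  next
    case False
    then have "((\<lambda>r. r powr s) \<longlongrightarrow> 0) (at_right 0)"
      using s by (intro tendsto_eq_rhs[OF tendsto_powr'[of "\<lambda>r. r" 0 _ "\<lambda>_. s" s]]) (auto intro!: tendsto_intros eventually_at_right_less simp: eventually_at_filter)
    from tendsto_mult[OF this fl] show ?thesis by simp
  qed
  have "?L = nnint {0<..<R} (\<lambda>r. r powr (2 * s-1) * Q r)"
    by (intro nn_integral_cong) (auto simp: indicator_def QR)
  also have "\<dots> \<le> nnint {0<..<R} (\<lambda>r. r powr (2 * s-1) * (m * (r * f' r)\<^sup>2))"
  proof (rule nn_integral_le_antiderivative[OF R, where F = "\<lambda>r. M * (r powr s * f r)\<^sup>2"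
        and F' = "\<lambda>r. r powr (2 * s-1) * (M * (2 * f r * (r * f' r) + 2 * s * (f r)\<^sup>2))"])
    fix r :: real assume r: "0 < r" "r < R"
    have "((\<lambda>r. r powr s * f r) has_real_derivative (s * r powr (s - 1) * f r + r powr s * f' r)) (at r)"
      using r by (auto intro!: derivative_eq_intros f simp: mult_ac)
    from DERIV_cmult[OF DERIV_power[OF this, of 2], of M]
    have "((\<lambda>r. M * (r powr s * f r)\<^sup>2) has_real_derivative M * (2 * (r powr s * f r) * (s * r powr (s - 1) * f r + r powr s * f' r))) (at r)"
      by (simp add: mult_ac)
    moreover have "M * (2 * (r powr s * f r) * (s * r powr (s - 1) * f r + r powr s * f' r))
       = r powr (2 * s-1) * (M * (2 * f r * (r * f' r) + 2 * s * (f r)\<^sup>2))"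
    proof -
      have 1: "r powr s = r powr (s - 1) * r" using r by (simp add: powr_diff)
      have 2: "r powr (2 * s-1) = r powr (s - 1) * r powr (s - 1) * r"
        using r by (simp add: powr_diff powr_add[symmetric] field_simps)
      show ?thesis unfolding 1 2 by (simp add: power2_eq_square algebra_simps)
    qed
    ultimately show "((\<lambda>r. M * (r powr s * f r)\<^sup>2) has_real_derivative r powr (2 * s-1) * (M * (2 * f r * (r * f' r) + 2 * s * (f r)\<^sup>2))) (at r)"
      by simp
    have "r powr (2 * s-1) * (M * (2 * f r * (r * f' r) + 2 * s * (f r)\<^sup>2)) \<le> r powr (2 * s-1) * (m * (r * f' r)\<^sup>2 - Q r)"
      using le[OF r(1)] by (intro mult_left_mono) auto
    then show "r powr (2 * s-1) * (M * (2 * f r * (r * f' r) + 2 * s * (f r)\<^sup>2))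
        \<le> r powr (2 * s-1) * (m * (r * f' r)\<^sup>2) - r powr (2 * s-1) * Q r"
      by (simp add: right_diff_distrib)
  next
    show "((\<lambda>r. M * (r powr s * f r)\<^sup>2) \<longlongrightarrow> 0) (at_right 0)"
      by (rule tendsto_eq_rhs[OF tendsto_mult[OF tendsto_const tendsto_power[OF trace]]]) simp
    have "isCont f R" using f[OF R] by (rule DERIV_isCont)
    then have "isCont (\<lambda>r. M * (r powr s * f r)\<^sup>2) R"
      using R by (intro continuous_intros) auto
    then show "((\<lambda>r. M * (r powr s * f r)\<^sup>2) \<longlongrightarrow> 0) (at_left R)"
      using fR[of R] by (simp add: isCont_def filterlim_at_split)
  qed (use m Q0 in \<open>auto intro!: continuous_intros continuous_on_subset[OF f' sub] continuous_on_subset[OF Qc sub]\<close>)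
  also have "\<dots> \<le> ?R"
    by (intro nn_integral_mono mult_left_mono) (auto simp: indicator_def)
  finally show ?thesis .
qed

section \<open>Spherical components of a field\<close>

lemma spherical_frame_derivs:
  "((\<lambda>t. e_rho a b c t \<phi>) has_vector_derivative e_theta a b c \<theta> \<phi>) (at \<theta>)"
  "((\<lambda>t. e_theta a b c t \<phi>) has_vector_derivative - e_rho a b c \<theta> \<phi>) (at \<theta>)"
  "((\<lambda>f. e_rho a b c \<theta> f) has_vector_derivative sin \<theta> *\<^sub>R e_phi a b \<phi>) (at \<phi>)"
  "((\<lambda>f. e_theta a b c \<theta> f) has_vector_derivative cos \<theta> *\<^sub>R e_phi a b \<phi>) (at \<phi>)"
  "((\<lambda>f. e_phi a b f) has_vector_derivative - (sin \<theta> *\<^sub>R e_rho a b c \<theta> \<phi> + cos \<theta> *\<^sub>R e_theta a b c \<theta> \<phi>)) (at \<phi>)"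
proof -
  have s: "sin \<theta> * sin \<theta> + cos \<theta> * cos \<theta> = 1"
    using sin_cos_squared_add[of \<theta>] by (simp add: power2_eq_square)
  show "((\<lambda>t. e_rho a b c t \<phi>) has_vector_derivative e_theta a b c \<theta> \<phi>) (at \<theta>)"
    unfolding e_rho_def e_theta_def
    by (auto intro!: derivative_eq_intros simp: algebra_simps)
  show "((\<lambda>t. e_theta a b c t \<phi>) has_vector_derivative - e_rho a b c \<theta> \<phi>) (at \<theta>)"
    unfolding e_rho_def e_theta_def
    by (auto intro!: derivative_eq_intros simp: algebra_simps)
  show "((\<lambda>f. e_rho a b c \<theta> f) has_vector_derivative sin \<theta> *\<^sub>R e_phi a b \<phi>) (at \<phi>)"
    unfolding e_rho_def e_phi_def
    by (auto intro!: derivative_eq_intros simp: algebra_simps)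
  show "((\<lambda>f. e_theta a b c \<theta> f) has_vector_derivative cos \<theta> *\<^sub>R e_phi a b \<phi>) (at \<phi>)"
    unfolding e_theta_def e_phi_def
    by (auto intro!: derivative_eq_intros simp: algebra_simps)
  \<comment> \<open>Minus the horizontal unit vector of azimuth \<open>\<phi>\<close>. It lies in
    the span of \<open>e_rho\<close> and \<open>e_theta\<close> for every polar angle, so
    \<open>\<theta>\<close> only selects how it is decomposed.\<close>
  have "((\<lambda>f. e_phi a b f) has_vector_derivative - (cos \<phi> *\<^sub>R a + sin \<phi> *\<^sub>R b)) (at \<phi>)"
    unfolding e_phi_def
    by (auto intro!: derivative_eq_intros simp: algebra_simps)
  moreover have "sin \<theta> *\<^sub>R e_rho a b c \<theta> \<phi> + cos \<theta> *\<^sub>R e_theta a b c \<theta> \<phi>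
      = (sin \<theta> * sin \<theta> + cos \<theta> * cos \<theta>) *\<^sub>R (cos \<phi> *\<^sub>R a + sin \<phi> *\<^sub>R b)"
    unfolding e_rho_def e_theta_def by (simp add: algebra_simps del: sin_cos_squared_add3)
  moreover have "(sin \<theta> * sin \<theta> + cos \<theta> * cos \<theta>) *\<^sub>R (cos \<phi> *\<^sub>R a + sin \<phi> *\<^sub>R b) = cos \<phi> *\<^sub>R a + sin \<phi> *\<^sub>R b"
    unfolding s by simp
  ultimately show "((\<lambda>f. e_phi a b f) has_vector_derivative - (sin \<theta> *\<^sub>R e_rho a b c \<theta> \<phi> + cos \<theta> *\<^sub>R e_theta a b c \<theta> \<phi>)) (at \<phi>)"
    by simp
qed

lemma has_vector_derivative_compose_field:
  assumes u: "(u has_derivative D) (at (g t))" and g: "(g has_vector_derivative v) (at t)"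
  shows "((\<lambda>t. u (g t)) has_vector_derivative D v) (at t)"
  using has_derivative_compose[OF g[unfolded has_vector_derivative_def] u]
  by (simp add: has_vector_derivative_def linear_cmul[OF has_derivative_linear[OF u]])

text \<open>The representation \<open>rep\<close> is asked for only on the open coordinate domain,
  which has full measure, while the components and their derivatives live at all angles, because the
  polar inequalities evaluate them at the poles. The locale serves arbitrary axisymmetric fields as
  well as the explicit test fields.\<close>

locale spherical_components =
  fixes a b c :: "real^3" and u :: "real^3 \<Rightarrow> real^3" and p q w pr qr wr pt qt wt :: "real \<Rightarrow> real \<Rightarrow> real"
  assumes frame: "orthonormal_frame a b c"
    and u_diff: "\<And>x. u differentiable (at x)"
    and rep: "\<And>r \<theta> \<phi>. 0 < r \<Longrightarrow> 0 < \<theta> \<Longrightarrow> \<theta> < pi \<Longrightarrow> 0 < \<phi> \<Longrightarrow> \<phi> < 2 * pi \<Longrightarrow>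
      u (r *\<^sub>R e_rho a b c \<theta> \<phi>) = p r \<theta> *\<^sub>R e_rho a b c \<theta> \<phi> + q r \<theta> *\<^sub>R e_theta a b c \<theta> \<phi> + w r \<theta> *\<^sub>R e_phi a b \<phi>"
    and deriv_r: "\<And>r \<theta>. 0 < r \<Longrightarrow> ((\<lambda>r. p r \<theta>) has_real_derivative pr r \<theta>) (at r)"
      "\<And>r \<theta>. 0 < r \<Longrightarrow> ((\<lambda>r. q r \<theta>) has_real_derivative qr r \<theta>) (at r)"
      "\<And>r \<theta>. 0 < r \<Longrightarrow> ((\<lambda>r. w r \<theta>) has_real_derivative wr r \<theta>) (at r)"
    and deriv_t: "\<And>r \<theta>. 0 < r \<Longrightarrow> ((\<lambda>t. p r t) has_real_derivative pt r \<theta>) (at \<theta>)"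
      "\<And>r \<theta>. 0 < r \<Longrightarrow> ((\<lambda>t. q r t) has_real_derivative qt r \<theta>) (at \<theta>)"
      "\<And>r \<theta>. 0 < r \<Longrightarrow> ((\<lambda>t. w r t) has_real_derivative wt r \<theta>) (at \<theta>)"
    and cont_r: "continuous_on ({0<..} \<times> UNIV) (\<lambda>z. pr (fst z) (snd z))" "continuous_on ({0<..} \<times> UNIV) (\<lambda>z. qr (fst z) (snd z))"
      "continuous_on ({0<..} \<times> UNIV) (\<lambda>z. wr (fst z) (snd z))"
    and cont_t: "continuous_on ({0<..} \<times> UNIV) (\<lambda>z. pt (fst z) (snd z))" "continuous_on ({0<..} \<times> UNIV) (\<lambda>z. qt (fst z) (snd z))"
      "continuous_on ({0<..} \<times> UNIV) (\<lambda>z. wt (fst z) (snd z))"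
    and cont: "continuous_on ({0<..} \<times> UNIV) (\<lambda>z. p (fst z) (snd z))" "continuous_on ({0<..} \<times> UNIV) (\<lambda>z. q (fst z) (snd z))"
      "continuous_on ({0<..} \<times> UNIV) (\<lambda>z. w (fst z) (snd z))"
begin

context
  fixes r \<theta> \<phi> :: real
  assumes r: "0 < r" and \<theta>: "0 < \<theta>" "\<theta> < pi" and \<phi>: "0 < \<phi>" "\<phi> < 2 * pi"
begin

abbreviation "eR \<equiv> e_rho a b c \<theta> \<phi>"
abbreviation "eT \<equiv> e_theta a b c \<theta> \<phi>"
abbreviation "eP \<equiv> e_phi a b \<phi>"
abbreviation "Du \<equiv> frechet_derivative u (at (r *\<^sub>R eR))"

lemma Du: "(u has_derivative Du) (at (r *\<^sub>R eR))"
  using u_diff frechet_derivative_works by blast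

lemma frame_at: "orthonormal_frame eR eT eP"
  by (rule spherical_frame[OF frame])

lemma norm_spherical: "norm (r *\<^sub>R eR) = r"
  using frame_at r by (simp add: orthonormal_frame_def)

lemma norm_sq_components: "(norm (u (r *\<^sub>R eR)))\<^sup>2 = (p r \<theta>)\<^sup>2 + (q r \<theta>)\<^sup>2 + (w r \<theta>)\<^sup>2"
  unfolding norm_sq_frame[OF frame_at] rep[OF r \<theta> \<phi>]
  by (simp add: inner_simps frame_inner[OF frame_at])

text \<open>Here and in the next two lemmas \<open>u\<close> is differentiated along a coordinate
  curve in two ways, by the chain rule and through the components with the moving frame; vector
  derivatives are unique.\<close>

lemma D_rho: "Du eR = pr r \<theta> *\<^sub>R eR + qr r \<theta> *\<^sub>R eT + wr r \<theta> *\<^sub>R eP"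
proof -
  have "((\<lambda>r. r *\<^sub>R eR) has_vector_derivative eR) (at r)"
    by (auto intro!: derivative_eq_intros)
  then have 1: "((\<lambda>r. u (r *\<^sub>R eR)) has_vector_derivative Du eR) (at r)"
    by (rule has_vector_derivative_compose_field[rotated]) (rule Du)
  have "((\<lambda>r. p r \<theta> *\<^sub>R eR + q r \<theta> *\<^sub>R eT + w r \<theta> *\<^sub>R eP) has_vector_derivative
      pr r \<theta> *\<^sub>R eR + qr r \<theta> *\<^sub>R eT + wr r \<theta> *\<^sub>R eP) (at r)"
    by (auto intro!: derivative_eq_intros deriv_r r)
  then have "((\<lambda>r. u (r *\<^sub>R eR)) has_vector_derivative pr r \<theta> *\<^sub>R eR + qr r \<theta> *\<^sub>R eT + wr r \<theta> *\<^sub>R eP) (at r)"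
    by (rule has_vector_derivative_transform_within_open[where S = "{0<..}"]) (use r \<theta> \<phi> in \<open>auto simp: rep\<close>)
  with 1 show ?thesis by (rule vector_derivative_unique_at)
qed

lemma D_theta: "r *\<^sub>R Du eT = (pt r \<theta> - q r \<theta>) *\<^sub>R eR + (qt r \<theta> + p r \<theta>) *\<^sub>R eT + wt r \<theta> *\<^sub>R eP"
proof -
  have "((\<lambda>t. r *\<^sub>R e_rho a b c t \<phi>) has_vector_derivative r *\<^sub>R eT) (at \<theta>)"
    by (auto intro!: derivative_eq_intros spherical_frame_derivs)
  then have "((\<lambda>t. u (r *\<^sub>R e_rho a b c t \<phi>)) has_vector_derivative Du (r *\<^sub>R eT)) (at \<theta>)"
    by (rule has_vector_derivative_compose_field[rotated]) (rule Du)
  then have 1: "((\<lambda>t. u (r *\<^sub>R e_rho a b c t \<phi>)) has_vector_derivative r *\<^sub>R Du eT) (at \<theta>)"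
    by (simp add: linear_cmul[OF has_derivative_linear[OF Du]])
  have "((\<lambda>t. p r t *\<^sub>R e_rho a b c t \<phi> + q r t *\<^sub>R e_theta a b c t \<phi> + w r t *\<^sub>R eP) has_vector_derivative
      (pt r \<theta> - q r \<theta>) *\<^sub>R eR + (qt r \<theta> + p r \<theta>) *\<^sub>R eT + wt r \<theta> *\<^sub>R eP) (at \<theta>)"
    by (auto intro!: derivative_eq_intros deriv_t r spherical_frame_derivs simp: algebra_simps)
  then have "((\<lambda>t. u (r *\<^sub>R e_rho a b c t \<phi>)) has_vector_derivative
      (pt r \<theta> - q r \<theta>) *\<^sub>R eR + (qt r \<theta> + p r \<theta>) *\<^sub>R eT + wt r \<theta> *\<^sub>R eP) (at \<theta>)"
    by (rule has_vector_derivative_transform_within_open[where S = "{0<..<pi}"]) (use r \<theta> \<phi> in \<open>auto simp: rep\<close>)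
  with 1 show ?thesis by (rule vector_derivative_unique_at)
qed

lemma D_phi: "(r * sin \<theta>) *\<^sub>R Du eP =
    (- w r \<theta> * sin \<theta>) *\<^sub>R eR + (- w r \<theta> * cos \<theta>) *\<^sub>R eT + (p r \<theta> * sin \<theta> + q r \<theta> * cos \<theta>) *\<^sub>R eP"
proof -
  have "((\<lambda>t. r *\<^sub>R e_rho a b c \<theta> t) has_vector_derivative (r * sin \<theta>) *\<^sub>R eP) (at \<phi>)"
    by (auto intro!: derivative_eq_intros spherical_frame_derivs)
  then have "((\<lambda>t. u (r *\<^sub>R e_rho a b c \<theta> t)) has_vector_derivative Du ((r * sin \<theta>) *\<^sub>R eP)) (at \<phi>)"
    by (rule has_vector_derivative_compose_field[rotated]) (rule Du)
  then have 1: "((\<lambda>t. u (r *\<^sub>R e_rho a b c \<theta> t)) has_vector_derivative (r * sin \<theta>) *\<^sub>R Du eP) (at \<phi>)"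
    by (simp add: linear_cmul[OF has_derivative_linear[OF Du]])
  have "((\<lambda>t. p r \<theta> *\<^sub>R e_rho a b c \<theta> t + q r \<theta> *\<^sub>R e_theta a b c \<theta> t + w r \<theta> *\<^sub>R e_phi a b t) has_vector_derivative
      (- w r \<theta> * sin \<theta>) *\<^sub>R eR + (- w r \<theta> * cos \<theta>) *\<^sub>R eT + (p r \<theta> * sin \<theta> + q r \<theta> * cos \<theta>) *\<^sub>R eP) (at \<phi>)"
    by (rule has_vector_derivative_eq_rhs, (rule derivative_intros spherical_frame_derivs(3-5)[where \<theta> = \<theta> and c = c])+)
       (simp add: algebra_simps)
  then have "((\<lambda>t. u (r *\<^sub>R e_rho a b c \<theta> t)) has_vector_derivative
      (- w r \<theta> * sin \<theta>) *\<^sub>R eR + (- w r \<theta> * cos \<theta>) *\<^sub>R eT + (p r \<theta> * sin \<theta> + q r \<theta> * cos \<theta>) *\<^sub>R eP) (at \<phi>)"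
    by (rule has_vector_derivative_transform_within_open[where S = "{0<..<2 * pi}"]) (use r \<theta> \<phi> in \<open>auto simp: rep\<close>)
  with 1 show ?thesis by (rule vector_derivative_unique_at)
qed

lemma sin_theta_pos: "0 < sin \<theta>"
  using \<theta> sin_gt_zero by blast

lemma norm_frame_comb: "(norm (x *\<^sub>R eR + y *\<^sub>R eT + z *\<^sub>R eP))\<^sup>2 = x\<^sup>2 + y\<^sup>2 + z\<^sup>2"
  unfolding norm_sq_frame[OF frame_at] by (simp add: inner_simps frame_inner[OF frame_at])

text \<open>Clearing the denominators by \<open>r^2\<close> leaves three groups: radial derivatives,
  the angular energy of \<open>(p, q)\<close>, and that of \<open>w\<close>. The two contributions
  of \<open>w\<close> to the azimuthal derivative add up to \<open>w^2\<close> by Pythagoras, so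
  that swirl and poloidal part do not mix and can be estimated separately.\<close>

lemma grad_sq_components:
  "r\<^sup>2 * grad_sq u (r *\<^sub>R eR) = r\<^sup>2 * ((pr r \<theta>)\<^sup>2 + (qr r \<theta>)\<^sup>2 + (wr r \<theta>)\<^sup>2)
     + ((pt r \<theta> - q r \<theta>)\<^sup>2 + (qt r \<theta> + p r \<theta>)\<^sup>2 + (p r \<theta> + q r \<theta> * (cos \<theta> / sin \<theta>))\<^sup>2)
     + ((wt r \<theta>)\<^sup>2 + (w r \<theta> / sin \<theta>)\<^sup>2)"
proof -
  have 2: "r\<^sup>2 * (norm (Du eT))\<^sup>2 = (pt r \<theta> - q r \<theta>)\<^sup>2 + (qt r \<theta> + p r \<theta>)\<^sup>2 + (wt r \<theta>)\<^sup>2"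
    using arg_cong[OF D_theta, of "\<lambda>x. (norm x)\<^sup>2"] by (simp add: norm_frame_comb power_mult_distrib)
  have "(sin \<theta>)\<^sup>2 * (r\<^sup>2 * (norm (Du eP))\<^sup>2)
      = (w r \<theta> * sin \<theta>)\<^sup>2 + (w r \<theta> * cos \<theta>)\<^sup>2 + (p r \<theta> * sin \<theta> + q r \<theta> * cos \<theta>)\<^sup>2"
    using arg_cong[OF D_phi, of "\<lambda>x. (norm x)\<^sup>2"] unfolding norm_frame_comb
    by (simp add: power_mult_distrib mult_ac)
  also have "(w r \<theta> * sin \<theta>)\<^sup>2 + (w r \<theta> * cos \<theta>)\<^sup>2 = (w r \<theta>)\<^sup>2"
    by (simp add: power_mult_distrib distrib_left[symmetric])
  finally have "(sin \<theta>)\<^sup>2 * (r\<^sup>2 * (norm (Du eP))\<^sup>2) = (w r \<theta>)\<^sup>2 + (p r \<theta> * sin \<theta> + q r \<theta> * cos \<theta>)\<^sup>2" .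
  then have "r\<^sup>2 * (norm (Du eP))\<^sup>2 = ((w r \<theta>)\<^sup>2 + (p r \<theta> * sin \<theta> + q r \<theta> * cos \<theta>)\<^sup>2) / (sin \<theta>)\<^sup>2"
    using sin_theta_pos by (simp add: field_simps)
  also have "\<dots> = (w r \<theta> / sin \<theta>)\<^sup>2 + (p r \<theta> + q r \<theta> * (cos \<theta> / sin \<theta>))\<^sup>2"
  proof -
    have e: "p r \<theta> + q r \<theta> * (cos \<theta> / sin \<theta>) = (p r \<theta> * sin \<theta> + q r \<theta> * cos \<theta>) / sin \<theta>"
      using sin_theta_pos by (simp add: field_simps)
    show ?thesis unfolding e power_divide by (rule add_divide_distrib)
  qed
  finally show ?thesis
    unfolding grad_sq_frame[OF frame_at Du] using 2
    by (simp add: distrib_left D_rho norm_frame_comb)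
qed

lemma divergence_components:
  "r * divergence u (r *\<^sub>R eR) = r * pr r \<theta> + 2 * p r \<theta> + qt r \<theta> + q r \<theta> * (cos \<theta> / sin \<theta>)"
proof -
  have 1: "r * (Du eT \<bullet> eT) = qt r \<theta> + p r \<theta>"
    using arg_cong[OF D_theta, of "\<lambda>x. x \<bullet> eT"] by (simp add: inner_simps frame_inner[OF frame_at])
  have "(r * sin \<theta>) * (Du eP \<bullet> eP) = p r \<theta> * sin \<theta> + q r \<theta> * cos \<theta>"
    using arg_cong[OF D_phi, of "\<lambda>x. x \<bullet> eP"] by (simp add: inner_simps frame_inner[OF frame_at])
  then have 2: "r * (Du eP \<bullet> eP) = p r \<theta> + q r \<theta> * (cos \<theta> / sin \<theta>)"
    using sin_theta_pos by (simp add: field_simps)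
  have 3: "Du eR \<bullet> eR = pr r \<theta>"
    unfolding D_rho by (simp add: inner_simps frame_inner[OF frame_at])
  show ?thesis
    unfolding divergence_frame[OF frame_at Du] distrib_left 1 2 3 by simp
qed

end
end

section \<open>Components of an axisymmetric field and their regularity\<close>

lemma Ck_1_continuous_derivative:
  fixes u :: "'a::euclidean_space \<Rightarrow> 'b::real_normed_vector"
  assumes u: "Ck (Suc 0) u" and g: "continuous_on S g" and v: "continuous_on S v"
  shows "continuous_on S (\<lambda>z. frechet_derivative u (at (g z)) (v z))"
proof -
  have lin: "linear (frechet_derivative u (at x))" for x
    using u by (simp add: linear_frechet_derivative)
  have c: "continuous_on S (\<lambda>z. frechet_derivative u (at (g z)) b)" if "b \<in> Basis" for b
    using u that g continuous_on_compose2[of UNIV "\<lambda>x. frechet_derivative u (at x) b" S g] by auto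
  \<comment> \<open>\<open>Ck\<close> controls the derivative in the fixed basis directions only;
    linearity passes to directions that vary with the point.\<close>
  have "frechet_derivative u (at x) w = (\<Sum>b\<in>Basis. (w \<bullet> b) *\<^sub>R frechet_derivative u (at x) b)" for x w
  proof -
    have "frechet_derivative u (at x) w = frechet_derivative u (at x) (\<Sum>b\<in>Basis. (w \<bullet> b) *\<^sub>R b)"
      by (simp only: euclidean_representation)
    also have "\<dots> = (\<Sum>b\<in>Basis. (w \<bullet> b) *\<^sub>R frechet_derivative u (at x) b)"
      by (simp only: linear_sum[OF lin] linear_cmul[OF lin])
    finally show ?thesis .
  qed
  then have "(\<lambda>z. frechet_derivative u (at (g z)) (v z)) = (\<lambda>z. \<Sum>b\<in>Basis. (v z \<bullet> b) *\<^sub>R frechet_derivative u (at (g z)) b)"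
    by (intro ext)
  then show ?thesis
    by (simp only:) (intro continuous_intros c v)
qed

lemma Ck_1_continuous:
  assumes "Ck (Suc 0) u"
  shows "continuous_on S u"
  using assms by (auto intro!: differentiable_imp_continuous_on simp: differentiable_on_def differentiable_at_withinI)

lemma Ck_1_derivative:
  assumes "Ck (Suc 0) u"
  shows "(u has_derivative frechet_derivative u (at x)) (at x)"
  using assms by (simp add: frechet_derivative_works)

text \<open>Here \<open>e\<close> traces the directions of a meridian and \<open>n\<close> is the
  frame vector that extracts a component. Letting both be arbitrary curves treats the radial, polar
  and azimuthal components at once, the last with constant \<open>n\<close>.\<close>

lemma polar_component_derivatives:
  fixes u :: "real^3 \<Rightarrow> real^3" and e n :: "real \<Rightarrow> real^3"
  assumes u: "Ck (Suc 0) u"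
    and e: "\<And>t. (e has_vector_derivative e' t) (at t)" and n: "\<And>t. (n has_vector_derivative n' t) (at t)"
    and ce: "continuous_on UNIV e'" and cn: "continuous_on UNIV n'"
  shows "\<exists>Fr Ft. (\<forall>r t. ((\<lambda>r. u (r *\<^sub>R e t) \<bullet> n t) has_real_derivative Fr r t) (at r)) \<and>
    (\<forall>r t. ((\<lambda>t. u (r *\<^sub>R e t) \<bullet> n t) has_real_derivative Ft r t) (at t)) \<and>
    continuous_on UNIV (\<lambda>z. Fr (fst z) (snd z)) \<and> continuous_on UNIV (\<lambda>z. Ft (fst z) (snd z)) \<and>
    continuous_on UNIV (\<lambda>z. u (fst z *\<^sub>R e (snd z)) \<bullet> n (snd z))"
proof (intro exI conjI allI)
  let ?D = "\<lambda>x. frechet_derivative u (at x)"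
  have c: "continuous_on UNIV e" "continuous_on UNIV n"
    using e n by (meson continuous_at_imp_continuous_on has_vector_derivative_continuous)+
  have comp: "continuous_on UNIV (\<lambda>z :: real \<times> real. f (snd z))" if "continuous_on UNIV f" for f :: "real \<Rightarrow> real^3"
    using continuous_on_compose2[OF that, of UNIV "snd :: real \<times> real \<Rightarrow> real"] by (simp add: continuous_on_snd continuous_on_id)
  note cc = comp[OF c(1)] comp[OF c(2)] comp[OF ce] comp[OF cn]
  have cu: "continuous_on UNIV (\<lambda>z. u (fst z *\<^sub>R e (snd z)))"
    by (rule continuous_on_compose2[OF Ck_1_continuous[OF u]]) (auto intro!: continuous_intros cc)
  show "((\<lambda>r. u (r *\<^sub>R e t) \<bullet> n t) has_real_derivative ?D (r *\<^sub>R e t) (e t) \<bullet> n t) (at r)" for r t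
  proof -
    have "((\<lambda>r. r *\<^sub>R e t) has_vector_derivative e t) (at r)"
      by (auto intro!: derivative_eq_intros)
    then have "((\<lambda>r. u (r *\<^sub>R e t)) has_vector_derivative ?D (r *\<^sub>R e t) (e t)) (at r)"
      by (rule has_vector_derivative_compose_field[rotated]) (rule Ck_1_derivative[OF u])
    from bounded_linear.has_vector_derivative[OF bounded_linear_inner_left this, of "n t"]
    show ?thesis by (simp add: has_real_derivative_iff_has_vector_derivative)
  qed
  show "((\<lambda>t. u (r *\<^sub>R e t) \<bullet> n t) has_real_derivative
      (u (r *\<^sub>R e t) \<bullet> n' t + ?D (r *\<^sub>R e t) (r *\<^sub>R e' t) \<bullet> n t)) (at t)" for r t
  proof -
    have "((\<lambda>t. r *\<^sub>R e t) has_vector_derivative r *\<^sub>R e' t) (at t)"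
      by (auto intro!: derivative_eq_intros e)
    then have "((\<lambda>t. u (r *\<^sub>R e t)) has_vector_derivative ?D (r *\<^sub>R e t) (r *\<^sub>R e' t)) (at t)"
      by (rule has_vector_derivative_compose_field[rotated]) (rule Ck_1_derivative[OF u])
    from bounded_bilinear.has_vector_derivative[OF bounded_bilinear_inner this n]
    show ?thesis by (simp add: has_real_derivative_iff_has_vector_derivative)
  qed
  show "continuous_on UNIV (\<lambda>z. ?D (fst z *\<^sub>R e (snd z)) (e (snd z)) \<bullet> n (snd z))"
    by (intro continuous_intros Ck_1_continuous_derivative[OF u] cc)
  show "continuous_on UNIV (\<lambda>z. u (fst z *\<^sub>R e (snd z)) \<bullet> n' (snd z) + ?D (fst z *\<^sub>R e (snd z)) (fst z *\<^sub>R e' (snd z)) \<bullet> n (snd z))"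
    by (intro continuous_intros Ck_1_continuous_derivative[OF u] cc cu)
  show "continuous_on UNIV (\<lambda>z. u (fst z *\<^sub>R e (snd z)) \<bullet> n (snd z))"
    by (intro continuous_intros cc cu)
qed

text \<open>The component functions in \<open>axisymmetric\<close> are merely asserted to exist and
  carry no regularity. Reading them off on the meridian of azimuth 0 gives inner products of
  \<open>u\<close> with smooth curves of frame vectors, which inherit differentiability from
  \<open>u\<close> and extend to all polar angles.\<close>

lemma axisymmetric_components:
  assumes frame: "orthonormal_frame a b c" and u: "Ck (Suc 0) u" and ax: "axisymmetric a b c u"
  obtains pr qr wr pt qt wt where
    "spherical_components a b c u (\<lambda>r t. u (r *\<^sub>R e_rho a b c t 0) \<bullet> e_rho a b c t 0)
       (\<lambda>r t. u (r *\<^sub>R e_rho a b c t 0) \<bullet> e_theta a b c t 0) (\<lambda>r t. u (r *\<^sub>R e_rho a b c t 0) \<bullet> e_phi a b 0)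
       pr qr wr pt qt wt"
proof -
  let ?e = "\<lambda>t. e_rho a b c t 0" and ?t = "\<lambda>t. e_theta a b c t 0" and ?f = "\<lambda>t::real. e_phi a b 0"
  have ce: "continuous_on UNIV ?t" "continuous_on UNIV (\<lambda>t. - ?e t)"
    unfolding e_theta_def e_rho_def by (intro continuous_intros)+
  note ev = spherical_frame_derivs(1,2)[of a b c 0]
  obtain pr pt where P: "\<And>r t. ((\<lambda>r. u (r *\<^sub>R ?e t) \<bullet> ?e t) has_real_derivative pr r t) (at r)"
    "\<And>r t. ((\<lambda>t. u (r *\<^sub>R ?e t) \<bullet> ?e t) has_real_derivative pt r t) (at t)"
    "continuous_on UNIV (\<lambda>z. pr (fst z) (snd z))" "continuous_on UNIV (\<lambda>z. pt (fst z) (snd z))"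
    "continuous_on UNIV (\<lambda>z. u (fst z *\<^sub>R ?e (snd z)) \<bullet> ?e (snd z))"
    using polar_component_derivatives[OF u ev(1) ev(1) ce(1) ce(1)] by blast
  obtain qr qt where Q: "\<And>r t. ((\<lambda>r. u (r *\<^sub>R ?e t) \<bullet> ?t t) has_real_derivative qr r t) (at r)"
    "\<And>r t. ((\<lambda>t. u (r *\<^sub>R ?e t) \<bullet> ?t t) has_real_derivative qt r t) (at t)"
    "continuous_on UNIV (\<lambda>z. qr (fst z) (snd z))" "continuous_on UNIV (\<lambda>z. qt (fst z) (snd z))"
    "continuous_on UNIV (\<lambda>z. u (fst z *\<^sub>R ?e (snd z)) \<bullet> ?t (snd z))"
    using polar_component_derivatives[OF u ev ce] by blast
  obtain wr wt where W: "\<And>r t. ((\<lambda>r. u (r *\<^sub>R ?e t) \<bullet> ?f t) has_real_derivative wr r t) (at r)"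
    "\<And>r t. ((\<lambda>t. u (r *\<^sub>R ?e t) \<bullet> ?f t) has_real_derivative wt r t) (at t)"
    "continuous_on UNIV (\<lambda>z. wr (fst z) (snd z))" "continuous_on UNIV (\<lambda>z. wt (fst z) (snd z))"
    "continuous_on UNIV (\<lambda>z. u (fst z *\<^sub>R ?e (snd z)) \<bullet> ?f (snd z))"
    using polar_component_derivatives[OF u ev(1) has_vector_derivative_const ce(1) continuous_on_const] by blast
  obtain u1 u2 u3 where U: "\<And>\<rho> \<theta> \<phi>. 0 < \<rho> \<Longrightarrow> \<theta> \<in> {0..pi} \<Longrightarrow> \<phi> \<in> {0..<2*pi} \<Longrightarrow>
      u (\<rho> *\<^sub>R e_rho a b c \<theta> \<phi>) =
            u1 \<rho> \<theta> *\<^sub>R e_rho a b c \<theta> \<phi> + u2 \<rho> \<theta> *\<^sub>R e_theta a b c \<theta> \<phi> + u3 \<rho> \<theta> *\<^sub>R e_phi a b \<phi>"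
    using ax unfolding axisymmetric_def by blast
  have eq: "u (\<rho> *\<^sub>R ?e \<theta>) \<bullet> ?e \<theta> = u1 \<rho> \<theta>" "u (\<rho> *\<^sub>R ?e \<theta>) \<bullet> ?t \<theta> = u2 \<rho> \<theta>" "u (\<rho> *\<^sub>R ?e \<theta>) \<bullet> ?f \<theta> = u3 \<rho> \<theta>"
    if "0 < \<rho>" "0 < \<theta>" "\<theta> < pi" for \<rho> \<theta>
    using that U[of \<rho> \<theta> 0] frame_inner[OF spherical_frame[OF frame, of \<theta> 0]] by (simp_all add: inner_simps)
  show ?thesis
  proof (rule that, unfold_locales)
    show "orthonormal_frame a b c" by (rule frame)
    show "u differentiable at x" for x using u by simp
    fix r \<theta> \<phi> :: real assume "0 < r" "0 < \<theta>" "\<theta> < pi" "0 < \<phi>" "\<phi> < 2 * pi"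
    then show "u (r *\<^sub>R e_rho a b c \<theta> \<phi>) = (u (r *\<^sub>R ?e \<theta>) \<bullet> ?e \<theta>) *\<^sub>R e_rho a b c \<theta> \<phi>
      + (u (r *\<^sub>R ?e \<theta>) \<bullet> ?t \<theta>) *\<^sub>R e_theta a b c \<theta> \<phi> + (u (r *\<^sub>R ?e \<theta>) \<bullet> e_phi a b 0) *\<^sub>R e_phi a b \<phi>"
      using U[of r \<theta> \<phi>] by (simp add: eq)
  qed (rule P Q W continuous_on_subset[OF P(3)] continuous_on_subset[OF P(4)] continuous_on_subset[OF P(5)]
      continuous_on_subset[OF Q(3)] continuous_on_subset[OF Q(4)] continuous_on_subset[OF Q(5)]
      continuous_on_subset[OF W(3)] continuous_on_subset[OF W(4)] continuous_on_subset[OF W(5)] subset_UNIV)+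
qed

text \<open>On the axis the azimuth is arbitrary, so that comparing two azimuths kills the tangential components.\<close>

lemma axisymmetric_axis:
  assumes frame: "orthonormal_frame a b c" and ax: "axisymmetric a b c u" and r: "0 < r" and \<theta>: "\<theta> = 0 \<or> \<theta> = pi"
  shows "u (r *\<^sub>R e_rho a b c \<theta> 0) \<bullet> e_theta a b c \<theta> 0 = 0" "u (r *\<^sub>R e_rho a b c \<theta> 0) \<bullet> e_phi a b 0 = 0"
proof -
  obtain u1 u2 u3 where U: "\<And>\<phi>. \<phi> \<in> {0..<2*pi} \<Longrightarrow>
      u (r *\<^sub>R e_rho a b c \<theta> \<phi>) = u1 *\<^sub>R e_rho a b c \<theta> \<phi> + u2 *\<^sub>R e_theta a b c \<theta> \<phi> + u3 *\<^sub>R e_phi a b \<phi>"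
    using ax r \<theta> unfolding axisymmetric_def by (metis atLeastAtMost_iff order_refl pi_ge_zero)
  have s: "sin \<theta> = 0" using \<theta> by auto
  have e: "e_rho a b c \<theta> pi = e_rho a b c \<theta> 0" "e_theta a b c \<theta> 0 = cos \<theta> *\<^sub>R a" "e_theta a b c \<theta> pi = - cos \<theta> *\<^sub>R a"
    "e_phi a b 0 = b" "e_phi a b pi = - b" "e_rho a b c \<theta> 0 = cos \<theta> *\<^sub>R c"
    by (simp_all add: e_rho_def e_theta_def e_phi_def s)
  have 1: "u (r *\<^sub>R e_rho a b c \<theta> 0) = u1 *\<^sub>R e_rho a b c \<theta> 0 + u2 *\<^sub>R (cos \<theta> *\<^sub>R a) + u3 *\<^sub>R b"
    using U[of 0] by (simp add: e)
  have 2: "u (r *\<^sub>R e_rho a b c \<theta> 0) = u1 *\<^sub>R e_rho a b c \<theta> 0 + u2 *\<^sub>R (- cos \<theta> *\<^sub>R a) + u3 *\<^sub>R (- b)"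
    using U[of pi] by (simp add: e)
  show "u (r *\<^sub>R e_rho a b c \<theta> 0) \<bullet> e_theta a b c \<theta> 0 = 0"
    using arg_cong[OF 1, of "\<lambda>x. x \<bullet> a"] arg_cong[OF 2, of "\<lambda>x. x \<bullet> a"] by (simp add: e inner_simps frame_inner[OF frame])
  show "u (r *\<^sub>R e_rho a b c \<theta> 0) \<bullet> e_phi a b 0 = 0"
    using arg_cong[OF 1, of "\<lambda>x. x \<bullet> b"] arg_cong[OF 2, of "\<lambda>x. x \<bullet> b"] by (simp add: e inner_simps frame_inner[OF frame])
qed

section \<open>Integrals over the meridian half-plane\<close>

definition half_disc :: "(real \<times> real) set" where
  "half_disc = {0<..} \<times> {0<..<pi}"

definition sector_integral :: "(real \<Rightarrow> real \<Rightarrow> real) \<Rightarrow> ennreal" where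
  "sector_integral G = nnint half_disc (\<lambda>z. G (fst z) (snd z))"

text \<open>Continuity on the open strip gives measurability, and nonnegativity makes Tonelli's
  theorem, additivity and scaling hold in \<open>[0, \<infinity>]\<close> without any
  integrability.\<close>

definition sector_fun :: "(real \<Rightarrow> real \<Rightarrow> real) \<Rightarrow> bool" where
  "sector_fun G \<longleftrightarrow> continuous_on half_disc (\<lambda>z. G (fst z) (snd z)) \<and> (\<forall>r>0. \<forall>t. 0 < t \<longrightarrow> t < pi \<longrightarrow> 0 \<le> G r t)"

lemma half_disc_borel [measurable]: "half_disc \<in> sets borel"
  unfolding half_disc_def by (intro borel_open open_Times) auto

lemma sector_measurable:
  assumes "sector_fun G"
  shows "(\<lambda>z. ennreal (G (fst z) (snd z)) * indicator half_disc z) \<in> borel_measurable (lborel \<Otimes>\<^sub>M lborel)"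
  using borel_measurable_ennreal_indicator[OF _ half_disc_borel] assms
  by (simp add: sector_fun_def lborel_prod)

lemma sector_integral_iterated:
  assumes "sector_fun G"
  shows "sector_integral G = (\<integral>\<^sup>+r. (nnint {0<..<pi} (\<lambda>t. G r t)) * indicator {0<..} r \<partial>lborel)" (is "_ = ?A")
    and "sector_integral G = (\<integral>\<^sup>+t. (nnint {0<..} (\<lambda>r. G r t)) * indicator {0<..<pi} t \<partial>lborel)" (is "_ = ?B")
proof -
  let ?f = "\<lambda>z. ennreal (G (fst z) (snd z)) * indicator half_disc z"
  have m: "?f \<in> borel_measurable (lborel \<Otimes>\<^sub>M lborel)"
    by (rule sector_measurable[OF assms])
  have "sector_integral G = (\<integral>\<^sup>+r. \<integral>\<^sup>+t. ?f (r, t) \<partial>lborel \<partial>lborel)"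
    unfolding sector_integral_def lborel_prod[symmetric] by (rule lborel.nn_integral_fst[OF m, symmetric])
  also have "\<dots> = ?A"
    by (intro nn_integral_cong) (auto simp: half_disc_def indicator_def intro!: nn_integral_cong)
  finally show "sector_integral G = ?A" .
  have "sector_integral G = (\<integral>\<^sup>+t. \<integral>\<^sup>+r. ?f (r, t) \<partial>lborel \<partial>lborel)"
    unfolding sector_integral_def lborel_prod[symmetric] by (rule lborel_pair.nn_integral_snd[symmetric]) (use m in simp)
  also have "\<dots> = ?B"
    by (intro nn_integral_cong) (auto simp: half_disc_def indicator_def intro!: nn_integral_cong)
  finally show "sector_integral G = ?B" .
qed

text \<open>The angular inequalities are applied sphere by sphere and the radial ones, in the
  companion lemma, ray by ray; Tonelli allows either order of integration.\<close>

lemma sector_integral_mono_theta: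
  assumes "sector_fun G" "sector_fun H"
    and "\<And>r. 0 < r \<Longrightarrow> (nnint {0<..<pi} (\<lambda>t. G r t)) \<le> nnint {0<..<pi} (\<lambda>t. H r t)"
  shows "sector_integral G \<le> sector_integral H"
  unfolding sector_integral_iterated(1)[OF assms(1)] sector_integral_iterated(1)[OF assms(2)]
  by (intro nn_integral_mono) (use assms(3) in \<open>auto simp: indicator_def\<close>)

lemma sector_integral_mono_r:
  assumes "sector_fun G" "sector_fun H"
    and "\<And>t. 0 < t \<Longrightarrow> t < pi \<Longrightarrow> (nnint {0<..} (\<lambda>r. G r t)) \<le> nnint {0<..} (\<lambda>r. H r t)"
  shows "sector_integral G \<le> sector_integral H"
  unfolding sector_integral_iterated(2)[OF assms(1)] sector_integral_iterated(2)[OF assms(2)]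
  by (intro nn_integral_mono) (use assms(3) in \<open>auto simp: indicator_def\<close>)

lemma sector_integral_cong:
  assumes "\<And>r t. 0 < r \<Longrightarrow> 0 < t \<Longrightarrow> t < pi \<Longrightarrow> G r t = H r t"
  shows "sector_integral G = sector_integral H"
  unfolding sector_integral_def
  by (intro nn_integral_cong) (use assms in \<open>auto simp: indicator_def half_disc_def\<close>)

lemma sector_integral_add:
  assumes "sector_fun G" "sector_fun H"
  shows "sector_integral (\<lambda>r t. G r t + H r t) = sector_integral G + sector_integral H"
  unfolding sector_integral_def
proof (subst nn_integral_add[symmetric])
  show "(nnint half_disc (\<lambda>z. G (fst z) (snd z) + H (fst z) (snd z)))
    = (\<integral>\<^sup>+z. ennreal (G (fst z) (snd z)) * indicator half_disc z + ennreal (H (fst z) (snd z)) * indicator half_disc z \<partial>lborel)"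
    by (intro nn_integral_cong) (use assms in \<open>auto simp: sector_fun_def indicator_def half_disc_def ennreal_plus\<close>)
qed (use sector_measurable[OF assms(1)] sector_measurable[OF assms(2)] in \<open>simp_all add: lborel_prod\<close>)

lemma sector_integral_cmult:
  assumes "sector_fun G" "0 \<le> k"
  shows "sector_integral (\<lambda>r t. k * G r t) = ennreal k * sector_integral G"
  unfolding sector_integral_def
proof (subst nn_integral_cmult[symmetric])
  show "(nnint half_disc (\<lambda>z. k * G (fst z) (snd z)))
    = (\<integral>\<^sup>+z. ennreal k * (ennreal (G (fst z) (snd z)) * indicator half_disc z) \<partial>lborel)"
    by (intro nn_integral_cong) (use assms in \<open>auto simp: sector_fun_def indicator_def half_disc_def ennreal_mult\<close>)
qed (use sector_measurable[OF assms(1)] in \<open>simp_all add: lborel_prod\<close>)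

lemma nn_integral_axisymmetric:
  assumes frame: "orthonormal_frame a b c" and F: "F \<in> borel_measurable borel"
    and FG: "\<And>r t \<phi>. 0 < r \<Longrightarrow> 0 < t \<Longrightarrow> t < pi \<Longrightarrow> 0 < \<phi> \<Longrightarrow> \<phi> < 2 * pi \<Longrightarrow> r\<^sup>2 * sin t * F (r *\<^sub>R e_rho a b c t \<phi>) = G r t"
    and F0: "\<And>x. 0 \<le> F x"
    and G: "sector_fun G"
  shows "(\<integral>\<^sup>+x. ennreal (F x) \<partial>lborel) = ennreal (2 * pi) * sector_integral G"
proof -
  have "(\<integral>\<^sup>+x. ennreal (F x) \<partial>lborel)
    = (\<integral>\<^sup>+r. \<integral>\<^sup>+t. \<integral>\<^sup>+\<phi>. ennreal (F (r *\<^sub>R e_rho a b c t \<phi>)) * ennreal (r\<^sup>2 * sin t)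
        * indicator {0<..} r * indicator {0<..<pi} t * indicator {0<..<2*pi} \<phi> \<partial>lborel \<partial>lborel \<partial>lborel)"
    using F by (intro nn_integral_spherical[OF frame]) simp
  also have "\<dots> = (\<integral>\<^sup>+r. \<integral>\<^sup>+t. \<integral>\<^sup>+\<phi>. (ennreal (G r t) * indicator {0<..} r * indicator {0<..<pi} t) * indicator {0<..<2*pi} \<phi> \<partial>lborel \<partial>lborel \<partial>lborel)"
  proof (intro nn_integral_cong)
    fix r t \<phi> :: real
    show "ennreal (F (r *\<^sub>R e_rho a b c t \<phi>)) * ennreal (r\<^sup>2 * sin t) * indicator {0<..} r * indicator {0<..<pi} t * indicator {0<..<2*pi} \<phi>
      = (ennreal (G r t) * indicator {0<..} r * indicator {0<..<pi} t) * indicator {0<..<2*pi} \<phi>"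
    proof (cases "0 < r \<and> 0 < t \<and> t < pi \<and> 0 < \<phi> \<and> \<phi> < 2 * pi")
      case True
      then have "0 \<le> r\<^sup>2 * sin t"
        by (simp add: sin_ge_zero)
      then show ?thesis
        using True F0 FG[of r t \<phi>] by (simp add: ennreal_mult[symmetric] mult_ac)
    qed (auto simp: indicator_def)
  qed
  also have "\<dots> = (\<integral>\<^sup>+r. \<integral>\<^sup>+t. ennreal (2 * pi) * (ennreal (G r t) * indicator {0<..} r * indicator {0<..<pi} t) \<partial>lborel \<partial>lborel)"
    by (intro nn_integral_cong, subst nn_integral_cmult_indicator) (simp_all add: mult.commute)
  also have "\<dots> = sector_integral (\<lambda>r t. 2 * pi * G r t)"
  proof (subst sector_integral_iterated(1))
    show "sector_fun (\<lambda>r t. 2 * pi * G r t)"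
      using G unfolding sector_fun_def by (auto intro!: continuous_intros)
    show "(\<integral>\<^sup>+r. \<integral>\<^sup>+t. ennreal (2 * pi) * (ennreal (G r t) * indicator {0<..} r * indicator {0<..<pi} t) \<partial>lborel \<partial>lborel)
      = (\<integral>\<^sup>+r. (nnint {0<..<pi} (\<lambda>t. 2 * pi * G r t)) * indicator {0<..} r \<partial>lborel)"
      by (intro nn_integral_cong) (auto simp: indicator_def ennreal_mult' intro!: nn_integral_cong)
  qed
  also have "\<dots> = ennreal (2 * pi) * sector_integral G"
    by (rule sector_integral_cmult[OF G]) simp
  finally show ?thesis .
qed

lemma set_nn_integral_cmult_mono:
  fixes f g :: "real \<Rightarrow> real"
  assumes "continuous_on A f" "continuous_on A g" "A \<in> sets borel" "0 \<le> k"
    and nn: "\<And>x. x \<in> A \<Longrightarrow> 0 \<le> f x" "\<And>x. x \<in> A \<Longrightarrow> 0 \<le> g x"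
    and le: "nnint A f \<le> nnint A g"
  shows "nnint A (\<lambda>x. k * f x) \<le> nnint A (\<lambda>x. k * g x)"
proof -
  have *: "nnint A (\<lambda>x. k * h x) = ennreal k * (nnint A h)"
    if "continuous_on A h" "\<And>x. x \<in> A \<Longrightarrow> 0 \<le> h x" for h :: "real \<Rightarrow> real"
  proof (subst nn_integral_cmult[symmetric])
    show "(\<lambda>x. ennreal (h x) * indicator A x) \<in> borel_measurable lborel"
      using borel_measurable_ennreal_indicator[OF that(1) assms(3)] by simp
    show "nnint A (\<lambda>x. k * h x) = (\<integral>\<^sup>+x. ennreal k * (ennreal (h x) * indicator A x) \<partial>lborel)"
      by (intro nn_integral_cong) (use that assms in \<open>auto simp: ennreal_mult indicator_def\<close>)
  qed
  show ?thesis
    using mult_left_mono[OF le, of "ennreal k"] by (simp add: *[OF assms(1) nn(1)] *[OF assms(2) nn(2)])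
qed

lemma sector_fun_slice:
  assumes "sector_fun G"
  shows "0 < r \<Longrightarrow> continuous_on {0<..<pi} (G r)" "0 < \<theta> \<Longrightarrow> \<theta> < pi \<Longrightarrow> continuous_on {0<..} (\<lambda>r. G r \<theta>)"
proof -
  have c: "continuous_on half_disc (\<lambda>z. G (fst z) (snd z))" using assms by (simp add: sector_fun_def)
  show "continuous_on {0<..<pi} (G r)" if "0 < r"
    using continuous_on_compose2[OF c, of "{0<..<pi}" "\<lambda>t. (r, t)"] that
    by (simp add: half_disc_def image_subset_iff continuous_on_Pair continuous_on_const continuous_on_id)
  show "continuous_on {0<..} (\<lambda>r. G r \<theta>)" if "0 < \<theta>" "\<theta> < pi"
    using continuous_on_compose2[OF c, of "{0<..}" "\<lambda>t. (t, \<theta>)"] that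
    by (simp add: half_disc_def image_subset_iff continuous_on_Pair continuous_on_const continuous_on_id)
qed

lemma sector_fun_mult:
  assumes "sector_fun G" "sector_fun H" shows "sector_fun (\<lambda>r t. G r t * H r t)"
  using assms unfolding sector_fun_def by (auto intro!: continuous_intros)

lemma sector_fun_add:
  assumes "sector_fun G" "sector_fun H" shows "sector_fun (\<lambda>r t. G r t + H r t)"
  using assms unfolding sector_fun_def by (auto intro!: continuous_intros)

lemma sector_fun_cmult:
  assumes "sector_fun G" "0 \<le> k" shows "sector_fun (\<lambda>r t. k * G r t)"
  using assms unfolding sector_fun_def by (auto intro!: continuous_intros)

lemma sector_fun_powr: "sector_fun (\<lambda>r t. r powr s)"
  unfolding sector_fun_def half_disc_def by (auto intro!: continuous_intros)

lemma sector_fun_sin: "sector_fun (\<lambda>r. sin)"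
  unfolding sector_fun_def by (auto intro!: continuous_intros sin_ge_zero)

lemma sector_fun_power2:
  assumes "continuous_on half_disc (\<lambda>z. X (fst z) (snd z))" shows "sector_fun (\<lambda>r t. (X r t)\<^sup>2)"
  using assms unfolding sector_fun_def by (auto intro!: continuous_intros)

text \<open>Up to the factor \<open>2 \<pi>\<close>, this is integration of axisymmetric functions against \<open>|x|\<close> to the power \<open>2 \<gamma> - 2\<close>.\<close>

definition wint :: "real \<Rightarrow> (real \<Rightarrow> real \<Rightarrow> real) \<Rightarrow> ennreal" where
  "wint \<gamma> X = sector_integral (\<lambda>r t. r powr (2 * \<gamma>) * X r t * sin t)"

lemma sector_fun_weight: "sector_fun X \<Longrightarrow> sector_fun (\<lambda>r t. r powr (2 * \<gamma>) * X r t * sin t)"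
  by (intro sector_fun_mult sector_fun_powr sector_fun_sin)

lemma wint_add: "sector_fun X \<Longrightarrow> sector_fun Y \<Longrightarrow> wint \<gamma> (\<lambda>r t. X r t + Y r t) = wint \<gamma> X + wint \<gamma> Y"
  unfolding wint_def by (subst sector_integral_add[symmetric]) (assumption | rule sector_fun_weight sector_integral_cong | simp add: algebra_simps)+

lemma wint_cmult: "sector_fun X \<Longrightarrow> 0 \<le> k \<Longrightarrow> wint \<gamma> (\<lambda>r t. k * X r t) = ennreal k * wint \<gamma> X"
  unfolding wint_def by (subst sector_integral_cmult[symmetric]) (assumption | rule sector_fun_weight sector_integral_cong | simp add: mult_ac)+

lemma wint_cong: "(\<And>r t. 0 < r \<Longrightarrow> 0 < t \<Longrightarrow> t < pi \<Longrightarrow> X r t = Y r t) \<Longrightarrow> wint \<gamma> X = wint \<gamma> Y"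
  unfolding wint_def by (intro sector_integral_cong) simp

lemma wint_mono_theta:
  assumes X: "sector_fun X" and Y: "sector_fun Y"
    and le: "\<And>r. 0 < r \<Longrightarrow> (nnint {0<..<pi} (\<lambda>t. X r t * sin t)) \<le> nnint {0<..<pi} (\<lambda>t. Y r t * sin t)"
  shows "wint \<gamma> X \<le> wint \<gamma> Y"
  unfolding wint_def
proof (rule sector_integral_mono_theta)
  fix r :: real assume r: "0 < r"
  have "sector_fun (\<lambda>r t. X r t * sin t)" "sector_fun (\<lambda>r t. Y r t * sin t)"
    by (intro sector_fun_mult X Y sector_fun_sin)+
  then have "nnint {0<..<pi} (\<lambda>t. r powr (2*\<gamma>) * (X r t * sin t))
    \<le> nnint {0<..<pi} (\<lambda>t. r powr (2*\<gamma>) * (Y r t * sin t))"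
    by (intro set_nn_integral_cmult_mono sector_fun_slice le r) (use r in \<open>auto simp: sector_fun_def\<close>)
  then show "nnint {0<..<pi} (\<lambda>t. r powr (2*\<gamma>) * X r t * sin t)
    \<le> nnint {0<..<pi} (\<lambda>t. r powr (2*\<gamma>) * Y r t * sin t)"
    by (simp only: mult.assoc)
qed (intro sector_fun_weight X Y)+

lemma wint_mono_r:
  assumes X: "sector_fun X" and Y: "sector_fun Y"
    and le: "\<And>\<theta>. 0 < \<theta> \<Longrightarrow> \<theta> < pi \<Longrightarrow> (nnint {0<..} (\<lambda>r. r powr (2*\<gamma>) * X r \<theta>)) \<le> nnint {0<..} (\<lambda>r. r powr (2*\<gamma>) * Y r \<theta>)"
  shows "wint \<gamma> X \<le> wint \<gamma> Y"
  unfolding wint_def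
proof (rule sector_integral_mono_r)
  fix \<theta> :: real assume t: "0 < \<theta>" "\<theta> < pi"
  have "sector_fun (\<lambda>r \<theta>. r powr (2*\<gamma>) * X r \<theta>)" "sector_fun (\<lambda>r \<theta>. r powr (2*\<gamma>) * Y r \<theta>)"
    by (intro sector_fun_mult X Y sector_fun_powr)+
  then have "nnint {0<..} (\<lambda>r. sin \<theta> * (r powr (2*\<gamma>) * X r \<theta>))
    \<le> nnint {0<..} (\<lambda>r. sin \<theta> * (r powr (2*\<gamma>) * Y r \<theta>))"
    using X Y by (intro set_nn_integral_cmult_mono sector_fun_slice(2)[where G = "\<lambda>r \<theta>. r powr (2*\<gamma>) * X r \<theta>"]
        sector_fun_slice(2)[where G = "\<lambda>r \<theta>. r powr (2*\<gamma>) * Y r \<theta>"] le t) (use t in \<open>auto simp: sector_fun_def sin_ge_zero\<close>)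
  then show "nnint {0<..} (\<lambda>r. r powr (2*\<gamma>) * X r \<theta> * sin \<theta>)
    \<le> nnint {0<..} (\<lambda>r. r powr (2*\<gamma>) * Y r \<theta> * sin \<theta>)"
    by (simp only: mult.commute[of "sin \<theta>"])
qed (intro sector_fun_weight X Y)+

lemma borel_measurable_grad_sq:
  assumes u: "Ck (Suc 0) u"
  shows "grad_sq u \<in> borel_measurable borel"
proof (rule borel_measurable_continuous_onI)
  show "continuous_on UNIV (grad_sq u)"
    unfolding grad_sq_def jacobian_def matrix_def
    by (simp, intro continuous_intros continuous_on_component Ck_1_continuous_derivative[OF u])
qed

context spherical_components
begin

lemma half_disc_continuous:
  "continuous_on half_disc (\<lambda>z. p (fst z) (snd z))" "continuous_on half_disc (\<lambda>z. q (fst z) (snd z))" "continuous_on half_disc (\<lambda>z. w (fst z) (snd z))"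
  "continuous_on half_disc (\<lambda>z. pr (fst z) (snd z))" "continuous_on half_disc (\<lambda>z. qr (fst z) (snd z))" "continuous_on half_disc (\<lambda>z. wr (fst z) (snd z))"
  "continuous_on half_disc (\<lambda>z. pt (fst z) (snd z))" "continuous_on half_disc (\<lambda>z. qt (fst z) (snd z))" "continuous_on half_disc (\<lambda>z. wt (fst z) (snd z))"
  by (rule continuous_on_subset[OF cont(1)] continuous_on_subset[OF cont(2)] continuous_on_subset[OF cont(3)]
      continuous_on_subset[OF cont_r(1)] continuous_on_subset[OF cont_r(2)] continuous_on_subset[OF cont_r(3)]
      continuous_on_subset[OF cont_t(1)] continuous_on_subset[OF cont_t(2)] continuous_on_subset[OF cont_t(3)],
      force simp: half_disc_def)+

lemma continuous_cot: "continuous_on half_disc (\<lambda>z. cos (snd z) / sin (snd z))" "continuous_on half_disc (\<lambda>z. w (fst z) (snd z) / sin (snd z))"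
proof -
  have "sin (snd z) \<noteq> 0" if "z \<in> half_disc" for z
    using that sin_gt_zero[of "snd z"] by (auto simp: half_disc_def)
  then show "continuous_on half_disc (\<lambda>z. cos (snd z) / sin (snd z))" "continuous_on half_disc (\<lambda>z. w (fst z) (snd z) / sin (snd z))"
    by (auto intro!: continuous_intros half_disc_continuous)
qed

lemmas sector_intros = sector_fun_power2 sector_fun_add continuous_intros half_disc_continuous continuous_cot

lemma field_integral:
  assumes u: "Ck (Suc 0) u"
  shows "(\<integral>\<^sup>+x. ennreal (norm x powr (2*\<gamma> - 2) * (norm (u x))\<^sup>2) \<partial>lborel)
    = ennreal (2 * pi) * wint \<gamma> (\<lambda>r t. (p r t)\<^sup>2 + (q r t)\<^sup>2 + (w r t)\<^sup>2)"
  unfolding wint_def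
proof (rule nn_integral_axisymmetric[OF frame])
  have [measurable]: "u \<in> borel_measurable borel"
    by (rule borel_measurable_continuous_onI[OF Ck_1_continuous[OF u]])
  show "(\<lambda>x. norm x powr (2*\<gamma> - 2) * (norm (u x))\<^sup>2) \<in> borel_measurable borel"
    by measurable
  show "sector_fun (\<lambda>r t. r powr (2 * \<gamma>) * ((p r t)\<^sup>2 + (q r t)\<^sup>2 + (w r t)\<^sup>2) * sin t)"
    by (intro sector_fun_weight sector_intros)
  fix r t \<phi> :: real assume H: "0 < r" "0 < t" "t < pi" "0 < \<phi>" "\<phi> < 2 * pi"
  have "r powr (2 * \<gamma>) = r\<^sup>2 * r powr (2*\<gamma> - 2)"
    using H(1) by (simp add: powr_diff)
  then show "r\<^sup>2 * sin t * (norm (r *\<^sub>R e_rho a b c t \<phi>) powr (2*\<gamma> - 2) * (norm (u (r *\<^sub>R e_rho a b c t \<phi>)))\<^sup>2)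
      = r powr (2 * \<gamma>) * ((p r t)\<^sup>2 + (q r t)\<^sup>2 + (w r t)\<^sup>2) * sin t"
    unfolding norm_spherical[OF H] norm_sq_components[OF H] by (simp only: mult_ac)
qed simp

text \<open>The factor \<open>r^2\<close> of the volume element clears the denominators of the
  spherical gradient. Both sides of the Hardy inequality thus become \<open>wint\<close> with the
  same weight.\<close>

lemma gradient_integral:
  assumes u: "Ck (Suc 0) u"
  shows "(\<integral>\<^sup>+x. ennreal (norm x powr (2*\<gamma>) * grad_sq u x) \<partial>lborel)
    = ennreal (2 * pi) * wint \<gamma> (\<lambda>r t. (r * pr r t)\<^sup>2 + (r * qr r t)\<^sup>2 + (r * wr r t)\<^sup>2
     + ((pt r t - q r t)\<^sup>2 + (qt r t + p r t)\<^sup>2 + (p r t + q r t * (cos t / sin t))\<^sup>2)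
     + ((wt r t)\<^sup>2 + (w r t / sin t)\<^sup>2))" (is "_ = _ * wint \<gamma> ?G")
  unfolding wint_def
proof (rule nn_integral_axisymmetric[OF frame])
  note [measurable] = borel_measurable_grad_sq[OF u]
  show "(\<lambda>x. norm x powr (2*\<gamma>) * grad_sq u x) \<in> borel_measurable borel"
    by measurable
  show "sector_fun (\<lambda>r t. r powr (2 * \<gamma>) * ?G r t * sin t)"
    by (intro sector_fun_weight sector_intros)
  fix r t \<phi> :: real assume H: "0 < r" "0 < t" "t < pi" "0 < \<phi>" "\<phi> < 2 * pi"
  let ?x = "r *\<^sub>R e_rho a b c t \<phi>"
  have "r\<^sup>2 * sin t * (norm ?x powr (2*\<gamma>) * grad_sq u ?x) = r powr (2 * \<gamma>) * (r\<^sup>2 * grad_sq u ?x) * sin t"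
    unfolding norm_spherical[OF H] by (simp only: mult_ac)
  then show "r\<^sup>2 * sin t * (norm ?x powr (2*\<gamma>) * grad_sq u ?x) = r powr (2 * \<gamma>) * ?G r t * sin t"
    unfolding grad_sq_components[OF H] by (simp only: power_mult_distrib distrib_left)
qed (simp add: grad_sq_def sum_nonneg)

end

section \<open>The inequality\<close>

locale solenoidal_components = spherical_components +
  assumes div_free: "\<And>x. divergence u x = 0"
    and on_axis: "\<And>r. 0 < r \<Longrightarrow> q r 0 = 0" "\<And>r. 0 < r \<Longrightarrow> q r pi = 0" "\<And>r. 0 < r \<Longrightarrow> w r 0 = 0" "\<And>r. 0 < r \<Longrightarrow> w r pi = 0"
    and support: "\<exists>R>0. \<forall>r\<ge>R. \<forall>t. p r t = 0 \<and> q r t = 0 \<and> w r t = 0"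
begin

lemma solenoidal: "r * pr r \<theta> = - (2 * p r \<theta> + qt r \<theta> + q r \<theta> * (cos \<theta> / sin \<theta>))"
  if "0 < r" "0 < \<theta>" "\<theta> < pi"
  using divergence_components[OF that, of pi] div_free by simp

lemma continuous_slice:
  assumes "continuous_on ({0<..} \<times> UNIV) (\<lambda>z. X (fst z) (snd z))" "(0::real) < r"
  shows "continuous_on A (\<lambda>\<theta>::real. X r \<theta>)"
  using continuous_on_compose2[OF assms(1), of A "\<lambda>t. (r, t)"] assms(2)
  by (simp add: image_subset_iff continuous_on_Pair continuous_on_const continuous_on_id)

lemma continuous_slice_r:
  assumes "continuous_on ({0<..} \<times> UNIV) (\<lambda>z. X (fst z) (snd z))"
  shows "continuous_on {0<..} (\<lambda>r::real. X r (\<theta>::real))"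
  using continuous_on_compose2[OF assms(1), of "{0<..}" "\<lambda>t. (t, \<theta>)"]
  by (simp add: image_subset_iff continuous_on_Pair continuous_on_const continuous_on_id)

text \<open>The flux of \<open>u\<close> through every sphere about the origin vanishes.\<close>

lemma mean_zero:
  assumes r: "0 < r"
  shows "integral {0..pi} (\<lambda>\<theta>. p r \<theta> * sin \<theta>) = 0"
proof -
  define m where "m r = integral {0..pi} (\<lambda>\<theta>. p r \<theta> * sin \<theta>)" for r
  have m': "(m has_real_derivative integral {0..pi} (\<lambda>\<theta>. pr r \<theta> * sin \<theta>)) (at r)" if r: "0 < r" for r
  proof -
    have "((\<lambda>r. integral (cbox 0 pi) (\<lambda>\<theta>. p r \<theta> * sin \<theta>)) has_real_derivative
        integral (cbox 0 pi) (\<lambda>\<theta>. pr r \<theta> * sin \<theta>)) (at r within {0<..})"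
    proof (rule leibniz_rule_field_derivative)
      fix x t :: real assume "x \<in> {0<..}"
      then show "((\<lambda>x. p x t * sin t) has_real_derivative pr x t * sin t) (at x within {0<..})"
        by (intro has_field_derivative_at_within[OF DERIV_cmult_right[OF deriv_r(1)]]) simp
    next
      fix x :: real assume "x \<in> {0<..}"
      then show "(\<lambda>t. p x t * sin t) integrable_on cbox 0 pi"
        by (intro integrable_continuous continuous_intros continuous_slice[OF cont(1)]) simp
    next
      show "continuous_on ({0<..} \<times> cbox 0 pi) (\<lambda>(x, t). pr x t * sin t)"
        unfolding case_prod_beta by (intro continuous_intros continuous_on_subset[OF cont_r(1)]) auto
    qed (use r in auto)
    then show ?thesis
      using r by (simp add: m_def[abs_def] at_within_open[of r "{0<..}"])
  qed
  \<comment> \<open>The angular part of the divergence times \<open>sin\<close> is the exact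
    derivative of \<open>q sin\<close> and integrates to zero. The divergence equation then reduces
    to \<open>r m' = - 2 m\<close>.\<close>
  have flux: "r * integral {0..pi} (\<lambda>\<theta>. pr r \<theta> * sin \<theta>) = - 2 * m r" if r: "0 < r" for r
  proof -
    have 1: "((\<lambda>\<theta>. qt r \<theta> * sin \<theta> + q r \<theta> * cos \<theta>) has_integral (q r pi * sin pi - q r 0 * sin 0)) {0..pi}"
      by (rule fundamental_theorem_of_calculus)
        (auto intro!: derivative_eq_intros has_field_derivative_at_within[OF deriv_t(2)[OF r]]
           simp: has_real_derivative_iff_has_vector_derivative[symmetric] algebra_simps)
    have 2: "((\<lambda>\<theta>. p r \<theta> * sin \<theta>) has_integral m r) {0..pi}"
      unfolding m_def by (intro integrable_integral integrable_continuous_real continuous_intros continuous_slice[OF cont(1) r])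
    have 3: "((\<lambda>\<theta>. - 2 * (p r \<theta> * sin \<theta>) - (qt r \<theta> * sin \<theta> + q r \<theta> * cos \<theta>)) has_integral (- 2 * m r - 0)) {0..pi}"
      using has_integral_diff[OF has_integral_mult_right[OF 2, of "-2"] 1] by simp
    have "((\<lambda>\<theta>. r * (pr r \<theta> * sin \<theta>)) has_integral (- 2 * m r - 0)) {0..pi}"
    proof (rule has_integral_eq[OF _ 3])
      fix \<theta> assume t: "\<theta> \<in> {0..pi}"
      show "- 2 * (p r \<theta> * sin \<theta>) - (qt r \<theta> * sin \<theta> + q r \<theta> * cos \<theta>) = r * (pr r \<theta> * sin \<theta>)"
      proof (cases "\<theta> = 0 \<or> \<theta> = pi")
        case True
        then show ?thesis using on_axis[OF r] by auto
      next
        case False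
        then have t': "0 < \<theta>" "\<theta> < pi" using t by auto
        then have "sin \<theta> \<noteq> 0" using sin_gt_zero[of \<theta>] by simp
        define k where "k = cos \<theta> / sin \<theta>"
        have "cos \<theta> = k * sin \<theta>"
          using \<open>sin \<theta> \<noteq> 0\<close> by (simp add: k_def)
        then show ?thesis
          using solenoidal[OF r t'] unfolding k_def[symmetric] by algebra
      qed
    qed
    then show ?thesis
      by (simp add: integral_unique flip: integral_mult_right)
  qed
  obtain R where R: "R > 0" "\<And>r \<theta>. r \<ge> R \<Longrightarrow> p r \<theta> = 0" using support by blast
  \<comment> \<open>The flux is a multiple of \<open>x^2 m x\<close>. It is constant in the radius
    and zero outside the support.\<close>
  have "\<exists>k. \<forall>x\<in>{0<..}. x\<^sup>2 * m x = k"
  proof (rule has_field_derivative_zero_constant)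
    fix x :: real assume x: "x \<in> {0<..}"
    then have "((\<lambda>x. x\<^sup>2 * m x) has_real_derivative (2 * x * m x + x\<^sup>2 * integral {0..pi} (\<lambda>\<theta>. pr x \<theta> * sin \<theta>))) (at x)"
      by (auto intro!: derivative_eq_intros m')
    also have "2 * x * m x + x\<^sup>2 * integral {0..pi} (\<lambda>\<theta>. pr x \<theta> * sin \<theta>) = 0"
      using flux[of x] x unfolding greaterThan_iff by algebra
    finally show "((\<lambda>x. x\<^sup>2 * m x) has_real_derivative 0) (at x within {0<..})"
      by (rule has_field_derivative_at_within)
  qed simp
  then obtain k where k: "\<And>x. 0 < x \<Longrightarrow> x\<^sup>2 * m x = k" by auto
  have "m R = 0" by (simp add: m_def R)
  then have "k = 0" using k[OF R(1)] by simp
  then show ?thesis using k[OF r] r by (simp add: m_def)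
qed

lemma poloidal_gradient_bound:
  "wint \<gamma> (\<lambda>r t. (r * pr r t)\<^sup>2)
     \<le> wint \<gamma> (\<lambda>r t. (pt r t - q r t)\<^sup>2 + (qt r t + p r t)\<^sup>2 + (p r t + q r t * (cos t / sin t))\<^sup>2)"
proof (rule wint_mono_theta)
  fix r :: real assume r: "0 < r"
  have "(nnint {0<..<pi} (\<lambda>t. (r * pr r t)\<^sup>2 * sin t))
     = (nnint {0<..<pi} (\<lambda>t. (2 * p r t + qt r t + q r t * (cos t / sin t))\<^sup>2 * sin t))"
  proof (intro nn_integral_cong)
    fix t :: real
    have "(r * pr r t)\<^sup>2 = (2 * p r t + qt r t + q r t * (cos t / sin t))\<^sup>2" if "t \<in> {0<..<pi}"
      using solenoidal[OF r, of t] that by (simp only: power2_minus greaterThanLessThan_iff)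
    then show "ennreal ((r * pr r t)\<^sup>2 * sin t) * indicator {0<..<pi} t
        = ennreal ((2 * p r t + qt r t + q r t * (cos t / sin t))\<^sup>2 * sin t) * indicator {0<..<pi} t"
      by (cases "t \<in> {0<..<pi}") simp_all
  qed
  also have "\<dots> \<le> nnint {0<..<pi} (\<lambda>t. ((pt r t - q r t)\<^sup>2 + (qt r t + p r t)\<^sup>2
      + (p r t + q r t * (cos t / sin t))\<^sup>2) * sin t)"
    by (rule polar_flux_poincare[OF deriv_t(1)[OF r] continuous_slice[OF cont_t(1) r] deriv_t(2)[OF r]
          continuous_slice[OF cont_t(2) r] on_axis(1)[OF r] on_axis(2)[OF r] mean_zero[OF r]])
  finally show "nnint {0<..<pi} (\<lambda>t. (r * pr r t)\<^sup>2 * sin t) \<le> \<dots>" .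
qed (intro sector_intros)+

lemma poloidal_tangential_bound:
  "wint \<gamma> (\<lambda>r t. 2 * (q r t)\<^sup>2) \<le> wint \<gamma> (\<lambda>r t. (r * pr r t + 2 * p r t)\<^sup>2)"
proof (rule wint_mono_theta)
  fix r :: real assume r: "0 < r"
  have "nnint {0<..<pi} (\<lambda>t. 2 * (q r t)\<^sup>2 * sin t)
     \<le> nnint {0<..<pi} (\<lambda>t. (qt r t + q r t * (cos t / sin t))\<^sup>2 * sin t)"
    by (rule azimuthal_poincare(2)[OF deriv_t(2)[OF r] continuous_slice[OF cont_t(2) r] on_axis(1)[OF r] on_axis(2)[OF r]])
  also have "\<dots> = nnint {0<..<pi} (\<lambda>t. (r * pr r t + 2 * p r t)\<^sup>2 * sin t)"
  proof (intro nn_integral_cong)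
    fix t :: real
    have "(qt r t + q r t * (cos t / sin t))\<^sup>2 = (r * pr r t + 2 * p r t)\<^sup>2" if "t \<in> {0<..<pi}"
    proof -
      have "qt r t + q r t * (cos t / sin t) = - (r * pr r t + 2 * p r t)"
        using solenoidal[OF r, of t] that by simp
      then show ?thesis by (simp only: power2_minus)
    qed
    then show "ennreal ((qt r t + q r t * (cos t / sin t))\<^sup>2 * sin t) * indicator {0<..<pi} t
        = ennreal ((r * pr r t + 2 * p r t)\<^sup>2 * sin t) * indicator {0<..<pi} t"
      by (cases "t \<in> {0<..<pi}") simp_all
  qed
  finally show "nnint {0<..<pi} (\<lambda>t. 2 * (q r t)\<^sup>2 * sin t) \<le> \<dots>" .
qed (intro sector_fun_cmult sector_intros; simp)+

lemma swirl_bound: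
  "wint \<gamma> (\<lambda>r t. 2 * (w r t)\<^sup>2) \<le> wint \<gamma> (\<lambda>r t. (wt r t)\<^sup>2 + (w r t / sin t)\<^sup>2)"
proof (rule wint_mono_theta)
  fix r :: real assume r: "0 < r"
  show "nnint {0<..<pi} (\<lambda>t. 2 * (w r t)\<^sup>2 * sin t)
     \<le> nnint {0<..<pi} (\<lambda>t. ((wt r t)\<^sup>2 + (w r t / sin t)\<^sup>2) * sin t)"
    by (rule azimuthal_poincare(1)[OF deriv_t(3)[OF r] continuous_slice[OF cont_t(3) r] on_axis(3)[OF r] on_axis(4)[OF r]])
qed (intro sector_fun_cmult sector_intros; simp)+

text \<open>The first inequality serves the tangential components, the second the radial one. The
  latter also absorbs \<open>(k/2) (r f_r + 2 f)^2\<close>, the price at which the divergence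
  equation supplies the share \<open>k q^2\<close> of the polar component.\<close>

lemma hardy_component:
  fixes f fr :: "real \<Rightarrow> real \<Rightarrow> real" and l :: "real \<Rightarrow> real"
  assumes s: "s = \<gamma> + 1 / 2" "s \<noteq> 0"
    and f: "\<And>r t. 0 < r \<Longrightarrow> ((\<lambda>r. f r t) has_real_derivative fr r t) (at r)"
    and c: "continuous_on ({0<..} \<times> UNIV) (\<lambda>z. f (fst z) (snd z))"
    and cr: "continuous_on ({0<..} \<times> UNIV) (\<lambda>z. fr (fst z) (snd z))"
    and R: "0 < R" "\<And>r t. R \<le> r \<Longrightarrow> f r t = 0"
    and l: "\<And>t. ((\<lambda>r. f r t) \<longlongrightarrow> l t) (at_right 0)" "\<And>t. s < 0 \<Longrightarrow> l t = 0"
    and k: "0 \<le> k" "k \<le> 2" "k * (s\<^sup>2 / 2 - 2 * s + 3) \<le> s\<^sup>2"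
  shows "wint \<gamma> (\<lambda>r t. s\<^sup>2 * (f r t)\<^sup>2) \<le> wint \<gamma> (\<lambda>r t. (r * fr r t)\<^sup>2)"
    and "wint \<gamma> (\<lambda>r t. (s\<^sup>2 + k) * (f r t)\<^sup>2 + k / 2 * (r * fr r t + 2 * f r t)\<^sup>2) \<le> wint \<gamma> (\<lambda>r t. 2 * (r * fr r t)\<^sup>2)"
proof -
  have sub: "half_disc \<subseteq> {0<..} \<times> UNIV" by (auto simp: half_disc_def)
  note c' = continuous_on_subset[OF c sub] continuous_on_subset[OF cr sub]
  have \<gamma>: "2 * \<gamma> = 2 * s - 1" using s by simp
  \<comment> \<open>The second density contains the radial derivative, which has to vanish for large
    \<open>r\<close> as well. It is computed from \<open>f = 0\<close> on the open ray beyond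
    \<open>R\<close>, hence the margin \<open>R + 1\<close>.\<close>
  have R': "fr r t = 0" if "R + 1 \<le> r" for r t
  proof -
    have "((\<lambda>r. f r t) has_real_derivative 0) (at r)"
    proof (rule has_field_derivative_transform_within_open[where S = "{R<..}"])
      show "((\<lambda>r. 0) has_real_derivative 0) (at r)" by simp
    qed (use that R in auto)
    moreover have "((\<lambda>r. f r t) has_real_derivative fr r t) (at r)"
      using R that by (intro f) simp
    ultimately show ?thesis using DERIV_unique by blast
  qed
  have sl: "continuous_on {0<..} (\<lambda>r. f r t)" "continuous_on {0<..} (\<lambda>r. fr r t)" for t
    by (rule continuous_slice_r, rule c, rule continuous_slice_r, rule cr)
  show "wint \<gamma> (\<lambda>r t. s\<^sup>2 * (f r t)\<^sup>2) \<le> wint \<gamma> (\<lambda>r t. (r * fr r t)\<^sup>2)"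
  proof (rule wint_mono_r)
    fix t :: real
    have "nnint {0<..} (\<lambda>r. r powr (2 * s - 1) * (s\<^sup>2 * (f r t)\<^sup>2))
        \<le> nnint {0<..} (\<lambda>r. r powr (2 * s - 1) * (1 * (r * fr r t)\<^sup>2))"
    proof (rule radial_hardy[OF f sl(2) l s(2) R, where M = "- s"])
      fix r :: real
      have "1 * (r * fr r t)\<^sup>2 - (s\<^sup>2 * (f r t)\<^sup>2 + - s * (2 * f r t * (r * fr r t) + 2 * s * (f r t)\<^sup>2)) = (r * fr r t + s * f r t)\<^sup>2"
        by (simp add: power2_eq_square algebra_simps)
      then show "s\<^sup>2 * (f r t)\<^sup>2 + - s * (2 * f r t * (r * fr r t) + 2 * s * (f r t)\<^sup>2) \<le> 1 * (r * fr r t)\<^sup>2"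
        by (smt (verit) zero_le_power2)
    qed (auto intro!: continuous_intros sl simp: R)
    then show "nnint {0<..} (\<lambda>r. r powr (2 * \<gamma>) * (s\<^sup>2 * (f r t)\<^sup>2))
        \<le> nnint {0<..} (\<lambda>r. r powr (2 * \<gamma>) * (r * fr r t)\<^sup>2)"
      unfolding \<gamma> by simp
  qed (intro sector_fun_cmult sector_fun_power2 continuous_intros c'; simp)+
  show "wint \<gamma> (\<lambda>r t. (s\<^sup>2 + k) * (f r t)\<^sup>2 + k / 2 * (r * fr r t + 2 * f r t)\<^sup>2) \<le> wint \<gamma> (\<lambda>r t. 2 * (r * fr r t)\<^sup>2)"
  proof (rule wint_mono_r)
    fix t :: real
    have "nnint {0<..} (\<lambda>r. r powr (2 * s - 1) * ((s\<^sup>2 + k) * (f r t)\<^sup>2 + k / 2 * (r * fr r t + 2 * f r t)\<^sup>2))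
        \<le> nnint {0<..} (\<lambda>r. r powr (2 * s - 1) * (2 * (r * fr r t)\<^sup>2))"
    \<comment> \<open>This \<open>M\<close> is forced by the mixed term: it makes the excess
      \<open>(2 - k/2)\<close> times the square of \<open>r f_r + s f\<close> plus a multiple of
      \<open>f^2\<close>. The third condition on \<open>k\<close> says that this multiple is
      nonnegative.\<close>
    proof (rule radial_hardy[OF f sl(2) l s(2), where M = "- k - (2 - k / 2) * s" and R = "R + 1"])
      fix r :: real
      have "2 * (r * fr r t)\<^sup>2 - ((s\<^sup>2 + k) * (f r t)\<^sup>2 + k / 2 * (r * fr r t + 2 * f r t)\<^sup>2
           + (- k - (2 - k / 2) * s) * (2 * f r t * (r * fr r t) + 2 * s * (f r t)\<^sup>2))
        = (2 - k / 2) * (r * fr r t + s * f r t)\<^sup>2 + (s\<^sup>2 - k * (s\<^sup>2 / 2 - 2 * s + 3)) * (f r t)\<^sup>2"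
        by (simp add: power2_eq_square field_simps)
      moreover have "0 \<le> (2 - k / 2) * (r * fr r t + s * f r t)\<^sup>2 + (s\<^sup>2 - k * (s\<^sup>2 / 2 - 2 * s + 3)) * (f r t)\<^sup>2"
        using k by simp
      ultimately show "(s\<^sup>2 + k) * (f r t)\<^sup>2 + k / 2 * (r * fr r t + 2 * f r t)\<^sup>2
           + (- k - (2 - k / 2) * s) * (2 * f r t * (r * fr r t) + 2 * s * (f r t)\<^sup>2) \<le> 2 * (r * fr r t)\<^sup>2"
        by linarith
    qed (use R R' k in \<open>auto intro!: continuous_intros sl\<close>)
    then show "nnint {0<..} (\<lambda>r. r powr (2 * \<gamma>) * ((s\<^sup>2 + k) * (f r t)\<^sup>2 + k / 2 * (r * fr r t + 2 * f r t)\<^sup>2))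
        \<le> nnint {0<..} (\<lambda>r. r powr (2 * \<gamma>) * (2 * (r * fr r t)\<^sup>2))"
      unfolding \<gamma> .
  qed (use k in \<open>(intro sector_fun_add sector_fun_cmult sector_fun_power2 continuous_intros c'; simp)+\<close>)
qed

text \<open>The limits at the origin may depend on the polar angle, since the components of the one
  vector \<open>u 0\<close> change with the direction of the ray. The constant
  \<open>s^2 + k\<close> is shared out: \<open>q\<close> and \<open>w\<close> take
  \<open>s^2\<close> from their own radial energy, \<open>q\<close> takes \<open>k\<close> from
  \<open>?X\<close>, \<open>w\<close> takes \<open>k\<close> from its angular energy
  \<open>?S\<close>, and \<open>p\<close> pays for itself and for \<open>?X\<close> with two copies
  of \<open>?A1\<close>.\<close>

theorem solenoidal_hardy:
  assumes u: "Ck (Suc 0) u" and s: "s = \<gamma> + 1 / 2" "s \<noteq> 0"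
    and l: "\<And>t. ((\<lambda>r. p r t) \<longlongrightarrow> lp t) (at_right 0)" "\<And>t. ((\<lambda>r. q r t) \<longlongrightarrow> lq t) (at_right 0)"
      "\<And>t. ((\<lambda>r. w r t) \<longlongrightarrow> lw t) (at_right 0)"
      "\<And>t. s < 0 \<Longrightarrow> lp t = 0" "\<And>t. s < 0 \<Longrightarrow> lq t = 0" "\<And>t. s < 0 \<Longrightarrow> lw t = 0"
    and k: "0 \<le> k" "k \<le> 2" "k * (s\<^sup>2 / 2 - 2 * s + 3) \<le> s\<^sup>2"
  shows "ennreal (s\<^sup>2 + k) * (\<integral>\<^sup>+x. ennreal (norm x powr (2*\<gamma> - 2) * (norm (u x))\<^sup>2) \<partial>lborel)
    \<le> (\<integral>\<^sup>+x. ennreal (norm x powr (2*\<gamma>) * grad_sq u x) \<partial>lborel)"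
proof -
  obtain R where R: "R > 0" "\<And>r t. R \<le> r \<Longrightarrow> p r t = 0" "\<And>r t. R \<le> r \<Longrightarrow> q r t = 0" "\<And>r t. R \<le> r \<Longrightarrow> w r t = 0"
    using support by blast
  let ?A = "wint \<gamma> (\<lambda>r t. (p r t)\<^sup>2)" and ?B = "wint \<gamma> (\<lambda>r t. (q r t)\<^sup>2)" and ?C = "wint \<gamma> (\<lambda>r t. (w r t)\<^sup>2)"
  let ?A1 = "wint \<gamma> (\<lambda>r t. (r * pr r t)\<^sup>2)" and ?B1 = "wint \<gamma> (\<lambda>r t. (r * qr r t)\<^sup>2)" and ?C1 = "wint \<gamma> (\<lambda>r t. (r * wr r t)\<^sup>2)"
  let ?P = "wint \<gamma> (\<lambda>r t. (pt r t - q r t)\<^sup>2 + (qt r t + p r t)\<^sup>2 + (p r t + q r t * (cos t / sin t))\<^sup>2)"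
  let ?S = "wint \<gamma> (\<lambda>r t. (wt r t)\<^sup>2 + (w r t / sin t)\<^sup>2)"
  let ?X = "wint \<gamma> (\<lambda>r t. (r * pr r t + 2 * p r t)\<^sup>2)"
  note hardy = hardy_component[OF s _ _ _ R(1) _ _ _ k]
  have B: "ennreal (s\<^sup>2) * ?B \<le> ?B1"
    using hardy(1)[OF deriv_r(2) cont(2) cont_r(2) R(3) l(2) l(5)]
    by (subst wint_cmult[symmetric]) (auto intro!: sector_intros)
  have C: "ennreal (s\<^sup>2) * ?C \<le> ?C1"
    using hardy(1)[OF deriv_r(3) cont(3) cont_r(3) R(4) l(3) l(6)]
    by (subst wint_cmult[symmetric]) (auto intro!: sector_intros)
  have A: "ennreal (s\<^sup>2 + k) * ?A + ennreal (k / 2) * ?X \<le> ennreal 2 * ?A1"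
  proof -
    have "wint \<gamma> (\<lambda>r t. (s\<^sup>2 + k) * (p r t)\<^sup>2 + k / 2 * (r * pr r t + 2 * p r t)\<^sup>2) = ennreal (s\<^sup>2 + k) * ?A + ennreal (k / 2) * ?X"
    proof (subst wint_add)
      have X: "sector_fun (\<lambda>r t. (r * pr r t + 2 * p r t)\<^sup>2)" and p: "sector_fun (\<lambda>r t. (p r t)\<^sup>2)"
        by (intro sector_intros)+
      show "sector_fun (\<lambda>r t. (s\<^sup>2 + k) * (p r t)\<^sup>2)" "sector_fun (\<lambda>r t. k / 2 * (r * pr r t + 2 * p r t)\<^sup>2)"
        by (rule sector_fun_cmult[OF p] sector_fun_cmult[OF X]; use k in simp)+
      show "wint \<gamma> (\<lambda>r t. (s\<^sup>2 + k) * (p r t)\<^sup>2) + wint \<gamma> (\<lambda>r t. k / 2 * (r * pr r t + 2 * p r t)\<^sup>2)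
          = ennreal (s\<^sup>2 + k) * ?A + ennreal (k / 2) * ?X"
        using k by (simp only: wint_cmult[OF p] wint_cmult[OF X] add_nonneg_nonneg zero_le_power2 divide_nonneg_pos zero_less_numeral)
    qed
    moreover have "wint \<gamma> (\<lambda>r t. 2 * (r * pr r t)\<^sup>2) = ennreal 2 * ?A1"
      by (intro wint_cmult sector_intros) simp
    ultimately show ?thesis
      using hardy(2)[OF deriv_r(1) cont(1) cont_r(1) R(2) l(1) l(4)] by simp
  qed
  have qX: "ennreal 2 * ?B \<le> ?X"
    using poloidal_tangential_bound by (subst wint_cmult[symmetric]) (auto intro!: sector_intros)
  have kB: "ennreal k * ?B \<le> ennreal (k / 2) * ?X"
  proof -
    have "ennreal k * ?B = ennreal (k / 2) * (ennreal 2 * ?B)"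
      using k by (simp add: mult.assoc[symmetric] ennreal_mult'[symmetric] del: ennreal_numeral)
    also have "\<dots> \<le> ennreal (k / 2) * ?X"
      by (rule mult_left_mono[OF qX]) simp
    finally show ?thesis .
  qed
  have kC: "ennreal k * ?C \<le> ?S"
  proof -
    have "ennreal k * ?C \<le> ennreal 2 * ?C"
      using k by (intro mult_right_mono ennreal_leI) auto
    also have "\<dots> \<le> ?S"
      using swirl_bound by (subst wint_cmult[symmetric]) (auto intro!: sector_intros)
    finally show ?thesis .
  qed
  have "ennreal (s\<^sup>2 + k) * wint \<gamma> (\<lambda>r t. (p r t)\<^sup>2 + (q r t)\<^sup>2 + (w r t)\<^sup>2) = ennreal (s\<^sup>2 + k) * (?A + ?B + ?C)"
    by (simp add: wint_add sector_intros)
  also have "\<dots> = ennreal (s\<^sup>2 + k) * ?A + ennreal k * ?B + ennreal (s\<^sup>2) * ?B + ennreal (s\<^sup>2) * ?C + ennreal k * ?C"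
    using k by (simp add: ennreal_plus algebra_simps)
  also have "\<dots> \<le> ennreal (s\<^sup>2 + k) * ?A + ennreal (k / 2) * ?X + ?B1 + ?C1 + ?S"
    by (intro add_mono B C kB kC order_refl)
  also have "\<dots> \<le> ennreal 2 * ?A1 + ?B1 + ?C1 + ?S"
    by (intro add_mono A order_refl)
  \<comment> \<open>One copy of \<open>?A1\<close> is the radial energy of \<open>p\<close>; the
    other is exchanged for the angular energy \<open>?P\<close>, where the vanishing flux
    enters.\<close>
  also have "\<dots> = ?A1 + ?B1 + ?C1 + ?A1 + ?S"
    by (simp add: mult_2 algebra_simps)
  also have "\<dots> \<le> ?A1 + ?B1 + ?C1 + ?P + ?S"
    by (intro add_mono poloidal_gradient_bound order_refl)
  also have "\<dots> = wint \<gamma> (\<lambda>r t. (r * pr r t)\<^sup>2 + (r * qr r t)\<^sup>2 + (r * wr r t)\<^sup>2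
     + ((pt r t - q r t)\<^sup>2 + (qt r t + p r t)\<^sup>2 + (p r t + q r t * (cos t / sin t))\<^sup>2)
     + ((wt r t)\<^sup>2 + (w r t / sin t)\<^sup>2))" (is "_ = ?G")
    by (subst wint_add, (intro sector_intros)+)+ (rule refl)
  finally have "ennreal (2 * pi) * (ennreal (s\<^sup>2 + k) * wint \<gamma> (\<lambda>r t. (p r t)\<^sup>2 + (q r t)\<^sup>2 + (w r t)\<^sup>2)) \<le> ennreal (2 * pi) * ?G"
    by (rule mult_left_mono) simp
  then show ?thesis
    unfolding field_integral[OF u] gradient_integral[OF u] by (simp only: mult.left_commute)
qed

end

section \<open>The optimal constant and the inequality for admissible fields\<close>

definition C3_gap :: "real \<Rightarrow> real" where
  "C3_gap \<gamma> = (if \<gamma> \<le> 1 then 2 * (\<gamma> + 1/2)\<^sup>2 / (2 + (\<gamma> - 3/2)\<^sup>2) else 2)"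

text \<open>\<open>C3_gap\<close> is the largest \<open>k\<close> allowed for
  \<open>s = \<gamma> + 1/2\<close>. For \<open>\<gamma> \<le> 1\<close> the third bound holds with
  equality, and for \<open>\<gamma> > 1\<close> the second does. Both cases compare
  \<open>(\<gamma> + 1/2)^2\<close> with \<open>2 + (\<gamma> - 3/2)^2\<close>, which is the
  comparison of \<open>\<gamma>\<close> with 1.\<close>

lemma C3_gap_bounds:
  "0 \<le> C3_gap \<gamma>" "C3_gap \<gamma> \<le> 2"
  "C3_gap \<gamma> * ((\<gamma> + 1/2)\<^sup>2 / 2 - 2 * (\<gamma> + 1/2) + 3) \<le> (\<gamma> + 1/2)\<^sup>2"
proof -
  have pos: "0 < 2 + (\<gamma> - 3/2)\<^sup>2" by (simp add: add_pos_nonneg)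
  have e: "(\<gamma> + 1/2)\<^sup>2 / 2 - 2 * (\<gamma> + 1/2) + 3 = (2 + (\<gamma> - 3/2)\<^sup>2) / 2"
    by (simp add: power2_eq_square field_simps)
  show "0 \<le> C3_gap \<gamma>" using pos by (simp add: C3_gap_def)
  show "C3_gap \<gamma> \<le> 2"
  proof (cases "\<gamma> \<le> 1")
    case True
    have "(\<gamma> + 1/2)\<^sup>2 \<le> 2 + (\<gamma> - 3/2)\<^sup>2"
      using True by (simp add: power2_eq_square algebra_simps)
    then show ?thesis using pos True by (simp add: C3_gap_def divide_le_eq)
  qed (simp add: C3_gap_def)
  show "C3_gap \<gamma> * ((\<gamma> + 1/2)\<^sup>2 / 2 - 2 * (\<gamma> + 1/2) + 3) \<le> (\<gamma> + 1/2)\<^sup>2"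
  proof (cases "\<gamma> \<le> 1")
    case True
    then show ?thesis unfolding e using pos by (simp add: C3_gap_def)
  next
    case False
    then show ?thesis unfolding e by (simp add: C3_gap_def power2_eq_square algebra_simps)
  qed
qed

lemma C3_eq:
  assumes "\<gamma> \<noteq> -1/2"
  shows "C3 \<gamma> = 1 / ((\<gamma> + 1/2)\<^sup>2 + C3_gap \<gamma>)" "0 < (\<gamma> + 1/2)\<^sup>2 + C3_gap \<gamma>"
proof -
  have "\<gamma> + 1/2 \<noteq> 0" using assms by linarith
  then have s: "0 < (\<gamma> + 1/2)\<^sup>2" by simp
  then show "0 < (\<gamma> + 1/2)\<^sup>2 + C3_gap \<gamma>" using C3_gap_bounds(1)[of \<gamma>] by linarith
  have s4: "(2 * \<gamma> + 1)\<^sup>2 = 4 * (\<gamma> + 1/2)\<^sup>2" by (simp add: power2_eq_square algebra_simps)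
  show "C3 \<gamma> = 1 / ((\<gamma> + 1/2)\<^sup>2 + C3_gap \<gamma>)"
  proof (cases "\<gamma> \<le> 1")
    case True
    define S where "S = (\<gamma> + 1/2)\<^sup>2"
    define Q where "Q = (\<gamma> - 3/2)\<^sup>2"
    have Q: "0 \<le> Q" by (simp add: Q_def)
    have S: "0 < S" using s by (simp add: S_def)
    have "C3 \<gamma> = 4 / (4 * S) * ((2 + Q) / (4 + Q))"
      using True by (simp add: C3_def s4 S_def Q_def)
    also have "\<dots> = 1 / (S + 2 * S / (2 + Q))"
    proof -
      have "S + 2 * S / (2 + Q) = S * (4 + Q) / (2 + Q)"
        using Q by (simp add: field_simps)
      then show ?thesis by simp
    qed
    finally show ?thesis using True by (simp add: C3_gap_def S_def Q_def)
  next
    case False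
    define X where "X = (\<gamma> + 1/2)\<^sup>2 + 2"
    have "8 + (1 + 2 * \<gamma>)\<^sup>2 = 4 * X" by (simp add: X_def power2_eq_square algebra_simps)
    then have "C3 \<gamma> = 4 / (4 * X)" using False by (simp add: C3_def)
    then have "C3 \<gamma> = 1 / X" by simp
    then show ?thesis using False by (simp add: C3_gap_def X_def)
  qed
qed

lemma test_field_bounded_support:
  assumes "test_field u"
  obtains R where "0 < R" "\<And>x. R \<le> norm x \<Longrightarrow> u x = 0"
proof -
  have "bounded {x. u x \<noteq> 0}"
    using assms unfolding test_field_def by (meson bounded_subset closure_subset compact_imp_bounded)
  then obtain B where "\<And>x. u x \<noteq> 0 \<Longrightarrow> norm x \<le> B"
    unfolding bounded_iff by blast
  then show ?thesis
    by (intro that[of "\<bar>B\<bar> + 1"]) (auto, smt (verit))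
qed

lemma hardy_leray_C3:
  assumes \<gamma>: "\<gamma> \<noteq> -1/2" and frame: "orthonormal_frame a b c"
  shows "hardy_leray a b c \<gamma> (C3 \<gamma>)"
  unfolding hardy_leray_def
proof (intro allI impI)
  fix u assume adm: "admissible a b c \<gamma> u"
  then have tf: "test_field u" and ax: "axisymmetric a b c u" and dv: "\<And>x. divergence u x = 0"
    and u0: "\<gamma> < -1/2 \<Longrightarrow> u 0 = 0"
    by (auto simp: admissible_def)
  have u: "Ck (Suc 0) u"
    using tf by (simp only: test_field_def)
  obtain R where R: "0 < R" "\<And>x. R \<le> norm x \<Longrightarrow> u x = 0"
    using test_field_bounded_support[OF tf] by blast
  obtain pr qr wr pt qt wt where comp:
    "spherical_components a b c u (\<lambda>r t. u (r *\<^sub>R e_rho a b c t 0) \<bullet> e_rho a b c t 0)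
       (\<lambda>r t. u (r *\<^sub>R e_rho a b c t 0) \<bullet> e_theta a b c t 0) (\<lambda>r t. u (r *\<^sub>R e_rho a b c t 0) \<bullet> e_phi a b 0)
       pr qr wr pt qt wt"
    using axisymmetric_components[OF frame u ax] by blast
  have "solenoidal_components a b c u (\<lambda>r t. u (r *\<^sub>R e_rho a b c t 0) \<bullet> e_rho a b c t 0)
       (\<lambda>r t. u (r *\<^sub>R e_rho a b c t 0) \<bullet> e_theta a b c t 0) (\<lambda>r t. u (r *\<^sub>R e_rho a b c t 0) \<bullet> e_phi a b 0)
       pr qr wr pt qt wt"
  proof (rule solenoidal_components.intro[OF comp], unfold_locales)
    show "\<exists>R>0. \<forall>r\<ge>R. \<forall>\<theta>. u (r *\<^sub>R e_rho a b c \<theta> 0) \<bullet> e_rho a b c \<theta> 0 = 0 \<and>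
        u (r *\<^sub>R e_rho a b c \<theta> 0) \<bullet> e_theta a b c \<theta> 0 = 0 \<and> u (r *\<^sub>R e_rho a b c \<theta> 0) \<bullet> e_phi a b 0 = 0"
      using R by (intro exI[of _ R]) (auto simp: norm_e_rho[OF frame])
  qed (use dv axisymmetric_axis[OF frame ax] in auto)
  then interpret solenoidal_components a b c u "\<lambda>r t. u (r *\<^sub>R e_rho a b c t 0) \<bullet> e_rho a b c t 0"
       "\<lambda>r t. u (r *\<^sub>R e_rho a b c t 0) \<bullet> e_theta a b c t 0" "\<lambda>r t. u (r *\<^sub>R e_rho a b c t 0) \<bullet> e_phi a b 0"
       pr qr wr pt qt wt .
  \<comment> \<open>Along each ray the components tend to those of \<open>u 0\<close>, which is zero
    when \<open>\<gamma> < -1/2\<close>; these are the limits the radial argument asks for.\<close>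
  have lim: "((\<lambda>r. u (r *\<^sub>R x) \<bullet> n) \<longlongrightarrow> u 0 \<bullet> n) (at_right 0)" for x n
  proof -
    have "continuous_on UNIV (\<lambda>r. u (r *\<^sub>R x) \<bullet> n)"
      by (intro continuous_intros continuous_on_compose2[OF Ck_1_continuous[OF u, of UNIV]]) auto
    then have "((\<lambda>r. u (r *\<^sub>R x) \<bullet> n) \<longlongrightarrow> u (0 *\<^sub>R x) \<bullet> n) (at 0)"
      by (meson UNIV_I continuous_on_eq_continuous_at isCont_def open_UNIV)
    then show ?thesis by (simp add: filterlim_at_split)
  qed
  let ?K = "(\<gamma> + 1/2)\<^sup>2 + C3_gap \<gamma>"
  let ?L = "\<integral>\<^sup>+x. ennreal (norm x powr (2*\<gamma> - 2) * (norm (u x))\<^sup>2) \<partial>lborel"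
  let ?G = "\<integral>\<^sup>+x. ennreal (norm x powr (2*\<gamma>) * grad_sq u x) \<partial>lborel"
  have "ennreal ?K * ?L \<le> ?G"
    by (rule solenoidal_hardy[OF u refl _ lim lim lim]) (use \<gamma> u0 C3_gap_bounds[of \<gamma>] in auto)
  then have "ennreal (C3 \<gamma>) * (ennreal ?K * ?L) \<le> ennreal (C3 \<gamma>) * ?G"
    by (rule mult_left_mono) simp
  moreover have "ennreal (C3 \<gamma>) * ennreal ?K = 1"
    using C3_eq[OF \<gamma>] by (simp add: ennreal_mult'[symmetric])
  ultimately show "?L \<le> ennreal (C3 \<gamma>) * ?G"
    by (simp add: mult.assoc[symmetric])
qed

section \<open>Smooth cutoffs\<close>

text \<open>\<open>Ck\<close> is phrased with \<open>frechet_derivative\<close>; by uniqueness any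
  explicit derivative may be supplied instead, which is what inductions over explicit families
  require.\<close>

lemma Ck_SucI:
  assumes "\<And>x. (f has_derivative D x) (at x)" "\<And>v. v \<in> Basis \<Longrightarrow> Ck k (\<lambda>x. D x v)"
  shows "Ck (Suc k) f"
proof -
  have "frechet_derivative f (at x) = D x" for x
    using frechet_derivative_at[OF assms(1)] by simp
  then show ?thesis
    using assms by (auto simp: differentiable_def)
qed

lemma Ck_SucI_real:
  fixes f :: "real \<Rightarrow> real"
  assumes "\<And>x. (f has_real_derivative f' x) (at x)" "Ck k f'"
  shows "Ck (Suc k) f"
  by (rule Ck_SucI[OF assms(1)[unfolded has_field_derivative_def]]) (use assms(2) in simp)

lemma Ck_SucD: "Ck (Suc k) f \<Longrightarrow> Ck k f"
proof (induction k arbitrary: f)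
  case 0
  then show ?case
    by (auto intro!: differentiable_imp_continuous_on simp: differentiable_on_def differentiable_at_withinI)
next
  case (Suc k)
  then show ?case by (meson Ck.simps(2))
qed

lemma Ck_Suc_has_derivative:
  "Ck (Suc k) f \<Longrightarrow> (f has_derivative frechet_derivative f (at x)) (at x)"
  by (simp add: frechet_derivative_works)

lemma Ck_const: "Ck k (\<lambda>x. c)"
  by (induction k arbitrary: c) (auto intro!: Ck_SucI[where D = "\<lambda>x v. 0"])

lemma Ck_bounded_linear: "bounded_linear f \<Longrightarrow> Ck k f"
proof (cases k)
  case 0
  then show "bounded_linear f \<Longrightarrow> Ck k f" by (simp add: linear_continuous_on)
next
  case (Suc j)
  then show "bounded_linear f \<Longrightarrow> Ck k f"
    by (auto intro!: Ck_SucI[where D = "\<lambda>x. f"] Ck_const bounded_linear_imp_has_derivative simp del: Ck.simps)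
qed

lemma Ck_add: "Ck k f \<Longrightarrow> Ck k g \<Longrightarrow> Ck k (\<lambda>x. f x + g x)"
proof (induction k arbitrary: f g)
  case 0
  then show ?case by (simp add: continuous_on_add)
next
  case (Suc k)
  show ?case
    by (rule Ck_SucI, rule has_derivative_add[OF Ck_Suc_has_derivative[OF Suc.prems(1)] Ck_Suc_has_derivative[OF Suc.prems(2)]])
      (use Suc in auto)
qed

lemma Ck_scaleR: "Ck k f \<Longrightarrow> Ck k g \<Longrightarrow> Ck k (\<lambda>x. f x *\<^sub>R g x)"
proof (induction k arbitrary: f g)
  case 0
  then show ?case by (simp add: continuous_on_scaleR)
next
  case (Suc k)
  note less = Ck_SucD[OF Suc.prems(1)] Ck_SucD[OF Suc.prems(2)]
  show ?case
  proof (rule Ck_SucI, rule has_derivative_scaleR[OF Ck_Suc_has_derivative[OF Suc.prems(1)] Ck_Suc_has_derivative[OF Suc.prems(2)]])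
    fix v :: 'a assume "v \<in> Basis"
    then have "Ck k (\<lambda>x. frechet_derivative f (at x) v)" "Ck k (\<lambda>x. frechet_derivative g (at x) v)"
      using Suc.prems by auto
    then show "Ck k (\<lambda>x. f x *\<^sub>R frechet_derivative g (at x) v + frechet_derivative f (at x) v *\<^sub>R g x)"
      by (intro Ck_add Suc.IH less)
  qed
qed

lemma Ck_mult: "Ck k f \<Longrightarrow> Ck k g \<Longrightarrow> Ck k (\<lambda>x. f x * g x :: real)"
  using Ck_scaleR[of k f g] by simp

text \<open>With an outer function of one real variable the chain rule is a product of two
  scalar-valued functions, so the induction closes under \<open>Ck_mult\<close>. Profiles of
  \<open>x \<bullet> x\<close> are of this kind.\<close>

lemma Ck_compose:
  fixes \<phi> :: "real \<Rightarrow> real"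
  shows "Ck k \<phi> \<Longrightarrow> Ck k f \<Longrightarrow> Ck k (\<lambda>x. \<phi> (f x))"
proof (induction k arbitrary: \<phi> f)
  case 0
  then show ?case using continuous_on_compose2[of UNIV \<phi> UNIV f] by simp
next
  case (Suc k)
  let ?\<phi>' = "\<lambda>t. frechet_derivative \<phi> (at t) 1"
  have d: "((\<lambda>x. \<phi> (f x)) has_derivative (\<lambda>v. frechet_derivative f (at x) v * ?\<phi>' (f x))) (at x)" for x
  proof -
    have l: "frechet_derivative \<phi> (at t) h = h * ?\<phi>' t" for t h
      using linear_cmul[OF has_derivative_linear[OF Ck_Suc_has_derivative[OF Suc.prems(1)]], of t h 1] by simp
    have "(\<lambda>v. frechet_derivative \<phi> (at (f x)) (frechet_derivative f (at x) v)) = (\<lambda>v. frechet_derivative f (at x) v * ?\<phi>' (f x))"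
      by (rule ext) (rule l)
    then show ?thesis
      using has_derivative_compose[OF Ck_Suc_has_derivative[OF Suc.prems(2)] Ck_Suc_has_derivative[OF Suc.prems(1)], of x]
      by (simp only:)
  qed
  have "Ck k ?\<phi>'"
    using Suc.prems(1) by simp
  from Suc.IH[OF this Ck_SucD[OF Suc.prems(2)]] show ?case
    using Suc.prems(2) by (intro Ck_SucI[OF d] Ck_mult) simp_all
qed

lemma Ck_inner_self: "Ck k (\<lambda>x::'a::euclidean_space. x \<bullet> x)"
proof (cases k)
  case 0
  then show ?thesis by (simp add: continuous_on_inner continuous_on_id)
next
  case (Suc j)
  have "((\<lambda>x::'a. x \<bullet> x) has_derivative (\<lambda>v. 2 * (x \<bullet> v))) (at x)" for x
    by (auto intro!: derivative_eq_intros simp: inner_commute)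
  then show ?thesis
    unfolding Suc
    by (rule Ck_SucI) (rule Ck_bounded_linear, intro bounded_linear_const_mult bounded_linear_inner_left)
qed

lemma Ck_deriv_real:
  fixes f :: "real \<Rightarrow> real"
  assumes "\<And>k. Ck k f"
  shows "(f has_real_derivative deriv f x) (at x)" "Ck k (deriv f)"
proof -
  have d: "(f has_real_derivative frechet_derivative f (at x) 1) (at x)" for x
  proof -
    have d: "(f has_derivative frechet_derivative f (at x)) (at x)"
      using assms[of "Suc 0"] by (rule Ck_Suc_has_derivative)
    have "frechet_derivative f (at x) = (*) (frechet_derivative f (at x) 1)"
    proof (rule ext)
      fix h show "frechet_derivative f (at x) h = frechet_derivative f (at x) 1 * h"
        using linear_cmul[OF has_derivative_linear[OF d], of h 1] by (simp add: mult.commute)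
    qed
    then show ?thesis using d by (metis has_field_derivative_def)
  qed
  then have e: "deriv f = (\<lambda>x. frechet_derivative f (at x) 1)"
    using DERIV_imp_deriv by blast
  show "(f has_real_derivative deriv f x) (at x)" unfolding e by (rule d)
  show "Ck k (deriv f)" unfolding e using assms[of "Suc k"] by simp
qed

section \<open>Bump functions and logarithmic profiles\<close>

definition flat :: "nat \<Rightarrow> real \<Rightarrow> real" where
  "flat n x = (if 0 < x then (1 / x) ^ n * exp (- (1 / x)) else 0)"

lemma flat_tendsto_0: "(flat n \<longlongrightarrow> 0) (at 0)"
proof -
  have "((\<lambda>x. inverse x ^ n / exp (inverse x)) \<longlongrightarrow> (0::real)) (at_right 0)"
    using filterlim_compose[OF tendsto_power_div_exp_0 filterlim_inverse_at_top_right] .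
  then have "(flat n \<longlongrightarrow> 0) (at_right 0)"
    by (rule Lim_transform_eventually) (auto simp: eventually_at_filter flat_def exp_minus field_simps)
  moreover have "(flat n \<longlongrightarrow> 0) (at_left 0)"
    by (rule Lim_transform_eventually[OF tendsto_const]) (auto simp: eventually_at_filter flat_def)
  ultimately show ?thesis by (simp add: filterlim_at_split)
qed

text \<open>The powers of \<open>1 / x\<close> are included in \<open>flat\<close> so that the
  family is closed under differentiation; smoothness then follows by induction for all
  \<open>n\<close> together. At the origin the difference quotient of \<open>flat n\<close> is
  \<open>flat (n + 1)\<close>, which tends to zero.\<close>

lemma flat_has_derivative: "(flat n has_real_derivative (flat (n + 2) x - real n * flat (n + 1) x)) (at x)"
proof (cases "x = 0")
  case True
  have "((\<lambda>h. (flat n (0 + h) - flat n 0) / h) \<longlongrightarrow> 0) (at 0)"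
    by (rule Lim_transform_eventually[OF flat_tendsto_0[of "Suc n"]]) (auto simp: eventually_at_filter flat_def)
  then show ?thesis
    using True by (simp add: DERIV_def flat_def)
next
  case False
  show ?thesis
  proof (cases "x > 0")
    case True
    have "((\<lambda>x. (1 / x) ^ n * exp (- (1 / x))) has_real_derivative flat (n + 2) x - real n * flat (n + 1) x) (at x)"
    proof -
      have i: "((\<lambda>x. 1 / x) has_real_derivative - ((1 / x)\<^sup>2)) (at x)"
        using True by (auto intro!: derivative_eq_intros simp: power2_eq_square)
      have 1: "((\<lambda>x. (1 / x) ^ n) has_real_derivative - (real n * (1 / x) ^ (n + 1))) (at x)"
        by (rule DERIV_cong[OF DERIV_power[OF i]]) (cases n; simp add: power2_eq_square power_add)
      have 2: "((\<lambda>x. exp (- (1 / x))) has_real_derivative exp (- (1 / x)) * (1 / x)\<^sup>2) (at x)"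
        by (rule DERIV_cong[OF DERIV_fun_exp[OF DERIV_minus[OF i]]]) simp
      show ?thesis
        by (rule DERIV_cong[OF DERIV_mult[OF 1 2]]) (use True in \<open>simp add: flat_def power_add power2_eq_square algebra_simps\<close>)
    qed
    then show ?thesis
      by (rule has_field_derivative_transform_within_open[where S = "{0<..}"]) (use True in \<open>auto simp: flat_def\<close>)
  next
    case F: False
    have "((\<lambda>x. 0) has_real_derivative flat (n + 2) x - real n * flat (n + 1) x) (at x)"
      using F by (simp add: flat_def)
    then show ?thesis
      by (rule has_field_derivative_transform_within_open[where S = "{..<0}"]) (use F False in \<open>auto simp: flat_def\<close>)
  qed
qed

lemma Ck_flat: "Ck k (flat n)"
proof (induction k arbitrary: n)
  case 0
  have "isCont (flat n) x" for x
    using flat_has_derivative by (rule DERIV_isCont)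
  then show ?case by (simp add: continuous_at_imp_continuous_on)
next
  case (Suc k)
  have "Ck k (\<lambda>x. flat (n + 2) x + (- real n) * flat (n + 1) x)"
    by (intro Ck_add Ck_mult Ck_const Suc.IH)
  then show ?case
    using flat_has_derivative[of n] by (intro Ck_SucI_real) auto
qed

definition bump :: "real \<Rightarrow> real" where
  "bump t = flat 0 (1 + t) * flat 0 (1 - t)"

lemma Ck_bump: "Ck k bump"
proof -
  have "Ck k (\<lambda>t::real. 1 + t)" "Ck k (\<lambda>t::real. 1 + (-1) * t)"
    by (intro Ck_add Ck_const Ck_mult Ck_bounded_linear bounded_linear_ident)+
  then show ?thesis
    unfolding bump_def[abs_def] by (intro Ck_mult Ck_compose[OF Ck_flat]) auto
qed

lemma bump_support: "1 < \<bar>t\<bar> \<Longrightarrow> bump t = 0" and bump_pos: "0 < bump 0"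
  by (auto simp: bump_def flat_def)

definition cutoff :: "(real \<Rightarrow> real) \<Rightarrow> bool" where
  "cutoff \<psi> \<longleftrightarrow> (\<forall>k. Ck k \<psi>) \<and> (\<forall>t. 1 < \<bar>t\<bar> \<longrightarrow> \<psi> t = 0)"

lemma cutoff_deriv:
  assumes "cutoff \<psi>" shows "cutoff (deriv \<psi>)" "(\<psi> has_real_derivative deriv \<psi> t) (at t)"
proof -
  have C: "\<And>k. Ck k \<psi>" and Z: "\<And>t. 1 < \<bar>t\<bar> \<Longrightarrow> \<psi> t = 0" using assms by (auto simp: cutoff_def)
  show d: "(\<psi> has_real_derivative deriv \<psi> t) (at t)" for t by (rule Ck_deriv_real[OF C])
  have "deriv \<psi> t = 0" if t: "1 < \<bar>t\<bar>" for t
  proof -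
    have "open {t::real. 1 < \<bar>t\<bar>}" by (intro open_Collect_less continuous_intros)
    then have "(\<psi> has_real_derivative 0) (at t)"
      by (rule has_field_derivative_transform_within_open[OF DERIV_const]) (use t Z in auto)
    then show ?thesis using d DERIV_unique by blast
  qed
  then show "cutoff (deriv \<psi>)" using Ck_deriv_real(2)[OF C] by (auto simp: cutoff_def)
qed

lemma cutoff_lincomb: "cutoff \<psi> \<Longrightarrow> cutoff \<eta> \<Longrightarrow> cutoff (\<lambda>t. x * \<psi> t + y * \<eta> t)"
  unfolding cutoff_def by (auto intro!: Ck_add Ck_mult Ck_const)

text \<open>For a cutoff \<open>\<psi>\<close> this is smooth on the whole line, since it vanishes near 0.\<close>

definition log_profile :: "real \<Rightarrow> real \<Rightarrow> (real \<Rightarrow> real) \<Rightarrow> real \<Rightarrow> real" where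
  "log_profile \<beta> p \<psi> \<sigma> = (if 0 < \<sigma> then \<sigma> powr p * \<psi> (\<beta> * ln \<sigma>) else 0)"

text \<open>Differentiation lowers the power by one and replaces the cutoff by another cutoff. The
  family is therefore closed under derivatives, and smoothness follows by induction over all powers
  and cutoffs.\<close>

lemma log_profile_has_derivative:
  assumes \<beta>: "0 < \<beta>" and \<psi>: "cutoff \<psi>"
  shows "(log_profile \<beta> p \<psi> has_real_derivative log_profile \<beta> (p - 1) (\<lambda>t. p * \<psi> t + \<beta> * deriv \<psi> t) \<sigma>) (at \<sigma>)"
proof (cases "0 < \<sigma>")
  case True
  have "((\<lambda>\<sigma>. \<psi> (\<beta> * ln \<sigma>)) has_real_derivative deriv \<psi> (\<beta> * ln \<sigma>) * (\<beta> / \<sigma>)) (at \<sigma>)"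
    by (rule DERIV_chain2[OF cutoff_deriv(2)[OF \<psi>]]) (use True in \<open>auto intro!: derivative_eq_intros\<close>)
  from DERIV_mult[OF has_real_derivative_powr[OF True, of p] this]
  have "((\<lambda>\<sigma>. \<sigma> powr p * \<psi> (\<beta> * ln \<sigma>)) has_real_derivative log_profile \<beta> (p - 1) (\<lambda>t. p * \<psi> t + \<beta> * deriv \<psi> t) \<sigma>) (at \<sigma>)"
    using True by (simp add: log_profile_def powr_diff field_simps)
  then show ?thesis
    by (rule has_field_derivative_transform_within_open[where S = "{0<..}"]) (use True in \<open>auto simp: log_profile_def\<close>)
next
  case False
  \<comment> \<open>Below \<open>exp (- 2 / \<beta>)\<close> the cutoff is evaluated below -2,
    outside its support, so the profile vanishes on a whole neighbourhood of every nonpositive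
    point.\<close>
  have z: "log_profile \<beta> p \<psi> \<tau> = 0" if "\<tau> < exp (- 2 / \<beta>)" for \<tau>
  proof (cases "0 < \<tau>")
    case True
    then have "ln \<tau> < - 2 / \<beta>" using that by (metis exp_less_cancel_iff exp_ln)
    then have "\<beta> * ln \<tau> < - 2" using \<beta> by (simp add: field_simps)
    then show ?thesis using \<psi> by (simp add: log_profile_def cutoff_def)
  qed (simp add: log_profile_def)
  have "((\<lambda>x. 0) has_real_derivative log_profile \<beta> (p - 1) (\<lambda>t. p * \<psi> t + \<beta> * deriv \<psi> t) \<sigma>) (at \<sigma>)"
    using False by (simp add: log_profile_def)
  then show ?thesis
    by (rule has_field_derivative_transform_within_open[where S = "{..<exp (- 2 / \<beta>)}"]) (use False z in \<open>auto intro: order.strict_trans1[of _ 0]\<close>)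
qed

lemma Ck_log_profile:
  assumes "0 < \<beta>" "cutoff \<psi>"
  shows "Ck k (log_profile \<beta> p \<psi>)"
  using assms(2)
proof (induction k arbitrary: p \<psi>)
  case 0
  have "isCont (log_profile \<beta> p \<psi>) x" for x
    using log_profile_has_derivative[OF assms(1) 0] by (rule DERIV_isCont)
  then show ?case by (simp add: continuous_at_imp_continuous_on)
next
  case (Suc k)
  show ?case
    by (rule Ck_SucI_real[OF log_profile_has_derivative[OF assms(1) Suc.prems]])
      (intro Suc.IH cutoff_lincomb cutoff_deriv Suc.prems)
qed

section \<open>Sharpness\<close>

text \<open>Every \<open>Q\<close> and \<open>Z\<close> give a solenoidal field, with components \<open>Q cos \<theta>\<close>, \<open>- (Q + \<sigma> Q') sin \<theta>\<close> and
  \<open>r Z sin \<theta>\<close> at \<open>\<sigma> = r\<^sup>2\<close>: a poloidal field of degree one plus a swirl of degree one.\<close>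

definition degree_one_field :: "real^3 \<Rightarrow> real^3 \<Rightarrow> real^3 \<Rightarrow> (real \<Rightarrow> real) \<Rightarrow> (real \<Rightarrow> real) \<Rightarrow> (real \<Rightarrow> real) \<Rightarrow> real^3 \<Rightarrow> real^3" where
  "degree_one_field a b c Q Q' Z x =
     (Q (x \<bullet> x) + (x \<bullet> x) * Q' (x \<bullet> x)) *\<^sub>R c - (Q' (x \<bullet> x) * (x \<bullet> c)) *\<^sub>R x
     + Z (x \<bullet> x) *\<^sub>R ((x \<bullet> a) *\<^sub>R b - (x \<bullet> b) *\<^sub>R a)"

text \<open>Taking the profiles as functions of \<open>x \<bullet> x\<close> rather than of the norm
  makes the field a sum of products of smooth functions, also at the origin.\<close>

lemma Ck_degree_one_field:
  assumes "Ck k Q" "Ck k Q'" "Ck k Z"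
  shows "Ck k (degree_one_field a b c Q Q' Z)"
proof -
  have "Ck k (\<lambda>x. (Q (x \<bullet> x) + (x \<bullet> x) * Q' (x \<bullet> x)) *\<^sub>R c + (-1 * (Q' (x \<bullet> x) * (x \<bullet> c))) *\<^sub>R x
     + Z (x \<bullet> x) *\<^sub>R ((x \<bullet> a) *\<^sub>R b + (-1 * (x \<bullet> b)) *\<^sub>R a))"
    by (intro Ck_add Ck_scaleR Ck_mult Ck_const Ck_compose[OF assms(1)] Ck_compose[OF assms(2)] Ck_compose[OF assms(3)]
        Ck_inner_self Ck_bounded_linear[OF bounded_linear_inner_left] Ck_bounded_linear[OF bounded_linear_ident])
  then show ?thesis
    by (simp add: degree_one_field_def[abs_def])
qed

text \<open>With the factor \<open>Q + \<sigma> Q'\<close> on \<open>c\<close>, the first term of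
  the field has divergence \<open>(4 Q' + 2 \<sigma> Q'') (x \<bullet> c)\<close>, and the second
  cancels it exactly. The swirl is a rotation about the axis scaled by a radial function, hence
  divergence-free.\<close>

lemma divergence_degree_one_field:
  assumes frame: "orthonormal_frame a b c"
    and Q: "\<And>\<sigma>. (Q has_real_derivative Q' \<sigma>) (at \<sigma>)" and Q': "\<And>\<sigma>. (Q' has_real_derivative Q'' \<sigma>) (at \<sigma>)"
    and Z: "\<And>\<sigma>. (Z has_real_derivative Z' \<sigma>) (at \<sigma>)"
  shows "divergence (degree_one_field a b c Q Q' Z) x = 0"
proof -
  let ?\<sigma> = "x \<bullet> x"
  have sq: "((\<lambda>x. x \<bullet> x) has_derivative (\<lambda>v. 2 * (x \<bullet> v))) (at x)"
    by (auto intro!: derivative_eq_intros simp: inner_commute)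
  have comp: "((\<lambda>x. f (x \<bullet> x)) has_derivative (\<lambda>v. 2 * (x \<bullet> v) * f' ?\<sigma>)) (at x)"
    if "\<And>\<sigma>. (f has_real_derivative f' \<sigma>) (at \<sigma>)" for f f' :: "real \<Rightarrow> real"
    using has_derivative_compose[OF sq that[of ?\<sigma>, unfolded has_field_derivative_def]] by (simp add: mult.commute)
  have lin: "((\<lambda>x. x \<bullet> n) has_derivative (\<lambda>v. v \<bullet> n)) (at x)" for n
    by (auto intro!: derivative_eq_intros)
  let ?D = "\<lambda>v. (2 * (x \<bullet> v) * Q' ?\<sigma> + (?\<sigma> * (2 * (x \<bullet> v) * Q'' ?\<sigma>) + 2 * (x \<bullet> v) * Q' ?\<sigma>)) *\<^sub>R c
      - ((Q' ?\<sigma> * (x \<bullet> c)) *\<^sub>R v + (Q' ?\<sigma> * (v \<bullet> c) + 2 * (x \<bullet> v) * Q'' ?\<sigma> * (x \<bullet> c)) *\<^sub>R x)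
      + (Z ?\<sigma> *\<^sub>R ((v \<bullet> a) *\<^sub>R b - (v \<bullet> b) *\<^sub>R a) + (2 * (x \<bullet> v) * Z' ?\<sigma>) *\<^sub>R ((x \<bullet> a) *\<^sub>R b - (x \<bullet> b) *\<^sub>R a))"
  have D: "(degree_one_field a b c Q Q' Z has_derivative ?D) (at x)"
    unfolding degree_one_field_def[abs_def]
    by (rule has_derivative_add has_derivative_diff has_derivative_scaleR has_derivative_mult has_derivative_scaleR_left
        comp[OF Q] comp[OF Q'] comp[OF Z] sq lin has_derivative_ident)+
  have xx: "x \<bullet> x = (x \<bullet> a) * (x \<bullet> a) + (x \<bullet> b) * (x \<bullet> b) + (x \<bullet> c) * (x \<bullet> c)"
    by (rule parseval_frame[OF frame])
  show ?thesis
    unfolding divergence_frame[OF frame D]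
    using xx by (simp add: inner_simps frame_inner[OF frame] inner_commute[of a x] inner_commute[of b x] inner_commute[of c x])
      (simp add: algebra_simps)
qed

lemma degree_one_field_spherical:
  assumes frame: "orthonormal_frame a b c"
  shows "degree_one_field a b c Q Q' Z (r *\<^sub>R e_rho a b c \<theta> \<phi>)
     = (Q (r\<^sup>2) * cos \<theta>) *\<^sub>R e_rho a b c \<theta> \<phi> + (- (Q (r\<^sup>2) + r\<^sup>2 * Q' (r\<^sup>2)) * sin \<theta>) *\<^sub>R e_theta a b c \<theta> \<phi>
       + (r * Z (r\<^sup>2) * sin \<theta>) *\<^sub>R e_phi a b \<phi>"
proof -
  let ?e = "e_rho a b c \<theta> \<phi>" and ?t = "e_theta a b c \<theta> \<phi>"
  have s: "(r *\<^sub>R ?e) \<bullet> (r *\<^sub>R ?e) = r\<^sup>2"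
    using norm_e_rho[OF frame, of \<theta> \<phi>] by (simp add: norm_eq_1 power2_eq_square)
  have "cos \<theta> *\<^sub>R ?e - sin \<theta> *\<^sub>R ?t = (cos \<theta> * cos \<theta> + sin \<theta> * sin \<theta>) *\<^sub>R c"
    by (simp add: e_rho_def e_theta_def algebra_simps del: sin_cos_squared_add3)
  then have c: "c = cos \<theta> *\<^sub>R ?e - sin \<theta> *\<^sub>R ?t" by simp
  define q where "q = Q (r\<^sup>2)"
  define q' where "q' = Q' (r\<^sup>2)"
  have "(q + r\<^sup>2 * q') *\<^sub>R c - (q' * (r * cos \<theta>)) *\<^sub>R (r *\<^sub>R ?e) = (q * cos \<theta>) *\<^sub>R ?e + (- (q + r\<^sup>2 * q') * sin \<theta>) *\<^sub>R ?t"
    by (subst c) (simp add: algebra_simps power2_eq_square)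
  moreover have "(r * sin \<theta> * cos \<phi>) *\<^sub>R b - (r * sin \<theta> * sin \<phi>) *\<^sub>R a = (r * sin \<theta>) *\<^sub>R e_phi a b \<phi>"
    by (simp add: e_phi_def algebra_simps)
  ultimately show ?thesis
    unfolding degree_one_field_def s unfolding inner_scaleR_left e_rho_inner[OF frame] q_def q'_def
    by (simp add: mult_ac)
qed

lemma admissible_degree_one_field:
  assumes frame: "orthonormal_frame a b c"
    and Q: "\<And>\<sigma>. (Q has_real_derivative Q' \<sigma>) (at \<sigma>)" and Q': "\<And>\<sigma>. (Q' has_real_derivative Q'' \<sigma>) (at \<sigma>)"
    and Z: "\<And>\<sigma>. (Z has_real_derivative Z' \<sigma>) (at \<sigma>)"
    and C: "\<And>k. Ck k Q" "\<And>k. Ck k Q'" "\<And>k. Ck k Z"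
    and R: "\<And>\<sigma>. R < \<sigma> \<Longrightarrow> Q \<sigma> = 0 \<and> Q' \<sigma> = 0 \<and> Z \<sigma> = 0" and Q0: "Q 0 = 0"
  shows "admissible a b c \<gamma> (degree_one_field a b c Q Q' Z)"
  unfolding admissible_def
proof (intro conjI allI impI)
  show "test_field (degree_one_field a b c Q Q' Z)"
    unfolding test_field_def
  proof (intro conjI allI)
    show "Ck k (degree_one_field a b c Q Q' Z)" for k
      by (rule Ck_degree_one_field[OF C])
    have "norm x \<le> sqrt \<bar>R\<bar>" if "degree_one_field a b c Q Q' Z x \<noteq> 0" for x
    proof -
      have "x \<bullet> x \<le> R" using that R[of "x \<bullet> x"] by (auto simp: degree_one_field_def not_less[symmetric])
      then show ?thesis by (simp add: norm_eq_sqrt_inner)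
    qed
    then show "compact (closure {x. degree_one_field a b c Q Q' Z x \<noteq> 0})"
      unfolding compact_eq_bounded_closed
      by (intro conjI closed_closure bounded_closure boundedI[where B = "sqrt \<bar>R\<bar>"]) auto
  qed
  show "axisymmetric a b c (degree_one_field a b c Q Q' Z)"
    unfolding axisymmetric_def using degree_one_field_spherical[OF frame, of Q Q' Z]
    by (intro exI[of _ "\<lambda>r \<theta>. Q (r\<^sup>2) * cos \<theta>"] exI[of _ "\<lambda>r \<theta>. - (Q (r\<^sup>2) + r\<^sup>2 * Q' (r\<^sup>2)) * sin \<theta>"]
        exI[of _ "\<lambda>r \<theta>. r * Z (r\<^sup>2) * sin \<theta>"]) blast
  show "divergence (degree_one_field a b c Q Q' Z) x = 0" for x
    by (rule divergence_degree_one_field[OF frame Q Q' Z])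
  show "degree_one_field a b c Q Q' Z 0 = 0"
    by (simp add: degree_one_field_def Q0)
qed

text \<open>The angular integrals of \<open>cos^2 sin\<close> and \<open>sin^3\<close> are 2/3 and
  4/3. The weight and the factor \<open>r powr (- 2 * s)\<close> combine to \<open>1 / r\<close>,
  which the substitution \<open>t = e ln r\<close> turns into Lebesgue measure divided by
  \<open>e\<close>.\<close>

lemma wint_log_profile:
  fixes \<alpha> \<beta> :: "real \<Rightarrow> real"
  assumes \<gamma>: "2 * \<gamma> = 2 * s - 1" and e: "0 < e"
    and c: "continuous_on UNIV \<alpha>" "continuous_on UNIV \<beta>" and nn: "\<And>t. 0 \<le> \<alpha> t" "\<And>t. 0 \<le> \<beta> t"
    and z: "\<And>t. 1 < \<bar>t\<bar> \<Longrightarrow> \<alpha> t = 0 \<and> \<beta> t = 0"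
  shows "wint \<gamma> (\<lambda>r \<theta>. r powr (- 2 * s) * (\<alpha> (e * ln r) * (cos \<theta>)\<^sup>2 + \<beta> (e * ln r) * (sin \<theta>)\<^sup>2))
     = ennreal (integral {-1..1} (\<lambda>t. 2/3 * \<alpha> t + 4/3 * \<beta> t) / e)"
proof -
  define \<psi> where "\<psi> t = 2/3 * \<alpha> t + 4/3 * \<beta> t" for t
  have c\<psi>: "continuous_on A \<psi>" for A
    unfolding \<psi>_def by (intro continuous_intros continuous_on_subset[OF c(1)] continuous_on_subset[OF c(2)]) auto
  have cl: "continuous_on half_disc (\<lambda>z. f (e * ln (fst z)))" if "continuous_on UNIV f" for f :: "real \<Rightarrow> real"
    by (rule continuous_on_compose2[OF that]) (auto intro!: continuous_intros simp: half_disc_def)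
  have sf: "sector_fun (\<lambda>r \<theta>. r powr (2 * \<gamma>) * (r powr (- 2 * s) * (\<alpha> (e * ln r) * (cos \<theta>)\<^sup>2 + \<beta> (e * ln r) * (sin \<theta>)\<^sup>2)) * sin \<theta>)"
    by (intro sector_fun_weight sector_fun_mult sector_fun_powr)
      (use nn in \<open>auto simp: sector_fun_def intro!: continuous_intros cl c\<close>)
  have inner: "(nnint {0<..<pi} (\<lambda>\<theta>. r powr (2 * \<gamma>) * (r powr (- 2 * s) * (\<alpha> (e * ln r) * (cos \<theta>)\<^sup>2 + \<beta> (e * ln r) * (sin \<theta>)\<^sup>2)) * sin \<theta>))
     = ennreal (1 / r * \<psi> (e * ln r))" if r: "0 < r" for r
  proof -
    let ?A = "\<alpha> (e * ln r)" and ?B = "\<beta> (e * ln r)"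
    have w: "r powr (2 * \<gamma>) * r powr (- 2 * s) = 1 / r"
    proof -
      have "r powr (2 * \<gamma>) * r powr (- 2 * s) = r powr (2 * \<gamma> + - 2 * s)"
        by (rule powr_add[symmetric])
      then show ?thesis using r by (simp add: \<gamma> powr_minus_divide)
    qed
    have "((\<lambda>\<theta>. (?A * (cos \<theta>)\<^sup>2 + ?B * (sin \<theta>)\<^sup>2) * sin \<theta>) has_integral
        ((- ?A * (cos pi)^3 / 3 + ?B * (- cos pi + (cos pi)^3 / 3)) - (- ?A * (cos 0)^3 / 3 + ?B * (- cos 0 + (cos 0)^3 / 3)))) {0..pi}"
    proof (rule fundamental_theorem_of_calculus)
      fix x :: real
      have "((\<lambda>\<theta>. - ?A * (cos \<theta>)^3 / 3 + ?B * (- cos \<theta> + (cos \<theta>)^3 / 3)) has_real_derivative (?A * (cos x)\<^sup>2 + ?B * (1 - (cos x)\<^sup>2)) * sin x) (at x)"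
        by (auto intro!: derivative_eq_intros simp: algebra_simps power2_eq_square)
      then show "((\<lambda>\<theta>. - ?A * (cos \<theta>)^3 / 3 + ?B * (- cos \<theta> + (cos \<theta>)^3 / 3)) has_vector_derivative (?A * (cos x)\<^sup>2 + ?B * (sin x)\<^sup>2) * sin x) (at x within {0..pi})"
        by (simp add: sin_squared_eq has_real_derivative_iff_has_vector_derivative[symmetric] has_field_derivative_at_within)
    qed simp
    also have "((- ?A * (cos pi)^3 / 3 + ?B * (- cos pi + (cos pi)^3 / 3)) - (- ?A * (cos 0)^3 / 3 + ?B * (- cos 0 + (cos 0)^3 / 3))) = \<psi> (e * ln r)"
      by (simp add: \<psi>_def field_simps)
    finally have "((\<lambda>\<theta>. 1 / r * ((?A * (cos \<theta>)\<^sup>2 + ?B * (sin \<theta>)\<^sup>2) * sin \<theta>)) has_integral 1 / r * \<psi> (e * ln r)) {0..pi}"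
      by (rule has_integral_mult_right)
    then have "((\<lambda>\<theta>. 1 / r * ((?A * (cos \<theta>)\<^sup>2 + ?B * (sin \<theta>)\<^sup>2) * sin \<theta>)) has_integral 1 / r * \<psi> (e * ln r)) {0<..<pi}"
      using has_integral_open_interval[of "\<lambda>\<theta>. 1 / r * ((?A * (cos \<theta>)\<^sup>2 + ?B * (sin \<theta>)\<^sup>2) * sin \<theta>)" _ 0 pi]
      by (simp only: cbox_interval box_real)
    from nn_integral_has_integral_lebesgue'[OF _ this]
    have "nnint {0<..<pi} (\<lambda>\<theta>. 1 / r * ((?A * (cos \<theta>)\<^sup>2 + ?B * (sin \<theta>)\<^sup>2) * sin \<theta>)) = ennreal (1 / r * \<psi> (e * ln r))"
      using r nn by (simp add: sin_ge_zero)
    then show ?thesis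
      by (simp only: w[symmetric] mult.assoc)
  qed
  have wi: "wint \<gamma> (\<lambda>r \<theta>. r powr (- 2 * s) * (\<alpha> (e * ln r) * (cos \<theta>)\<^sup>2 + \<beta> (e * ln r) * (sin \<theta>)\<^sup>2))
      = nnint {0<..} (\<lambda>r. 1 / r * \<psi> (e * ln r))"
    unfolding wint_def sector_integral_iterated(1)[OF sf]
  proof (intro nn_integral_cong)
    fix r :: real
    show "(nnint {0<..<pi} (\<lambda>\<theta>. r powr (2 * \<gamma>) * (r powr (- 2 * s) * (\<alpha> (e * ln r) * (cos \<theta>)\<^sup>2 + \<beta> (e * ln r) * (sin \<theta>)\<^sup>2)) * sin \<theta>))
        * indicator {0<..} r = ennreal (1 / r * \<psi> (e * ln r)) * indicator {0<..} r"
    proof (cases "0 < r")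
      case True
      show ?thesis unfolding inner[OF True] ..
    qed simp
  qed
  let ?l = "exp (- 1 / e)" and ?u = "exp (1 / e)"
  have pos: "0 < r" if "?l \<le> r" for r
    using exp_gt_zero that by (rule less_le_trans)
  have z\<psi>: "\<psi> (e * ln r) = 0" if "0 < r" "r \<notin> {?l..?u}" for r
  proof -
    have "ln r < - 1 / e \<or> 1 / e < ln r"
      using that by (metis atLeastAtMost_iff exp_ln exp_le_cancel_iff not_le)
    then have "1 < \<bar>e * ln r\<bar>" using e by (auto simp: field_simps)
    then show ?thesis using z by (simp add: \<psi>_def)
  qed
  have lu: "?l \<le> ?u" "ln ?l = - 1 / e" "ln ?u = 1 / e" using e by auto
  \<comment> \<open>The ends \<open>exp (- 1 / e)\<close> and \<open>exp (1 / e)\<close> correspond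
    to \<open>t = -1\<close> and \<open>t = 1\<close>, beyond which both profiles vanish.\<close>
  have "((\<lambda>r. (e / r) *\<^sub>R \<psi> (e * ln r)) has_integral (integral {e * ln ?l..e * ln ?u} \<psi>)) {?l..?u}"
  proof (rule has_integral_substitution[where c = "-1" and d = 1])
    show "(\<lambda>r. e * ln r) ` {?l..?u} \<subseteq> {- 1..1}"
    proof (rule image_subsetI)
      fix r assume "r \<in> {?l..?u}"
      then have r: "?l \<le> r" "r \<le> ?u" by auto
      have "0 < r" using r(1) by (rule pos)
      then have "- 1 / e \<le> ln r" "ln r \<le> 1 / e" using r by (metis exp_le_cancel_iff exp_ln)+
      then show "e * ln r \<in> {-1..1}" using e by (auto simp: field_simps)
    qed
    fix r assume "r \<in> {?l..?u}"
    then have "0 < r" by (intro pos) simp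
    then show "((\<lambda>r. e * ln r) has_real_derivative e / r) (at r within {?l..?u})"
      by (auto intro!: derivative_eq_intros)
  qed (use lu e c\<psi> in auto)
  then have "((\<lambda>r. (e / r) * \<psi> (e * ln r)) has_integral (integral {-1..1} \<psi>)) {?l..?u}"
    using e lu by simp
  from has_integral_mult_right[OF this, of "1 / e"]
  have "((\<lambda>r. 1 / r * \<psi> (e * ln r)) has_integral (integral {-1..1} \<psi> / e)) {?l..?u}"
    using e by simp
  then have "nnint {?l..?u} (\<lambda>r. 1 / r * \<psi> (e * ln r)) = ennreal (integral {-1..1} \<psi> / e)"
  proof (rule nn_integral_has_integral_lebesgue'[rotated])
    fix r assume "r \<in> {?l..?u}"
    then have "0 < r" by (intro pos) simp
    then show "0 \<le> 1 / r * \<psi> (e * ln r)" using nn by (simp add: \<psi>_def)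
  qed
  moreover have "nnint {?l..?u} (\<lambda>r. 1 / r * \<psi> (e * ln r)) = nnint {0<..} (\<lambda>r. 1 / r * \<psi> (e * ln r))"
  proof (intro nn_integral_cong)
    fix r :: real
    show "ennreal (1 / r * \<psi> (e * ln r)) * indicator {?l..?u} r = ennreal (1 / r * \<psi> (e * ln r)) * indicator {0<..} r"
      using z\<psi>[of r] pos[of r] by (cases "0 < r") (auto simp: indicator_def)
  qed
  ultimately show ?thesis
    unfolding wi \<psi>_def[abs_def] by simp
qed

section \<open>Test fields and their energies on the logarithmic scale\<close>

lemma cutoff_continuous: "cutoff \<psi> \<Longrightarrow> continuous_on A \<psi>"
  unfolding cutoff_def using Ck.simps(1) continuous_on_subset by blast

lemma profile_derivative:
  assumes "0 < r" "\<And>t. (\<psi> has_real_derivative \<psi>' t) (at t)"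
  shows "((\<lambda>r. r powr (- s) * \<psi> (e * ln r)) has_real_derivative
     r powr (- s) * (- s * \<psi> (e * ln r) + e * \<psi>' (e * ln r)) / r) (at r)"
proof -
  have "((\<lambda>r. \<psi> (e * ln r)) has_real_derivative \<psi>' (e * ln r) * (e / r)) (at r)"
    by (rule DERIV_chain2[OF assms(2)]) (use assms(1) in \<open>auto intro!: derivative_eq_intros\<close>)
  from DERIV_mult[OF has_real_derivative_powr[OF assms(1), of "- s"] this]
  show ?thesis
    by (rule DERIV_cong) (use assms(1) in \<open>auto simp: powr_diff field_simps\<close>)
qed

context
  fixes s :: real and X Y :: "real \<Rightarrow> real"
begin

text \<open>The tangential factor imposed by solenoidality: \<open>Q + \<sigma> Q'\<close> is the
  derivative of \<open>r^2 Q\<close> in \<open>r\<close> divided by \<open>2 r\<close>, here for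
  \<open>Q = r powr (- s) * X (e * ln r)\<close>, with the power of \<open>r\<close>
  removed.\<close>

definition tang_profile :: "real \<Rightarrow> real \<Rightarrow> real" where
  "tang_profile e t = ((2 - s) * X t + e * deriv X t) / 2"

definition field_density :: "real \<Rightarrow> real \<Rightarrow> real" where
  "field_density e t = 2/3 * (X t)\<^sup>2 + 4/3 * ((tang_profile e t)\<^sup>2 + (Y t)\<^sup>2)"

text \<open>The first line collects the terms with \<open>cos^2\<close>, the second those with
  \<open>sin^2\<close>. The swirl term \<open>(w / sin)^2\<close> has no angular dependence and
  therefore appears in both, and the polar derivative of the swirl accounts for the second
  \<open>(Y t)^2\<close> in the first line.\<close>

definition gradient_density :: "real \<Rightarrow> real \<Rightarrow> real" where
  "gradient_density e t =
     2/3 * ((- s * X t + e * deriv X t)\<^sup>2 + 2 * (X t - tang_profile e t)\<^sup>2 + 2 * (Y t)\<^sup>2)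
     + 4/3 * ((- s * tang_profile e t + e * (((2 - s) * deriv X t + e * deriv (deriv X) t) / 2))\<^sup>2
         + (- s * Y t + e * deriv Y t)\<^sup>2 + (tang_profile e t - X t)\<^sup>2 + (Y t)\<^sup>2)"

context
  assumes X: "cutoff X" and Y: "cutoff Y"
begin

lemma tang_profile_derivative:
  "(tang_profile e has_real_derivative ((2 - s) * deriv X t + e * deriv (deriv X) t) / 2) (at t)"
  unfolding tang_profile_def[abs_def]
  by (auto intro!: derivative_eq_intros cutoff_deriv(2)[OF X] cutoff_deriv(2)[OF cutoff_deriv(1)[OF X]])

text \<open>Both integrals carry the same factor \<open>2 \<pi> / \<epsilon>\<close>, so their
  quotient is a quotient of integrals over \<open>[-1, 1]\<close> that depend continuously on
  \<open>\<epsilon>\<close>, down to \<open>\<epsilon> = 0\<close>.\<close>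

lemma densities_of_test_field:
  assumes frame: "orthonormal_frame a b c" and \<epsilon>: "0 < \<epsilon>" and \<gamma>: "2 * \<gamma> = 2 * s - 1"
  obtains u where "admissible a b c \<gamma> u"
    "(\<integral>\<^sup>+x. ennreal (norm x powr (2*\<gamma> - 2) * (norm (u x))\<^sup>2) \<partial>lborel) = ennreal (2 * pi) * ennreal (integral {-1..1} (field_density \<epsilon>) / \<epsilon>)"
    "(\<integral>\<^sup>+x. ennreal (norm x powr (2*\<gamma>) * grad_sq u x) \<partial>lborel) = ennreal (2 * pi) * ennreal (integral {-1..1} (gradient_density \<epsilon>) / \<epsilon>)"
proof -
  \<comment> \<open>The profiles are functions of \<open>r^2\<close> and
    \<open>ln (r^2) = 2 ln r\<close>, so the scale and the exponents in \<open>Q\<close>,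
    \<open>Q'\<close> and \<open>Z\<close> are half of those in \<open>r\<close>.\<close>
  define \<beta> where "\<beta> = \<epsilon> / 2"
  have \<beta>: "0 < \<beta>" using \<epsilon> by (simp add: \<beta>_def)
  let ?X' = "\<lambda>t. (- s / 2) * X t + \<beta> * deriv X t"
  let ?X'' = "\<lambda>t. (- s / 2 - 1) * ?X' t + \<beta> * deriv ?X' t"
  define Q where "Q = log_profile \<beta> (- s / 2) X"
  define Q' where "Q' = log_profile \<beta> (- s / 2 - 1) ?X'"
  \<comment> \<open>The azimuthal component is \<open>r Z sin \<theta>\<close>; the extra
    \<open>r\<close> is why the exponent is \<open>- (s + 1) / 2\<close> instead of
    \<open>- s / 2\<close>.\<close>
  define Z where "Z = log_profile \<beta> (- (s + 1) / 2) Y"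
  have X': "cutoff ?X'" by (intro cutoff_lincomb cutoff_deriv X)
  note dQ = log_profile_has_derivative[OF \<beta> X, of "- s / 2", folded Q_def Q'_def]
  note dQ' = log_profile_has_derivative[OF \<beta> X', of "- s / 2 - 1", folded Q'_def]
  note dZ = log_profile_has_derivative[OF \<beta> Y, of "- (s + 1) / 2", folded Z_def]
  define u where "u = degree_one_field a b c Q Q' Z"
  have far: "log_profile \<beta> p \<psi> \<sigma> = 0" if "cutoff \<psi>" "exp (1 / \<beta>) < \<sigma>" for p \<psi> \<sigma>
  proof -
    have s0: "0 < \<sigma>" using that(2) exp_gt_zero[of "1 / \<beta>"] by linarith
    then have "1 / \<beta> < ln \<sigma>" using that(2) by (metis exp_less_cancel_iff exp_ln)
    then have "1 < \<bar>\<beta> * ln \<sigma>\<bar>" using \<beta> by (simp add: field_simps)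
    then show ?thesis using that(1) by (simp add: log_profile_def cutoff_def)
  qed
  have adm: "admissible a b c \<gamma> u"
    unfolding u_def
  proof (rule admissible_degree_one_field[OF frame dQ dQ' dZ])
    show "Ck k Q" "Ck k Q'" "Ck k Z" for k
      unfolding Q_def Q'_def Z_def by (rule Ck_log_profile[OF \<beta> X] Ck_log_profile[OF \<beta> X'] Ck_log_profile[OF \<beta> Y])+
    show "Q \<sigma> = 0 \<and> Q' \<sigma> = 0 \<and> Z \<sigma> = 0" if "exp (1 / \<beta>) < \<sigma>" for \<sigma>
      unfolding Q_def Q'_def Z_def using far X X' Y that by simp
    show "Q 0 = 0" by (simp add: Q_def log_profile_def)
  qed
  then have u1: "Ck (Suc 0) u"
    by (simp only: admissible_def test_field_def)
  define P where "P \<psi> r = r powr (- s) * \<psi> (\<epsilon> * ln r)" for \<psi> :: "real \<Rightarrow> real" and r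
  let ?H = "tang_profile \<epsilon>"
  let ?H' = "\<lambda>t. ((2 - s) * deriv X t + \<epsilon> * deriv (deriv X) t) / 2"
  let ?a = "\<lambda>t. - s * X t + \<epsilon> * deriv X t" and ?h = "\<lambda>t. - s * ?H t + \<epsilon> * ?H' t" and ?g = "\<lambda>t. - s * Y t + \<epsilon> * deriv Y t"
  have sq: "(r\<^sup>2) powr p = r powr (2 * p)" "ln (r\<^sup>2) = 2 * ln r" if "0 < r" for r p :: real
    using that powr_powr[of r 2 p] by (simp_all add: powr_numeral ln_realpow)
  have Qr: "Q (r\<^sup>2) = P X r" if "0 < r" for r
    using that by (simp add: Q_def log_profile_def sq P_def \<beta>_def)
  have Hr: "Q (r\<^sup>2) + r\<^sup>2 * Q' (r\<^sup>2) = P ?H r" if "0 < r" for r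
  proof -
    have "r\<^sup>2 * (r\<^sup>2) powr (- s / 2 - 1) = r powr (- s)"
      using that by (simp add: powr_diff sq)
    then have "r\<^sup>2 * Q' (r\<^sup>2) = r powr (- s) * ?X' (\<epsilon> * ln r)"
      using that by (simp add: Q'_def log_profile_def sq(2) \<beta>_def mult.assoc[symmetric])
    then show ?thesis
      unfolding Qr[OF that] P_def tang_profile_def \<beta>_def by (simp add: field_simps)
  qed
  have Zr: "r * Z (r\<^sup>2) = P Y r" if "0 < r" for r
  proof -
    have "r * (r\<^sup>2) powr (- (s + 1) / 2) = r powr (- s)"
    proof -
      have e: "2 * (- (s + 1) / 2) = - s - 1" by simp
      have "(r\<^sup>2) powr (- (s + 1) / 2) = r powr (- s - 1)"
        unfolding sq(1)[OF that] e ..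
      then show ?thesis using that by (simp add: powr_diff)
    qed
    then show ?thesis
      using that by (simp add: Z_def log_profile_def sq(2) \<beta>_def P_def mult.assoc[symmetric])
  qed
  have dP: "(P X has_real_derivative P ?a r / r) (at r)" "(P ?H has_real_derivative P ?h r / r) (at r)"
    "(P Y has_real_derivative P ?g r / r) (at r)" if "0 < r" for r
    unfolding P_def by (rule profile_derivative[OF that] cutoff_deriv(2)[OF X] cutoff_deriv(2)[OF Y] tang_profile_derivative)+
  have cc: "continuous_on A X" "continuous_on A Y" "continuous_on A (deriv X)" "continuous_on A (deriv (deriv X))" "continuous_on A (deriv Y)" for A
    by (intro cutoff_continuous cutoff_deriv X Y)+
  have cH: "continuous_on A ?H" "continuous_on A ?a" "continuous_on A ?h" "continuous_on A ?g" for A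
    unfolding tang_profile_def by (intro continuous_intros cc; simp)+
  have cP: "continuous_on ({0<..} \<times> UNIV) (\<lambda>z :: real \<times> real. P \<psi> (fst z))" if "\<And>A. continuous_on A \<psi>" for \<psi>
    unfolding P_def by (intro continuous_intros continuous_on_compose2[OF that[of UNIV]]) auto
  interpret spherical_components a b c u "\<lambda>r \<theta>. P X r * cos \<theta>" "\<lambda>r \<theta>. - P ?H r * sin \<theta>" "\<lambda>r \<theta>. P Y r * sin \<theta>"
    "\<lambda>r \<theta>. P ?a r / r * cos \<theta>" "\<lambda>r \<theta>. - (P ?h r / r) * sin \<theta>" "\<lambda>r \<theta>. P ?g r / r * sin \<theta>"
    "\<lambda>r \<theta>. - P X r * sin \<theta>" "\<lambda>r \<theta>. - P ?H r * cos \<theta>" "\<lambda>r \<theta>. P Y r * cos \<theta>"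
  proof unfold_locales
    show "orthonormal_frame a b c" by (rule frame)
    show "u differentiable at x" for x using u1 by simp
    show "u (r *\<^sub>R e_rho a b c \<theta> \<phi>) = (P X r * cos \<theta>) *\<^sub>R e_rho a b c \<theta> \<phi>
        + (- P ?H r * sin \<theta>) *\<^sub>R e_theta a b c \<theta> \<phi> + (P Y r * sin \<theta>) *\<^sub>R e_phi a b \<phi>"
      if "0 < r" for r \<theta> \<phi>
      unfolding u_def degree_one_field_spherical[OF frame] Hr[OF that] Zr[OF that] unfolding Qr[OF that] ..
    fix r \<theta> :: real assume r: "0 < r"
    show "((\<lambda>r. P X r * cos \<theta>) has_real_derivative P ?a r / r * cos \<theta>) (at r)"
      "((\<lambda>r. - P ?H r * sin \<theta>) has_real_derivative - (P ?h r / r) * sin \<theta>) (at r)"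
      "((\<lambda>r. P Y r * sin \<theta>) has_real_derivative P ?g r / r * sin \<theta>) (at r)"
      by (intro DERIV_cmult_right DERIV_minus dP r)+
    show "((\<lambda>\<theta>. P X r * cos \<theta>) has_real_derivative - P X r * sin \<theta>) (at \<theta>)"
      "((\<lambda>\<theta>. - P ?H r * sin \<theta>) has_real_derivative - P ?H r * cos \<theta>) (at \<theta>)"
      "((\<lambda>\<theta>. P Y r * sin \<theta>) has_real_derivative P Y r * cos \<theta>) (at \<theta>)"
      by (auto intro!: derivative_eq_intros)
  qed (intro continuous_intros cP cc cH; auto)+
  have P2: "(P \<psi> r)\<^sup>2 = r powr (- 2 * s) * (\<psi> (\<epsilon> * ln r))\<^sup>2" for \<psi> r
  proof -
    have "(r powr (- s))\<^sup>2 = r powr (- 2 * s)" by (simp add: power2_eq_square powr_add[symmetric])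
    then show ?thesis by (simp add: P_def power_mult_distrib)
  qed
  have Pd: "P \<psi> r - P \<eta> r = P (\<lambda>t. \<psi> t - \<eta> t) r" for \<psi> \<eta> r
    by (simp add: P_def right_diff_distrib)
  have zero: "X t = 0" "Y t = 0" "deriv X t = 0" "deriv (deriv X) t = 0" "deriv Y t = 0" if "1 < \<bar>t\<bar>" for t
    using that X Y cutoff_deriv(1)[OF X] cutoff_deriv(1)[OF cutoff_deriv(1)[OF X]] cutoff_deriv(1)[OF Y] by (auto simp: cutoff_def)
  let ?NA = "\<lambda>t. (X t)\<^sup>2" and ?NB = "\<lambda>t. (?H t)\<^sup>2 + (Y t)\<^sup>2"
  let ?DA = "\<lambda>t. (?a t)\<^sup>2 + 2 * (X t - ?H t)\<^sup>2 + 2 * (Y t)\<^sup>2" and ?DB = "\<lambda>t. (?h t)\<^sup>2 + (?g t)\<^sup>2 + (?H t - X t)\<^sup>2 + (Y t)\<^sup>2"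
  have "wint \<gamma> (\<lambda>r \<theta>. (P X r * cos \<theta>)\<^sup>2 + (- P ?H r * sin \<theta>)\<^sup>2 + (P Y r * sin \<theta>)\<^sup>2)
      = wint \<gamma> (\<lambda>r \<theta>. r powr (- 2 * s) * (?NA (\<epsilon> * ln r) * (cos \<theta>)\<^sup>2 + ?NB (\<epsilon> * ln r) * (sin \<theta>)\<^sup>2))"
    unfolding power_mult_distrib power2_minus P2 by (rule wint_cong) (simp add: algebra_simps)
  also have "\<dots> = ennreal (integral {-1..1} (field_density \<epsilon>) / \<epsilon>)"
    unfolding field_density_def[abs_def]
    by (rule wint_log_profile[OF \<gamma> \<epsilon>]) (auto intro!: continuous_intros cc cH simp: zero tang_profile_def)
  finally have N: "(\<integral>\<^sup>+x. ennreal (norm x powr (2*\<gamma> - 2) * (norm (u x))\<^sup>2) \<partial>lborel) = ennreal (2 * pi) * ennreal (integral {-1..1} (field_density \<epsilon>) / \<epsilon>)"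
    unfolding field_integral[OF u1] by simp
  have "wint \<gamma> (\<lambda>r \<theta>. (r * (P ?a r / r * cos \<theta>))\<^sup>2 + (r * (- (P ?h r / r) * sin \<theta>))\<^sup>2 + (r * (P ?g r / r * sin \<theta>))\<^sup>2
     + ((- P X r * sin \<theta> - - P ?H r * sin \<theta>)\<^sup>2 + (- P ?H r * cos \<theta> + P X r * cos \<theta>)\<^sup>2 + (P X r * cos \<theta> + - P ?H r * sin \<theta> * (cos \<theta> / sin \<theta>))\<^sup>2)
     + ((P Y r * cos \<theta>)\<^sup>2 + (P Y r * sin \<theta> / sin \<theta>)\<^sup>2))
    = wint \<gamma> (\<lambda>r \<theta>. r powr (- 2 * s) * (?DA (\<epsilon> * ln r) * (cos \<theta>)\<^sup>2 + ?DB (\<epsilon> * ln r) * (sin \<theta>)\<^sup>2))"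
  proof (rule wint_cong)
    fix r \<theta> :: real assume r: "0 < r" and t: "0 < \<theta>" "\<theta> < pi"
    have s0: "sin \<theta> \<noteq> 0" using sin_gt_zero[OF t] by simp
    have 1: "- P X r * sin \<theta> - - P ?H r * sin \<theta> = P (\<lambda>t. ?H t - X t) r * sin \<theta>"
      "- P ?H r * cos \<theta> + P X r * cos \<theta> = P (\<lambda>t. X t - ?H t) r * cos \<theta>"
      "P X r * cos \<theta> + - P ?H r * sin \<theta> * (cos \<theta> / sin \<theta>) = P (\<lambda>t. X t - ?H t) r * cos \<theta>"
      "P Y r * sin \<theta> / sin \<theta> = P Y r"
      using s0 by (simp_all add: Pd[symmetric] algebra_simps)
    have 2: "r * (P ?a r / r * cos \<theta>) = P ?a r * cos \<theta>" "r * (- (P ?h r / r) * sin \<theta>) = - P ?h r * sin \<theta>"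
      "r * (P ?g r / r * sin \<theta>) = P ?g r * sin \<theta>"
      using r by simp_all
    show "(r * (P ?a r / r * cos \<theta>))\<^sup>2 + (r * (- (P ?h r / r) * sin \<theta>))\<^sup>2 + (r * (P ?g r / r * sin \<theta>))\<^sup>2
     + ((- P X r * sin \<theta> - - P ?H r * sin \<theta>)\<^sup>2 + (- P ?H r * cos \<theta> + P X r * cos \<theta>)\<^sup>2 + (P X r * cos \<theta> + - P ?H r * sin \<theta> * (cos \<theta> / sin \<theta>))\<^sup>2)
     + ((P Y r * cos \<theta>)\<^sup>2 + (P Y r * sin \<theta> / sin \<theta>)\<^sup>2)
     = r powr (- 2 * s) * (?DA (\<epsilon> * ln r) * (cos \<theta>)\<^sup>2 + ?DB (\<epsilon> * ln r) * (sin \<theta>)\<^sup>2)"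
      unfolding 1 2 power_mult_distrib power2_minus P2 by (simp add: sin_squared_eq algebra_simps)
  qed
  also have "\<dots> = ennreal (integral {-1..1} (gradient_density \<epsilon>) / \<epsilon>)"
    unfolding gradient_density_def[abs_def]
    by (rule wint_log_profile[OF \<gamma> \<epsilon>]) (auto intro!: continuous_intros cc cH simp: zero tang_profile_def)
  finally have D: "(\<integral>\<^sup>+x. ennreal (norm x powr (2*\<gamma>) * grad_sq u x) \<partial>lborel) = ennreal (2 * pi) * ennreal (integral {-1..1} (gradient_density \<epsilon>) / \<epsilon>)"
    unfolding gradient_integral[OF u1] by simp
  show ?thesis by (rule that[OF adm N D])
qed

text \<open>As \<open>\<epsilon>\<close> tends to 0 the cutoff is stretched over ever more decades,
  and all terms with its derivatives drop out of the densities. The limiting statement concerns pure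
  powers, for which both densities are quadratic in \<open>X\<close> and \<open>Y\<close>
  alone.\<close>

lemma hardy_leray_limit:
  assumes frame: "orthonormal_frame a b c" and \<gamma>: "2 * \<gamma> = 2 * s - 1" and C: "hardy_leray a b c \<gamma> C"
  shows "integral {-1..1} (field_density 0) \<le> max 0 C * integral {-1..1} (gradient_density 0)"
proof -
  have cc: "continuous_on A X" "continuous_on A Y" "continuous_on A (deriv X)" "continuous_on A (deriv (deriv X))" "continuous_on A (deriv Y)" for A
    by (intro cutoff_continuous cutoff_deriv X Y)+
  have comp: "continuous_on S (\<lambda>z :: real \<times> real. f (snd z))" if "\<And>A. continuous_on A f" for f :: "real \<Rightarrow> real" and S
    by (rule continuous_on_compose2[OF that[of UNIV]]) (auto intro!: continuous_intros)
  have cf: "continuous_on UNIV (\<lambda>e. integral (cbox (-1) 1) (field_density e))"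
  proof (rule integral_continuous_on_param)
    show "continuous_on (UNIV \<times> cbox (-1) 1) (\<lambda>(e, t). field_density e t)"
      unfolding case_prod_beta field_density_def tang_profile_def by (intro continuous_intros comp cc) simp_all
  qed
  have cg: "continuous_on UNIV (\<lambda>e. integral (cbox (-1) 1) (gradient_density e))"
  proof (rule integral_continuous_on_param)
    show "continuous_on (UNIV \<times> cbox (-1) 1) (\<lambda>(e, t). gradient_density e t)"
      unfolding case_prod_beta gradient_density_def tang_profile_def by (intro continuous_intros comp cc) simp_all
  qed
  have lim: "((\<lambda>e. integral {-1..1} (field_density e)) \<longlongrightarrow> integral {-1..1} (field_density 0)) (at_right 0)"
    "((\<lambda>e. integral {-1..1} (gradient_density e)) \<longlongrightarrow> integral {-1..1} (gradient_density 0)) (at_right 0)"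
    using cf cg by (auto simp: cbox_interval continuous_on_def intro: filterlim_mono[OF _ order_refl at_le[OF subset_UNIV]])
  have nn: "0 \<le> field_density e t" "0 \<le> gradient_density e t" for e t
    by (simp_all add: field_density_def gradient_density_def)
  have int: "field_density e integrable_on {-1..1}" "gradient_density e integrable_on {-1..1}" for e
    unfolding field_density_def[abs_def] gradient_density_def[abs_def] tang_profile_def[abs_def]
    by (intro integrable_continuous_real continuous_intros cc; simp)+
  have le: "integral {-1..1} (field_density e) \<le> max 0 C * integral {-1..1} (gradient_density e)" if e: "0 < e" for e
  proof -
    let ?N = "integral {-1..1} (field_density e)" and ?D = "integral {-1..1} (gradient_density e)"
    have N0: "0 \<le> ?N" and D0: "0 \<le> ?D" by (intro integral_nonneg int nn)+
    obtain u where u: "admissible a b c \<gamma> u"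
      "(\<integral>\<^sup>+x. ennreal (norm x powr (2*\<gamma> - 2) * (norm (u x))\<^sup>2) \<partial>lborel) = ennreal (2 * pi) * ennreal (?N / e)"
      "(\<integral>\<^sup>+x. ennreal (norm x powr (2*\<gamma>) * grad_sq u x) \<partial>lborel) = ennreal (2 * pi) * ennreal (?D / e)"
      using densities_of_test_field[OF frame e \<gamma>] by blast
    have "ennreal (2 * pi) * ennreal (?N / e) \<le> ennreal C * (ennreal (2 * pi) * ennreal (?D / e))"
      using C u(1) unfolding hardy_leray_def u(2,3)[symmetric] by blast
    \<comment> \<open>A negative \<open>C\<close> acts as 0 in \<open>ennreal\<close>; its
      nonnegative part is what survives the passage to real numbers.\<close>
    also have "ennreal C = ennreal (max 0 C)" by (simp add: ennreal_max_0)
    also have "ennreal (2 * pi) * ennreal (?N / e) = ennreal (2 * pi * (?N / e))"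
      using N0 e by (intro ennreal_mult[symmetric]) auto
    also have "ennreal (2 * pi) * ennreal (?D / e) = ennreal (2 * pi * (?D / e))"
      using D0 e by (intro ennreal_mult[symmetric]) auto
    also have "ennreal (max 0 C) * \<dots> = ennreal (max 0 C * (2 * pi * (?D / e)))"
      using D0 e by (intro ennreal_mult[symmetric]) auto
    finally have "ennreal (2 * pi * (?N / e)) \<le> ennreal (max 0 C * (2 * pi * (?D / e)))" .
    then have "2 * pi * (?N / e) \<le> max 0 C * (2 * pi * (?D / e))"
      using D0 e by (subst (asm) ennreal_le_iff) auto
    then have "(2 * pi / e) * ?N \<le> (2 * pi / e) * (max 0 C * ?D)"
      by (simp add: mult_ac)
    then show ?thesis
      using e by (subst (asm) mult_le_cancel_left_pos) auto
  qed
  show ?thesis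
  proof (rule tendsto_le[OF _ tendsto_mult[OF tendsto_const lim(2)] lim(1)])
    show "eventually (\<lambda>e. integral {-1..1} (field_density e) \<le> max 0 C * integral {-1..1} (gradient_density e)) (at_right 0)"
      using le by (auto simp: eventually_at_filter)
  qed simp
qed

end
end

section \<open>Optimality of the constant\<close>

lemma C3_le_of_ratio:
  assumes frame: "orthonormal_frame a b c" and \<gamma>: "\<gamma> \<noteq> -1/2" and C: "hardy_leray a b c \<gamma> C"
    and X: "cutoff X" and Y: "cutoff Y"
    and ratio: "\<And>t. gradient_density (\<gamma> + 1/2) X Y 0 t = ((\<gamma> + 1/2)\<^sup>2 + C3_gap \<gamma>) * field_density (\<gamma> + 1/2) X Y 0 t"
    and pos: "0 < field_density (\<gamma> + 1/2) X Y 0 0"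
  shows "C3 \<gamma> \<le> C"
proof -
  let ?K = "(\<gamma> + 1/2)\<^sup>2 + C3_gap \<gamma>"
  let ?N = "field_density (\<gamma> + 1/2) X Y 0"
  let ?I = "integral {-1..1} ?N"
  have c: "continuous_on {-1..1} ?N"
    unfolding field_density_def[abs_def] tang_profile_def[abs_def]
    by (intro continuous_intros cutoff_continuous cutoff_deriv X Y; simp)
  have nn: "0 \<le> ?N t" for t by (simp add: field_density_def)
  \<comment> \<open>A continuous nonnegative function with zero integral vanishes identically, so
    positivity at the single point 0 suffices to divide by the integral.\<close>
  have "?I \<noteq> 0"
  proof
    assume "?I = 0"
    then have "(?N has_integral 0) (cbox (-1) 1)"
      using integrable_integral[OF integrable_continuous_real[OF c]] by (simp add: cbox_interval)
    from has_integral_0_cbox_imp_0[OF _ _ this, of 0] pos c nn show False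
      by (simp add: cbox_interval box_real)
  qed
  moreover have "0 \<le> ?I"
    by (intro integral_nonneg integrable_continuous_real c nn)
  ultimately have I: "0 < ?I" by simp
  have "?I \<le> max 0 C * integral {-1..1} (gradient_density (\<gamma> + 1/2) X Y 0)"
    by (rule hardy_leray_limit[OF X Y frame _ C]) simp
  also have "integral {-1..1} (gradient_density (\<gamma> + 1/2) X Y 0) = ?K * ?I"
    unfolding ratio by (rule integral_mult_right)
  finally have "1 * ?I \<le> (max 0 C * ?K) * ?I" by (simp add: mult.assoc)
  then have "1 \<le> max 0 C * ?K" using I by (subst (asm) mult_le_cancel_right_pos) auto
  then have "C3 \<gamma> \<le> max 0 C"
    using C3_eq[OF \<gamma>] by (simp add: divide_le_eq)
  \<comment> \<open>Positivity of \<open>C3\<close> rules out the branch \<open>max 0 C = 0\<close>,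
    that is a nonpositive \<open>C\<close>.\<close>
  moreover have "0 < C3 \<gamma>" using C3_eq[OF \<gamma>] by simp
  ultimately show ?thesis by (simp add: max_def split: if_splits)
qed

text \<open>At zero scale the quotient of gradient to field density is
  \<open>S^2 + 2 S^2 / (2 + (2 - S)^2)\<close> for the poloidal field and \<open>S^2 + 2\<close> for
  the swirl, where \<open>S = \<gamma> + 1/2\<close>. In each range of \<open>\<gamma>\<close> the
  field with the smaller quotient is taken, and that quotient is the reciprocal of
  \<open>C3\<close>.\<close>

lemma C3_optimal:
  assumes frame: "orthonormal_frame a b c" and \<gamma>: "\<gamma> \<noteq> -1/2" and C: "hardy_leray a b c \<gamma> C"
  shows "C3 \<gamma> \<le> C"
proof -
  have bump: "cutoff bump" using Ck_bump bump_support by (simp add: cutoff_def)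
  have zero: "cutoff (\<lambda>t. 0)" by (simp add: cutoff_def Ck_const)
  show ?thesis
  proof (cases "\<gamma> \<le> 1")
    case True
    show ?thesis
    proof (rule C3_le_of_ratio[OF frame \<gamma> C bump zero])
      fix t
      have q: "2 + (\<gamma> - 3/2)\<^sup>2 \<noteq> 0"
        using zero_le_power2[of "\<gamma> - 3/2"] by linarith
      show "gradient_density (\<gamma> + 1/2) bump (\<lambda>t. 0) 0 t = ((\<gamma> + 1/2)\<^sup>2 + C3_gap \<gamma>) * field_density (\<gamma> + 1/2) bump (\<lambda>t. 0) 0 t"
      proof -
        define S where "S = \<gamma> + 1/2"
        have g: "C3_gap \<gamma> * (2 + (2 - S)\<^sup>2) = 2 * S\<^sup>2"
        proof -
          have e: "2 - S = - (\<gamma> - 3/2)" by (simp add: S_def)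
          show ?thesis using q True unfolding e power2_minus by (simp add: C3_gap_def S_def)
        qed
        have fd: "field_density S bump (\<lambda>t. 0) 0 t = (2 + (2 - S)\<^sup>2) * (bump t)\<^sup>2 / 3"
          by (simp add: field_density_def tang_profile_def power2_eq_square field_simps)
        have gd: "gradient_density S bump (\<lambda>t. 0) 0 t = (S\<^sup>2 * (2 + (2 - S)\<^sup>2) + 2 * S\<^sup>2) * (bump t)\<^sup>2 / 3"
          by (simp add: gradient_density_def tang_profile_def power2_eq_square field_simps)
        show ?thesis
          unfolding S_def[symmetric] fd gd g[symmetric] by (simp add: algebra_simps)
      qed
      show "0 < field_density (\<gamma> + 1/2) bump (\<lambda>t. 0) 0 0"
        using bump_pos by (simp add: field_density_def add_pos_nonneg)
    qed
  next
    case False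
    show ?thesis
    proof (rule C3_le_of_ratio[OF frame \<gamma> C zero bump])
      fix t
      define S where "S = \<gamma> + 1/2"
      have "gradient_density S (\<lambda>t. 0) bump 0 t = (S\<^sup>2 + 2) * field_density S (\<lambda>t. 0) bump 0 t"
        by (simp add: gradient_density_def field_density_def tang_profile_def power_mult_distrib algebra_simps)
      then show "gradient_density (\<gamma> + 1/2) (\<lambda>t. 0) bump 0 t = ((\<gamma> + 1/2)\<^sup>2 + C3_gap \<gamma>) * field_density (\<gamma> + 1/2) (\<lambda>t. 0) bump 0 t"
        using False by (simp add: S_def C3_gap_def)
      show "0 < field_density (\<gamma> + 1/2) (\<lambda>t. 0) bump 0 0"
        using bump_pos by (simp add: field_density_def tang_profile_def)
    qed
  qed
qed

theorem corollary1:
  fixes \<gamma> :: real and a b c :: "real^3"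
  assumes "\<gamma> \<noteq> -1/2"
    and "orthonormal_frame a b c"
  shows "hardy_leray a b c \<gamma> (C3 \<gamma>) \<and> (\<forall>C. hardy_leray a b c \<gamma> C \<longrightarrow> C3 \<gamma> \<le> C)"
  using hardy_leray_C3[OF assms] C3_optimal[OF assms(2,1)] by blast

end
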